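(* Let $q\ge 1$ be an integer. (1) For every $\sigma,\delta\ge 1$, Vertex Deletion to $q$-Coloring on $n$-vertex graphs can be solved in time $(q+1)^{p}\cdot n^{\mathcal{O}(1)}$ if a $(\sigma,\delta)$-hub of size $p$ is given in the input. (2) For every $\epsilon>0$, there exist integers $\sigma,\delta\ge 1$ such that if there is an algorithm solving in time $(q+1-\epsilon)^{p}\cdot n^{\mathcal{O}(1)}$ every $n$-vertex instance of Vertex Deletion to $q$-Coloring given with a $(\sigma,\delta)$-hub of size at most $p$, then the SETH fails.
   Context: For a graph $G$ and integers $\sigma,\delta\ge 1$, a set $Q\subseteq V(G)$ is a $(\sigma,\delta)$-hub of $G$ if every connected component of $G-Q$ has at most $\sigma$ vertices and each such component is adjacent (in $G$) to at most $\delta$ vertices of $Q$. Vertex Deletion to $q$-Coloring: given a graph $G$, find a minimum-size set $X$ of vertices such that $G-X$ admits a proper $q$-coloring (a map $V(G-X)\to\{1,\dots,q\}$ giving adjacent vertices different colors). (For $q=1$ this is Vertex Cover; for $q=2$ Odd Cycle Transversal.) The SETH: there is no $\epsilon>0$ such that for every $k$, every $n$-variable instance of $k$-SAT can be solved in time $(2-\epsilon)^n\cdot n^{\mathcal{O}(1)}$. *)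

theory Defs
  imports "Graph_Theory.Graph_Theory" "HOL-Library.Log_Nat"
begin

section \<open>Graphs, hubs, and Vertex Deletion to q-Coloring\<close>

text \<open>
  A finite simple undirected graph is a \<^const>\<open>pair_graph\<close>: a finite, loop-free digraph with a
  symmetric set of arcs. In such a graph the strongly connected components are exactly the
  connected components.
\<close>

definition delete_verts :: "'a pair_pre_digraph \<Rightarrow> 'a set \<Rightarrow> ('a, 'a \<times> 'a) pre_digraph" where
  "delete_verts G X = with_proj G \<restriction> (pverts G - X)"

definition hub :: "nat \<Rightarrow> nat \<Rightarrow> 'a pair_pre_digraph \<Rightarrow> 'a set \<Rightarrow> bool" where
  "hub \<sigma> \<delta> G Q \<longleftrightarrow> Q \<subseteq> pverts G \<and>
     (\<forall>C \<in> pre_digraph.sccs (delete_verts G Q).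
        card (verts C) \<le> \<sigma> \<and>
        card {v \<in> Q. \<exists>u \<in> verts C. (u, v) \<in> parcs G} \<le> \<delta>)"

definition proper_coloring :: "nat \<Rightarrow> ('a, 'b) pre_digraph \<Rightarrow> ('a \<Rightarrow> nat) \<Rightarrow> bool" where
  "proper_coloring q H f \<longleftrightarrow>
     (\<forall>v \<in> verts H. f v \<in> {1..q}) \<and> (\<forall>(u, v) \<in> arcs_ends H. f u \<noteq> f v)"

definition coloring_deletion_set :: "nat \<Rightarrow> 'a pair_pre_digraph \<Rightarrow> 'a set \<Rightarrow> bool" where
  "coloring_deletion_set q G X \<longleftrightarrow>
     X \<subseteq> pverts G \<and> (\<exists>f. proper_coloring q (delete_verts G X) f)"

definition min_coloring_deletion_set :: "nat \<Rightarrow> 'a pair_pre_digraph \<Rightarrow> 'a set \<Rightarrow> bool" where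
  "min_coloring_deletion_set q G X \<longleftrightarrow>
     coloring_deletion_set q G X \<and> (\<forall>Y. coloring_deletion_set q G Y \<longrightarrow> card X \<le> card Y)"


section \<open>Random access machines with logarithmic cost\<close>

text \<open>
  Programs use finitely many registers and finitely many unbounded arrays, all holding natural
  numbers; array cells are addressed indirectly through registers. Every step is charged one unit
  plus the bit lengths of the numbers and addresses it handles. Up to factors polylogarithmic in
  the running time this agrees with the usual (word) RAM model, and for running times of the form
  \<open>c\<^sup>n \<cdot> n\<^bsup>O(1)\<^esup>\<close> such factors are absorbed by \<open>n\<^bsup>O(1)\<^esup>\<close>.
\<close>

datatype prog =
    Skip
  | Const nat nat         \<comment> \<open>\<open>Const x c\<close>: \<open>x := c\<close>\<close>
  | Add nat nat nat       \<comment> \<open>\<open>Add x y z\<close>: \<open>x := y + z\<close>\<close>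
  | Sub nat nat nat       \<comment> \<open>\<open>Sub x y z\<close>: \<open>x := y - z\<close>, truncated at 0\<close>
  | Load nat nat nat      \<comment> \<open>\<open>Load x a y\<close>: \<open>x := a[y]\<close>\<close>
  | Store nat nat nat     \<comment> \<open>\<open>Store a x y\<close>: \<open>a[x] := y\<close>\<close>
  | Seq prog prog
  | If nat prog prog      \<comment> \<open>the first branch is taken iff the register is nonzero\<close>
  | While nat prog        \<comment> \<open>loops as long as the register is nonzero\<close>

record ram_state =
  regs :: "nat \<Rightarrow> nat"
  arrs :: "nat \<Rightarrow> nat \<Rightarrow> nat"

abbreviation bit_len :: "nat \<Rightarrow> nat" where
  "bit_len \<equiv> floorlog 2"

definition set_reg :: "nat \<Rightarrow> nat \<Rightarrow> ram_state \<Rightarrow> ram_state" where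
  "set_reg x v s = s\<lparr>regs := (regs s)(x := v)\<rparr>"

definition set_cell :: "nat \<Rightarrow> nat \<Rightarrow> nat \<Rightarrow> ram_state \<Rightarrow> ram_state" where
  "set_cell a i v s = s\<lparr>arrs := (arrs s)(a := (arrs s a)(i := v))\<rparr>"

text \<open>\<open>exec P s t s'\<close>: started in \<open>s\<close>, program \<open>P\<close> halts in \<open>s'\<close> with total cost \<open>t\<close>.\<close>

inductive exec :: "prog \<Rightarrow> ram_state \<Rightarrow> nat \<Rightarrow> ram_state \<Rightarrow> bool" where
  Skip: "exec Skip s 1 s"
| Const: "exec (Const x c) s (1 + bit_len c) (set_reg x c s)"
| Add: "exec (Add x y z) s (1 + bit_len (regs s y) + bit_len (regs s z))
     (set_reg x (regs s y + regs s z) s)"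
| Sub: "exec (Sub x y z) s (1 + bit_len (regs s y) + bit_len (regs s z))
     (set_reg x (regs s y - regs s z) s)"
| Load: "exec (Load x a y) s (1 + bit_len (regs s y) + bit_len (arrs s a (regs s y)))
     (set_reg x (arrs s a (regs s y)) s)"
| Store: "exec (Store a x y) s (1 + bit_len (regs s x) + bit_len (regs s y))
     (set_cell a (regs s x) (regs s y) s)"
| Seq: "\<lbrakk>exec P s t s'; exec P' s' t' s''\<rbrakk> \<Longrightarrow> exec (Seq P P') s (t + t') s''"
| If_nonzero: "\<lbrakk>regs s x \<noteq> 0; exec P s t s'\<rbrakk>
     \<Longrightarrow> exec (If x P P') s (1 + bit_len (regs s x) + t) s'"
| If_zero: "\<lbrakk>regs s x = 0; exec P' s t s'\<rbrakk> \<Longrightarrow> exec (If x P P') s (1 + t) s'"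
| While_zero: "regs s x = 0 \<Longrightarrow> exec (While x P) s 1 s"
| While_nonzero: "\<lbrakk>regs s x \<noteq> 0; exec P s t s'; exec (While x P) s' t' s''\<rbrakk>
     \<Longrightarrow> exec (While x P) s (1 + bit_len (regs s x) + t + t') s''"

inductive_cases exec_elims:
  "exec Skip s t s'"
  "exec (Const x c) s t s'"
  "exec (Add x y z) s t s'"
  "exec (Sub x y z) s t s'"
  "exec (Load x a y) s t s'"
  "exec (Store a x y) s t s'"
  "exec (Seq P P') s t s'"
  "exec (If x P P') s t s'"
  "exec (While x P) s t s'"

lemma exec_deterministic:
  assumes "exec P s t s'" and "exec P s u s''"
  shows "t = u \<and> s' = s''"
  using assms
proof (induction arbitrary: u s'' rule: exec.induct)
  case (Seq P s t s' P' t' s2)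
  show ?case by (rule exec_elims(7)[OF Seq.prems]) (metis Seq.IH)
next
  case (If_nonzero s x P t s' P')
  from If_nonzero.hyps(1) obtain v where "u = 1 + bit_len (regs s x) + v" "exec P s v s''"
    by (auto intro: exec_elims(8)[OF If_nonzero.prems])
  with If_nonzero.IH[OF this(2)] show ?case by simp
next
  case (If_zero s x P' t s' P)
  from If_zero.hyps(1) obtain v where "u = 1 + v" "exec P' s v s''"
    by (auto intro: exec_elims(8)[OF If_zero.prems])
  with If_zero.IH[OF this(2)] show ?case by simp
next
  case (While_zero s x P)
  then show ?case by (auto intro: exec_elims(9)[OF While_zero.prems])
next
  case (While_nonzero s x P t s' t' s2)
  from While_nonzero.hyps(1) obtain v w r
    where *: "u = 1 + bit_len (regs s x) + v + w" "exec P s v r" "exec (While x P) r w s''"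
    by (auto intro: exec_elims(9)[OF While_nonzero.prems])
  from While_nonzero.IH(1)[OF *(2)] have "t = v" "s' = r" by simp_all
  with While_nonzero.IH(2) * show ?case by simp
qed (erule exec_elims; simp)+

lemma exec_cost_pos: "exec P s t s' \<Longrightarrow> t \<ge> 1"
  by (induction rule: exec.induct) auto

text \<open>
  The input is a list of numbers stored in array 0, everything else being 0 initially; the output
  is the final content of array 1.
\<close>

definition initial_state :: "nat list \<Rightarrow> ram_state" where
  "initial_state xs =
     \<lparr>regs = (\<lambda>_. 0), arrs = (\<lambda>_ _. 0)(0 := (\<lambda>i. if i < length xs then xs ! i else 0))\<rparr>"

definition computes :: "prog \<Rightarrow> nat list \<Rightarrow> nat \<Rightarrow> (nat \<Rightarrow> nat) \<Rightarrow> bool" where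
  "computes P xs t out \<longleftrightarrow> (\<exists>s. exec P (initial_state xs) t s \<and> out = arrs s 1)"

text \<open>
  A running time \<open>B \<cdot> n\<^bsup>O(1)\<^esup>\<close> is a bound \<open>B * poly_factor c n\<close> for a constant \<open>c\<close>; the
  \<open>+ 1\<close> only matters for \<open>n \<le> 1\<close>.
\<close>

definition poly_factor :: "nat \<Rightarrow> nat \<Rightarrow> real" where
  "poly_factor c n = real c * (real n + 1) ^ c"


section \<open>Algorithms for Vertex Deletion to q-Coloring\<close>

definition input_graph :: "nat pair_pre_digraph \<Rightarrow> bool" where
  "input_graph G \<longleftrightarrow> pair_graph G \<and> pverts G = {..<card (pverts G)}"

text \<open>The number of vertices, the adjacency matrix row by row, the characteristic vector of \<open>Q\<close>.\<close>

definition encode_instance :: "nat pair_pre_digraph \<Rightarrow> nat set \<Rightarrow> nat list" where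
  "encode_instance G Q = (let n = card (pverts G) in
     n # concat (map (\<lambda>u. map (\<lambda>v. of_bool ((u, v) \<in> parcs G)) [0..<n]) [0..<n])
       @ map (\<lambda>v. of_bool (v \<in> Q)) [0..<n])"

text \<open>
  On input \<open>G\<close> and \<open>Q\<close>, program \<open>P\<close> outputs the characteristic vector of an optimal solution
  at cost at most \<open>T\<close>.
\<close>

definition solves_deletion_within ::
    "prog \<Rightarrow> nat \<Rightarrow> nat pair_pre_digraph \<Rightarrow> nat set \<Rightarrow> real \<Rightarrow> bool" where
  "solves_deletion_within P q G Q T \<longleftrightarrow>
     (\<exists>t out. computes P (encode_instance G Q) t out \<and> real t \<le> T \<and>
        min_coloring_deletion_set q G {v \<in> pverts G. out v = 1})"


section \<open>k-SAT and the SETH\<close>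

text \<open>
  The literal \<open>(v, b)\<close> is true iff variable \<open>v\<close> has value \<open>b\<close>. Lists represent a set of clauses,
  each a set of literals, so that for fixed \<open>k\<close> the formula has size polynomial in the number
  of variables.
\<close>

type_synonym cnf = "(nat \<times> bool) list list"

definition k_cnf :: "nat \<Rightarrow> nat \<Rightarrow> cnf \<Rightarrow> bool" where
  "k_cnf k n \<phi> \<longleftrightarrow> distinct (map set \<phi>) \<and>
     (\<forall>cl \<in> set \<phi>. distinct cl \<and> length cl \<le> k \<and> (\<forall>(v, b) \<in> set cl. v < n))"

definition satisfiable :: "cnf \<Rightarrow> bool" where
  "satisfiable \<phi> \<longleftrightarrow> (\<exists>\<alpha>. \<forall>cl \<in> set \<phi>. \<exists>(v, b) \<in> set cl. \<alpha> v = b)"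

definition encode_cnf :: "nat \<Rightarrow> cnf \<Rightarrow> nat list" where
  "encode_cnf n \<phi> =
     n # length \<phi> # concat (map (\<lambda>cl. length cl # map (\<lambda>(v, b). 2 * v + of_bool b) cl) \<phi>)"

definition solves_sat_within :: "prog \<Rightarrow> nat \<Rightarrow> cnf \<Rightarrow> real \<Rightarrow> bool" where
  "solves_sat_within P n \<phi> T \<longleftrightarrow>
     (\<exists>t out. computes P (encode_cnf n \<phi>) t out \<and> real t \<le> T \<and>
        out 0 = of_bool (satisfiable \<phi>))"

definition SETH :: bool where
  "SETH \<longleftrightarrow> \<not> (\<exists>\<epsilon>::real > 0. \<forall>k. \<exists>P c. \<forall>n \<phi>. k_cnf k n \<phi> \<longrightarrow>
     solves_sat_within P n \<phi> ((2 - \<epsilon>) ^ n * poly_factor c n))"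

end

theory Submission
  imports Defs
begin

text \<open>
  Upper bound. A coloring of the hub leaves independent problems on components with at most \<open>\<sigma>\<close>
  vertices, so a partial coloring extending it is optimal as soon as no change of at most \<open>\<sigma>\<close>
  vertices outside the hub improves it; this needs no computation of components. The hub colorings are
  enumerated like the readings of an odometer.

  Lower bound. Groups of \<open>b\<close> variables are encoded by colorings of \<open>t\<close> hub vertices, where \<open>2\<^sup>b\<close> is
  almost \<open>(q + 1)\<^sup>t\<close>. Deleting a vertex never makes a gadget more expensive, hence only patterns with
  the same number \<open>z\<close> of deleted vertices are used, and they are considered up to renaming of colors
  so that no palette is needed; both restrictions cost a factor polynomial in \<open>t\<close>. A gadget
  forbids a pattern by a conjunction of tests that two colors are equal or different, each a clique that
  is colorable iff the test fails; the roots of these cliques are joined so that all but one of them must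
  be deleted anyway. Since \<open>\<sigma>\<close> and \<open>\<delta>\<close> may depend on whether the SETH holds, the clause size \<open>k\<close> that
  the SETH provides for the resulting base can be fixed first.
\<close>

section \<open>Loop programs\<close>

text \<open>Logarithmic cost shapes the upper bound: exponentially many steps must not create
  numbers of exponential length. Two growth estimates are kept apart. In polynomially many steps
  values may double each time; in the main loop the second summands come from registers that are
  never overwritten, so values grow linearly and lengths stay polynomial. In the lower bound a
  solver might escape gadgets by deleting hub vertices. The budget prevents this by being tight:
  each group of t hub vertices accounts for at least z, counting its own deletions and the excess of
  its gadgets, so equality holds everywhere and nothing is left for a clause gadget. Of the (q+1)^t
  words, fixing z costs a factor t+1, identification up to renaming a factor (q+1)^(q+1), and
  rounding to a power of two a factor 2; for B < q+1 all this is beaten by ((q+1)/B)^t. With p about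
  tn/b, the time B^p is (B^(t/b))^n up to a constant, and B^t < 2^b puts that base below 2.\<close>

datatype lprog =
    LSkip
  | LConst nat nat
  | LAdd nat nat nat
  | LSub nat nat nat
  | LLoad nat nat nat
  | LStore nat nat nat
  | LSeq lprog lprog (infixr ";;" 60)
  | LIf nat lprog lprog
  | LFor nat nat lprog

text \<open>
  \<open>LFor i m B\<close> runs \<open>B\<close> with \<open>i = 0, \<dots>, n - 1\<close>, where \<open>n\<close> is the content of register \<open>m\<close>;
  register \<open>Suc i\<close> holds the number of remaining iterations. The semantics below is
  only adequate if \<open>B\<close> writes none of \<open>i\<close>, \<open>Suc i\<close>, \<open>m\<close>, as ensured by \<open>lwf\<close>.
\<close>

primrec compile :: "lprog \<Rightarrow> prog" where
  "compile LSkip = Skip"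
| "compile (LConst x c) = Const x c"
| "compile (LAdd x y z) = Add x y z"
| "compile (LSub x y z) = Sub x y z"
| "compile (LLoad x a y) = Load x a y"
| "compile (LStore a x y) = Store a x y"
| "compile (A ;; B) = Seq (compile A) (compile B)"
| "compile (LIf x A B) = If x (compile A) (compile B)"
| "compile (LFor i m B) =
     Seq (Const i 0) (Seq (Sub (Suc i) m i)
       (While (Suc i) (Seq (compile B)
         (Seq (Const (Suc i) 1) (Seq (Add i i (Suc i)) (Sub (Suc i) m i))))))"

definition for_step :: "nat \<Rightarrow> nat \<Rightarrow> (ram_state \<Rightarrow> ram_state) \<Rightarrow> ram_state \<Rightarrow> ram_state" where
  "for_step i n F s =
     set_reg (Suc i) (n - Suc (regs s i)) (set_reg i (Suc (regs s i)) (F s))"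

definition for_init :: "nat \<Rightarrow> nat \<Rightarrow> ram_state \<Rightarrow> ram_state" where
  "for_init i n s = set_reg (Suc i) n (set_reg i 0 s)"

primrec lsem :: "lprog \<Rightarrow> ram_state \<Rightarrow> ram_state" where
  "lsem LSkip s = s"
| "lsem (LConst x c) s = set_reg x c s"
| "lsem (LAdd x y z) s = set_reg x (regs s y + regs s z) s"
| "lsem (LSub x y z) s = set_reg x (regs s y - regs s z) s"
| "lsem (LLoad x a y) s = set_reg x (arrs s a (regs s y)) s"
| "lsem (LStore a x y) s = set_cell a (regs s x) (regs s y) s"
| "lsem (A ;; B) s = lsem B (lsem A s)"
| "lsem (LIf x A B) s = (if regs s x \<noteq> 0 then lsem A s else lsem B s)"
| "lsem (LFor i m B) s = (for_step i (regs s m) (lsem B) ^^ regs s m) (for_init i (regs s m) s)"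

text \<open>Steps are counted apart from the lengths of the numbers they handle. The
  \<open>3\<close> of a loop are its two initial instructions and the final test; the
  \<open>4\<close> of an iteration are the test and the three counter updates.\<close>

primrec lcost :: "lprog \<Rightarrow> ram_state \<Rightarrow> nat" where
  "lcost LSkip s = 1"
| "lcost (LConst x c) s = 1"
| "lcost (LAdd x y z) s = 1"
| "lcost (LSub x y z) s = 1"
| "lcost (LLoad x a y) s = 1"
| "lcost (LStore a x y) s = 1"
| "lcost (A ;; B) s = lcost A s + lcost B (lsem A s)"
| "lcost (LIf x A B) s = 1 + (if regs s x \<noteq> 0 then lcost A s else lcost B s)"
| "lcost (LFor i m B) s = 3 + (\<Sum>k<regs s m.
     lcost B ((for_step i (regs s m) (lsem B) ^^ k) (for_init i (regs s m) s)) + 4)"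

primrec wregs :: "lprog \<Rightarrow> nat set" where
  "wregs LSkip = {}"
| "wregs (LConst x c) = {x}"
| "wregs (LAdd x y z) = {x}"
| "wregs (LSub x y z) = {x}"
| "wregs (LLoad x a y) = {x}"
| "wregs (LStore a x y) = {}"
| "wregs (A ;; B) = wregs A \<union> wregs B"
| "wregs (LIf x A B) = wregs A \<union> wregs B"
| "wregs (LFor i m B) = {i, Suc i} \<union> wregs B"

primrec warrs :: "lprog \<Rightarrow> nat set" where
  "warrs LSkip = {}"
| "warrs (LConst x c) = {}"
| "warrs (LAdd x y z) = {}"
| "warrs (LSub x y z) = {}"
| "warrs (LLoad x a y) = {}"
| "warrs (LStore a x y) = {a}"
| "warrs (A ;; B) = warrs A \<union> warrs B"
| "warrs (LIf x A B) = warrs A \<union> warrs B"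
| "warrs (LFor i m B) = warrs B"

primrec lwf :: "lprog \<Rightarrow> bool" where
  "lwf LSkip \<longleftrightarrow> True"
| "lwf (LConst x c) \<longleftrightarrow> True"
| "lwf (LAdd x y z) \<longleftrightarrow> True"
| "lwf (LSub x y z) \<longleftrightarrow> True"
| "lwf (LLoad x a y) \<longleftrightarrow> True"
| "lwf (LStore a x y) \<longleftrightarrow> True"
| "lwf (A ;; B) \<longleftrightarrow> lwf A \<and> lwf B"
| "lwf (LIf x A B) \<longleftrightarrow> lwf A \<and> lwf B"
| "lwf (LFor i m B) \<longleftrightarrow> lwf B \<and> i \<noteq> m \<and> Suc i \<noteq> m \<and>
     i \<notin> wregs B \<and> Suc i \<notin> wregs B \<and> m \<notin> wregs B"

section \<open>Frame properties and loop invariants\<close>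

lemma regs_set_reg [simp]: "regs (set_reg x v s) = (regs s)(x := v)"
  and arrs_set_reg [simp]: "arrs (set_reg x v s) = arrs s"
  and regs_set_cell [simp]: "regs (set_cell a i v s) = regs s"
  and arrs_set_cell [simp]: "arrs (set_cell a i v s) = (arrs s)(a := (arrs s a)(i := v))"
  by (simp_all add: set_reg_def set_cell_def)

lemma regs_for_init [simp]: "regs (for_init i n s) = (regs s)(i := 0, Suc i := n)"
  and arrs_for_init [simp]: "arrs (for_init i n s) = arrs s"
  by (simp_all add: for_init_def)

lemma regs_for_step [simp]:
    "regs (for_step i n F s) = (regs (F s))(i := Suc (regs s i), Suc i := n - Suc (regs s i))"
  and arrs_for_step [simp]: "arrs (for_step i n F s) = arrs (F s)"
  by (simp_all add: for_step_def)

lemma for_iterate_inv: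
  assumes "I s" and "\<And>s. I s \<Longrightarrow> I (for_step i n F s)"
  shows "I ((for_step i n F ^^ k) s)"
  using assms by (induction k) auto

lemma lsem_frame_regs: "r \<notin> wregs P \<Longrightarrow> regs (lsem P s) r = regs s r"
proof (induction P arbitrary: s)
  case (LFor i m B)
  have "regs ((for_step i (regs s m) (lsem B) ^^ regs s m) (for_init i (regs s m) s)) r = regs s r"
    by (rule for_iterate_inv) (use LFor in auto)
  then show ?case by simp
qed auto

lemma lsem_frame_arrs: "a \<notin> warrs P \<Longrightarrow> arrs (lsem P s) a = arrs s a"
proof (induction P arbitrary: s)
  case (LFor i m B)
  have "arrs ((for_step i (regs s m) (lsem B) ^^ regs s m) (for_init i (regs s m) s)) a = arrs s a"
    by (rule for_iterate_inv) (use LFor in auto)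
  then show ?case by simp
qed auto

lemma for_step_counter:
  assumes "i \<notin> wregs B"
  shows "regs ((for_step i n (lsem B) ^^ k) (for_init i n s)) i = k"
  by (induction k) auto

lemma for_step_remaining:
  assumes "i \<notin> wregs B"
  shows "regs ((for_step i n (lsem B) ^^ k) (for_init i n s)) (Suc i) = n - k"
  by (cases k) (use for_step_counter[OF assms] in auto)

lemma for_step_other:
  assumes "r \<notin> wregs B" "r \<noteq> i" "r \<noteq> Suc i"
  shows "regs ((for_step i n (lsem B) ^^ k) (for_init i n s)) r = regs s r"
  by (rule for_iterate_inv) (use assms in \<open>auto simp: lsem_frame_regs\<close>)

lemma LFor_invariant:
  assumes "lwf (LFor i m B)" and "regs s m = n"
    and "I 0 (for_init i n s)"
    and "\<And>k s'. k < n \<Longrightarrow> I k s' \<Longrightarrow> regs s' i = k \<Longrightarrow> regs s' m = n \<Longrightarrow> regs s' (Suc i) = n - k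
      \<Longrightarrow> I (Suc k) (for_step i n (lsem B) s')"
  shows "I n (lsem (LFor i m B) s)"
proof -
  have "k \<le> n \<Longrightarrow> I k ((for_step i n (lsem B) ^^ k) (for_init i n s))" for k
  proof (induction k)
    case (Suc k)
    then show ?case
      using assms by (auto simp: for_step_counter for_step_remaining for_step_other)
  qed (use assms in auto)
  then show ?thesis using assms(2) by auto
qed


subsection \<open>Logarithmic cost of loop programs\<close>

text \<open>Only contents are bounded: every address that a program uses is read from a register and
  hence bounded as well.\<close>

definition bounded_state :: "nat \<Rightarrow> ram_state \<Rightarrow> bool" where
  "bounded_state M s \<longleftrightarrow> (\<forall>r. regs s r \<le> M) \<and> (\<forall>a i. arrs s a i \<le> M)"

lemma bounded_state_mono: "bounded_state M s \<Longrightarrow> M \<le> M' \<Longrightarrow> bounded_state M' s"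
  by (auto simp: bounded_state_def intro: order_trans)

lemma bounded_state_set_reg: "bounded_state M s \<Longrightarrow> v \<le> M \<Longrightarrow> bounded_state M (set_reg x v s)"
  and bounded_state_set_cell: "bounded_state M s \<Longrightarrow> v \<le> M \<Longrightarrow> bounded_state M (set_cell a i v s)"
  by (auto simp: bounded_state_def)

primrec max_const :: "lprog \<Rightarrow> nat" where
  "max_const LSkip = 0"
| "max_const (LConst x c) = c"
| "max_const (LAdd x y z) = 0"
| "max_const (LSub x y z) = 0"
| "max_const (LLoad x a y) = 0"
| "max_const (LStore a x y) = 0"
| "max_const (A ;; B) = max (max_const A) (max_const B)"
| "max_const (LIf x A B) = max (max_const A) (max_const B)"
| "max_const (LFor i m B) = max_const B"

text \<open>Only the second operand of an addition: while it stays below a constant, a step enlarges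
  the largest number by at most that constant instead of doubling it.\<close>

primrec summands :: "lprog \<Rightarrow> nat set" where
  "summands LSkip = {}"
| "summands (LConst x c) = {}"
| "summands (LAdd x y z) = {z}"
| "summands (LSub x y z) = {}"
| "summands (LLoad x a y) = {}"
| "summands (LStore a x y) = {}"
| "summands (A ;; B) = summands A \<union> summands B"
| "summands (LIf x A B) = summands A \<union> summands B"
| "summands (LFor i m B) = summands B"

lemma bit_len_mono: "m \<le> n \<Longrightarrow> bit_len m \<le> bit_len n"
  by (rule floorlog_mono)

text \<open>
  \<open>V k M\<close> bounds all numbers that occur within \<open>k\<close> steps when all numbers are initially at
  most \<open>M\<close>.
\<close>

lemma exec_compile_growth:
  fixes V :: "nat \<Rightarrow> nat \<Rightarrow> nat" and R :: "nat set" and D :: nat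
  assumes V_ge: "\<And>k M. M \<le> V k M"
    and V_mono: "\<And>k k' M M'. k \<le> k' \<Longrightarrow> M \<le> M' \<Longrightarrow> V k M \<le> V k' M'"
    and V_comp: "\<And>k k' M. V k' (V k M) \<le> V (k + k') M"
    and V_add: "\<And>M a b z. 1 \<le> M \<Longrightarrow> a \<le> M \<Longrightarrow> b \<le> M \<Longrightarrow> (z \<in> R \<longrightarrow> b \<le> D) \<Longrightarrow> z \<in> Z
      \<Longrightarrow> a + b \<le> V 1 M"
  assumes "lwf P" "summands P \<subseteq> Z" "wregs P \<inter> R = {}" "max_const P \<le> M" "1 \<le> M"
    "bounded_state M s" "\<forall>r\<in>R. regs s r \<le> D"
  shows "\<exists>t. exec (compile P) s t (lsem P s) \<and>
           t \<le> lcost P s * (1 + 2 * bit_len (V (lcost P s) M)) \<and>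
           bounded_state (V (lcost P s) M) (lsem P s)"
  using assms(5-)
proof (induction P arbitrary: s M)
  case LSkip
  then show ?case
    by (intro exI[of _ 1]) (auto intro: exec.Skip[simplified] V_ge bounded_state_mono)
next
  case (LConst x c)
  have "c \<le> V 1 M" using LConst V_ge[of M 1] by simp
  then have "bit_len c \<le> bit_len (V 1 M)" by (rule bit_len_mono)
  then show ?case using LConst V_ge[of M 1] \<open>c \<le> V 1 M\<close>
    by (intro exI[of _ "1 + bit_len c"] conjI)
      (auto intro: exec.Const[simplified] bounded_state_set_reg bounded_state_mono)
next
  case (LAdd x y z)
  have b: "regs s y \<le> M" "regs s z \<le> M" using LAdd by (auto simp: bounded_state_def)
  have "regs s y + regs s z \<le> V 1 M"
    using LAdd by (intro V_add[of _ _ _ z]) (auto simp: bounded_state_def)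
  moreover have "bit_len (regs s y) \<le> bit_len (V 1 M)" "bit_len (regs s z) \<le> bit_len (V 1 M)"
    using b V_ge[of M 1] by (auto intro!: bit_len_mono)
  ultimately show ?case using LAdd V_ge[of M 1] unfolding compile.simps lsem.simps lcost.simps
    by (intro exI[of _ "1 + bit_len (regs s y) + bit_len (regs s z)"] conjI exec.Add)
      (auto intro: bounded_state_set_reg bounded_state_mono)
next
  case (LSub x y z)
  have b: "regs s y \<le> M" "regs s z \<le> M" using LSub by (auto simp: bounded_state_def)
  then have "regs s y - regs s z \<le> V 1 M" using V_ge[of M 1] by simp
  moreover have "bit_len (regs s y) \<le> bit_len (V 1 M)" "bit_len (regs s z) \<le> bit_len (V 1 M)"
    using b V_ge[of M 1] by (auto intro!: bit_len_mono)
  ultimately show ?case using LSub V_ge[of M 1] unfolding compile.simps lsem.simps lcost.simps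
    by (intro exI[of _ "1 + bit_len (regs s y) + bit_len (regs s z)"] conjI exec.Sub)
      (auto intro: bounded_state_set_reg bounded_state_mono)
next
  case (LLoad x a y)
  have b: "regs s y \<le> M" "arrs s a (regs s y) \<le> M" using LLoad by (auto simp: bounded_state_def)
  moreover have "bit_len (regs s y) \<le> bit_len (V 1 M)"
    "bit_len (arrs s a (regs s y)) \<le> bit_len (V 1 M)"
    using b V_ge[of M 1] by (auto intro!: bit_len_mono)
  ultimately show ?case using LLoad V_ge[of M 1] unfolding compile.simps lsem.simps lcost.simps
    by (intro exI[of _ "1 + bit_len (regs s y) + bit_len (arrs s a (regs s y))"] conjI exec.Load)
      (auto intro: bounded_state_set_reg bounded_state_mono)
next
  case (LStore a x y)
  have b: "regs s x \<le> M" "regs s y \<le> M" using LStore by (auto simp: bounded_state_def)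
  moreover have "bit_len (regs s x) \<le> bit_len (V 1 M)"
    "bit_len (regs s y) \<le> bit_len (V 1 M)"
    using b V_ge[of M 1] by (auto intro!: bit_len_mono)
  ultimately show ?case using LStore V_ge[of M 1] unfolding compile.simps lsem.simps lcost.simps
    by (intro exI[of _ "1 + bit_len (regs s x) + bit_len (regs s y)"] conjI exec.Store)
      (auto intro: bounded_state_set_cell bounded_state_mono)
next
  case (LSeq A B)
  let ?a = "lcost A s" and ?s = "lsem A s"
  let ?b = "lcost B ?s"
  obtain t where t: "exec (compile A) s t ?s" "t \<le> ?a * (1 + 2 * bit_len (V ?a M))"
    "bounded_state (V ?a M) ?s"
    using LSeq.IH(1)[OF _ _ _ _ LSeq.prems(5-7)] LSeq.prems(1-4) by auto
  have "r \<notin> wregs A" if "r \<in> R" for r using LSeq.prems(3) that by auto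
  then have R: "\<forall>r\<in>R. regs ?s r \<le> D" using LSeq.prems(7) by (simp add: lsem_frame_regs)
  have B: "lwf B" "summands B \<subseteq> Z" "wregs B \<inter> R = {}" "max_const B \<le> V ?a M" "1 \<le> V ?a M"
    using LSeq.prems(1-5) V_ge[of M ?a] by auto
  obtain u where u: "exec (compile B) ?s u (lsem B ?s)"
    "u \<le> ?b * (1 + 2 * bit_len (V ?b (V ?a M)))" "bounded_state (V ?b (V ?a M)) (lsem B ?s)"
    using LSeq.IH(2)[OF B t(3) R] by blast
  have "bit_len (V ?b (V ?a M)) \<le> bit_len (V (?a + ?b) M)" by (rule bit_len_mono[OF V_comp])
  then have u': "u \<le> ?b * (1 + 2 * bit_len (V (?a + ?b) M))"
    by (intro order_trans[OF u(2)]) auto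
  have "bit_len (V ?a M) \<le> bit_len (V (?a + ?b) M)" by (intro bit_len_mono V_mono) auto
  then have t': "t \<le> ?a * (1 + 2 * bit_len (V (?a + ?b) M))"
    by (intro order_trans[OF t(2)]) auto
  show ?case
    using t u t' u' V_comp[of ?b ?a M]
    by (intro exI[of _ "t + u"]) (auto intro: exec.Seq bounded_state_mono simp: algebra_simps)
next
  case (LIf x A B)
  let ?w = "\<lambda>k. 1 + 2 * bit_len (V k M)"
  have x: "bit_len (regs s x) \<le> bit_len (V k M)" for k
    using LIf.prems V_ge[of M k] by (intro bit_len_mono) (auto simp: bounded_state_def intro: order_trans)
  have mono: "t \<le> k * ?w k \<Longrightarrow> t \<le> k * ?w (Suc k)" for t k
  proof -
    assume "t \<le> k * ?w k"
    moreover have "bit_len (V k M) \<le> bit_len (V (Suc k) M)" by (intro bit_len_mono V_mono) auto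
    then have "k * ?w k \<le> k * ?w (Suc k)" by simp
    ultimately show ?thesis by linarith
  qed
  have mono': "V k M \<le> V (Suc k) M" for k by (intro V_mono) auto
  show ?case
  proof (cases "regs s x = 0")
    case True
    obtain t where t: "exec (compile B) s t (lsem B s)" "t \<le> lcost B s * ?w (lcost B s)"
      "bounded_state (V (lcost B s) M) (lsem B s)"
      using LIf.IH(2)[OF _ _ _ _ LIf.prems(5-7)] LIf.prems(1-4) by auto
    from mono[OF t(2)] show ?thesis using True t(1) bounded_state_mono[OF t(3) mono']
      by (intro exI[of _ "1 + t"]) (auto intro: exec.If_zero[simplified])
  next
    case False
    obtain t where t: "exec (compile A) s t (lsem A s)" "t \<le> lcost A s * ?w (lcost A s)"
      "bounded_state (V (lcost A s) M) (lsem A s)"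
      using LIf.IH(1)[OF _ _ _ _ LIf.prems(5-7)] LIf.prems(1-4) by auto
    from mono[OF t(2)] show ?thesis
      using False t(1) bounded_state_mono[OF t(3) mono'] x[of "Suc (lcost A s)"]
      by (intro exI[of _ "1 + bit_len (regs s x) + t"]) (auto intro: exec.If_nonzero[simplified])
  qed
next
  case (LFor i m B)
  define n where "n = regs s m"
  define st where "st k = (for_step i n (lsem B) ^^ k) (for_init i n s)" for k
  \<comment> \<open>\<open>c k\<close> counts the steps before iteration \<open>k\<close>, including
    the two initial instructions, so \<open>V (c k) M\<close> bounds the state there.\<close>
  define c where "c k = 2 + (\<Sum>j<k. lcost B (st j) + 4)" for k
  define w where "w = 1 + 2 * bit_len (V (lcost (LFor i m B) s) M)"
  have cost: "lcost (LFor i m B) s = Suc (c n)"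
    by (simp add: c_def st_def n_def)
  have wf: "lwf B" "i \<noteq> m" "Suc i \<noteq> m" "i \<notin> wregs B" "Suc i \<notin> wregs B" "m \<notin> wregs B"
    using LFor.prems by auto
  have n_le: "n \<le> M" using LFor.prems by (auto simp: n_def bounded_state_def)
  have st_i: "regs (st k) i = k" for k unfolding st_def by (rule for_step_counter) (rule wf)
  have st_m: "regs (st k) m = n" for k
    unfolding st_def n_def by (rule for_step_other) (use wf in auto)
  have st_rem: "regs (st k) (Suc i) = n - k" for k
    unfolding st_def by (rule for_step_remaining) (rule wf)
  have "r \<notin> wregs B \<and> r \<noteq> i \<and> r \<noteq> Suc i" if "r \<in> R" for r using LFor.prems(3) that by auto
  then have st_R: "\<forall>r\<in>R. regs (st k) r \<le> D" for k
    using LFor.prems(7) by (simp add: st_def for_step_other)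
  have st_Suc: "st (Suc k) = set_reg (Suc i) (n - Suc k) (set_reg i (Suc k) (lsem B (st k)))" for k
    using st_i[of k] by (simp add: st_def for_step_def)
  have c_mono: "j \<le> k \<Longrightarrow> c j \<le> c k" for j k
    unfolding c_def by (intro add_left_mono sum_mono2) auto
  have body: "\<exists>t. exec (compile B) (st k) t (lsem B (st k)) \<and> t \<le> lcost B (st k) * w
      \<and> bounded_state (V (c (Suc k)) M) (lsem B (st k))"
    if "k < n" and bk: "bounded_state (V (c k) M) (st k)" for k
  proof -
    let ?b = "lcost B (st k)"
    have B: "lwf B" "summands B \<subseteq> Z" "wregs B \<inter> R = {}" "max_const B \<le> V (c k) M"
      "1 \<le> V (c k) M"
      using LFor.prems(1-5) V_ge[of M "c k"] by auto
    obtain t where t: "exec (compile B) (st k) t (lsem B (st k))"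
      "t \<le> ?b * (1 + 2 * bit_len (V ?b (V (c k) M)))"
      "bounded_state (V ?b (V (c k) M)) (lsem B (st k))"
      using LFor.IH[OF B bk st_R] by blast
    have "V ?b (V (c k) M) \<le> V (c (Suc k)) M"
      by (rule order_trans[OF V_comp V_mono]) (auto simp: c_def)
    moreover have "c (Suc k) \<le> Suc (c n)" using c_mono[of "Suc k" n] that by simp
    then have "V (c (Suc k)) M \<le> V (Suc (c n)) M" by (rule V_mono) simp
    ultimately have "bit_len (V ?b (V (c k) M)) \<le> bit_len (V (Suc (c n)) M)"
      by (intro bit_len_mono) simp
    then have "t \<le> ?b * w" unfolding w_def cost by (intro order_trans[OF t(2)]) auto
    then show ?thesis using t \<open>V ?b (V (c k) M) \<le> V (c (Suc k)) M\<close>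
      by (auto intro: bounded_state_mono)
  qed
  have bnd: "k \<le> n \<Longrightarrow> bounded_state (V (c k) M) (st k)" for k
  proof (induction k)
    case 0
    have "n \<le> V (c 0) M" "M \<le> V (c 0) M" using n_le V_ge[of M "c 0"] by auto
    then show ?case using LFor.prems
      by (auto simp: st_def for_init_def intro!: bounded_state_set_reg intro: bounded_state_mono)
  next
    case (Suc k)
    then have "bounded_state (V (c (Suc k)) M) (lsem B (st k))" using body[of k] by auto
    moreover have "n \<le> V (c (Suc k)) M" using n_le V_ge[of M "c (Suc k)"] by linarith
    ultimately show ?case unfolding st_Suc using Suc.prems
      by (intro bounded_state_set_reg) auto
  qed
  have w1: "1 + bit_len x + bit_len y \<le> w" if "x \<le> M" "y \<le> M" for x y
  proof -
    have "x \<le> V (lcost (LFor i m B) s) M" "y \<le> V (lcost (LFor i m B) s) M"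
      using that V_ge[of M "lcost (LFor i m B) s"] by linarith+
    then show ?thesis using bit_len_mono[of x] bit_len_mono[of y] unfolding w_def by force
  qed
  let ?loop = "While (Suc i) (Seq (compile B)
         (Seq (Const (Suc i) 1) (Seq (Add i i (Suc i)) (Sub (Suc i) m i))))"
  \<comment> \<open>Induction from the last iteration backwards, since an execution of
    \<open>While\<close> is assembled from that of its remaining iterations.\<close>
  have "\<exists>t. exec ?loop (st k) t (st n) \<and> t \<le> ((\<Sum>j=k..<n. lcost B (st j) + 4) + 1) * w"
    if "k \<le> n" for k
    using that
  proof (induction rule: inc_induct)
    case base
    have "w \<ge> 1" by (simp add: w_def)
    then show ?case using st_rem[of n] by (intro exI[of _ 1]) (auto intro: exec.While_zero[simplified])
  next
    case (step k)
    then obtain u where u: "exec ?loop (st (Suc k)) u (st n)"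
      "u \<le> ((\<Sum>j=Suc k..<n. lcost B (st j) + 4) + 1) * w" by auto
    obtain t where t: "exec (compile B) (st k) t (lsem B (st k))" "t \<le> lcost B (st k) * w"
      using body[of k] bnd[of k] step by auto
    let ?s1 = "lsem B (st k)"
    let ?s2 = "set_reg (Suc i) 1 ?s1"
    let ?s3 = "set_reg i (Suc k) ?s2"
    have r1: "regs ?s1 i = k" "regs ?s1 m = n" using wf st_i st_m by (auto simp: lsem_frame_regs)
    have e2: "exec (Const (Suc i) 1) ?s1 (1 + bit_len 1) ?s2" by (rule exec.Const)
    have e3: "exec (Add i i (Suc i)) ?s2 (1 + bit_len k + bit_len 1) ?s3"
      using exec.Add[of i i "Suc i" ?s2] r1 by simp
    have s4: "set_reg (Suc i) (n - Suc k) ?s3 = st (Suc k)"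
      unfolding st_Suc by (simp add: set_reg_def fun_upd_twist)
    have e4: "exec (Sub (Suc i) m i) ?s3 (1 + bit_len n + bit_len (Suc k)) (st (Suc k))"
      using exec.Sub[of "Suc i" m i ?s3] r1 wf s4 by auto
    have e: "exec (Seq (compile B) (Seq (Const (Suc i) 1) (Seq (Add i i (Suc i)) (Sub (Suc i) m i))))
       (st k) (t + ((1 + bit_len 1) + ((1 + bit_len k + bit_len 1) + (1 + bit_len n + bit_len (Suc k)))))
       (st (Suc k))"
      by (intro exec.Seq[OF t(1)] exec.Seq[OF e2] exec.Seq[OF e3] e4)
    have ex: "exec ?loop (st k) (1 + bit_len (n - k) + (t + ((1 + bit_len 1) + ((1 + bit_len k + bit_len 1)
        + (1 + bit_len n + bit_len (Suc k))))) + u) (st n)"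
      using exec.While_nonzero[OF _ e u(1)] step st_rem[of k] by simp
    have "1 + bit_len (n - k) + bit_len 0 \<le> w" "1 + bit_len 1 + bit_len 0 \<le> w"
      "1 + bit_len k + bit_len 1 \<le> w" "1 + bit_len n + bit_len (Suc k) \<le> w"
      using n_le step LFor.prems by (intro w1; simp)+
    then have le: "1 + bit_len (n - k) + (t + ((1 + bit_len 1) + ((1 + bit_len k + bit_len 1)
        + (1 + bit_len n + bit_len (Suc k))))) + u \<le> 4 * w + lcost B (st k) * w +
        ((\<Sum>j=Suc k..<n. lcost B (st j) + 4) + 1) * w"
      using t(2) u(2) by linarith
    have "(\<Sum>j=k..<n. lcost B (st j) + 4) = lcost B (st k) + 4 + (\<Sum>j=Suc k..<n. lcost B (st j) + 4)"
      using step by (simp add: sum.atLeast_Suc_lessThan)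
    then have "4 * w + lcost B (st k) * w + ((\<Sum>j=Suc k..<n. lcost B (st j) + 4) + 1) * w
       = ((\<Sum>j=k..<n. lcost B (st j) + 4) + 1) * w"
      by (simp add: algebra_simps)
    with le have "1 + bit_len (n - k) + (t + ((1 + bit_len 1) + ((1 + bit_len k + bit_len 1)
        + (1 + bit_len n + bit_len (Suc k))))) + u \<le> ((\<Sum>j=k..<n. lcost B (st j) + 4) + 1) * w"
      by (simp only:)
    with ex show ?case by blast
  qed
  from this[of 0] obtain t where t: "exec ?loop (st 0) t (st n)" "t \<le> (c n - 1) * w"
    by (auto simp: c_def atLeast0LessThan)
  have e1: "exec (Const i 0) s (1 + bit_len 0) (set_reg i 0 s)" by (rule exec.Const)
  have e2: "exec (Sub (Suc i) m i) (set_reg i 0 s) (1 + bit_len n + bit_len 0) (st 0)"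
    using exec.Sub[of "Suc i" m i "set_reg i 0 s"] wf by (simp add: n_def st_def for_init_def)
  have "exec (compile (LFor i m B)) s ((1 + bit_len 0) + ((1 + bit_len n + bit_len 0) + t)) (st n)"
    unfolding compile.simps by (intro exec.Seq[OF e1] exec.Seq[OF e2] t)
  moreover have "1 + bit_len 0 + bit_len 0 \<le> w" "1 + bit_len n + bit_len 0 \<le> w"
    using n_le by (intro w1; simp)+
  then have "(1 + bit_len 0) + ((1 + bit_len n + bit_len 0) + t) \<le> w + w + (c n - 1) * w"
    using t(2) by linarith
  moreover have "w + w + (c n - 1) * w = Suc (c n) * w"
  proof -
    have "Suc (c n) = 2 + (c n - 1)" by (simp add: c_def)
    then show ?thesis by (simp only: distrib_right)
  qed
  moreover have "lsem (LFor i m B) s = st n" by (simp add: st_def n_def)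
  moreover have "bounded_state (V (Suc (c n)) M) (st n)"
    by (rule bounded_state_mono[OF bnd]) (auto intro: V_mono)
  ultimately have "exec (compile (LFor i m B)) s ((1 + bit_len 0) + ((1 + bit_len n + bit_len 0) + t))
      (lsem (LFor i m B) s)"
    "(1 + bit_len 0) + ((1 + bit_len n + bit_len 0) + t) \<le> lcost (LFor i m B) s * w"
    "bounded_state (V (lcost (LFor i m B) s) M) (lsem (LFor i m B) s)"
    unfolding cost by simp_all
  then show ?case unfolding w_def by blast
qed

section \<open>Polynomial bounds and static cost bounds\<close>

definition poly_bounded :: "('a \<Rightarrow> nat) \<Rightarrow> ('a \<Rightarrow> nat) \<Rightarrow> bool" where
  "poly_bounded sz f \<longleftrightarrow> (\<exists>c. \<forall>x. f x \<le> c * (sz x + 1) ^ c)"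

lemma poly_bounded_mono: "poly_bounded sz g \<Longrightarrow> (\<And>x. f x \<le> g x) \<Longrightarrow> poly_bounded sz f"
  unfolding poly_bounded_def by (meson order_trans)

text \<open>One constant serves as factor and as exponent, as in \<open>poly_factor\<close>; the sum
  of the two given ones is large enough for both.\<close>

lemma poly_boundedI:
  assumes "\<And>x. f x \<le> a * (sz x + 1) ^ b"
  shows "poly_bounded sz f"
  unfolding poly_bounded_def
proof (intro exI[of _ "a + b"] allI)
  fix x
  have "(sz x + 1) ^ b \<le> (sz x + 1) ^ (a + b)" by (intro power_increasing) auto
  then have "a * (sz x + 1) ^ b \<le> (a + b) * (sz x + 1) ^ (a + b)" by (intro mult_mono) auto
  with assms show "f x \<le> (a + b) * (sz x + 1) ^ (a + b)" using order_trans by blast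
qed

lemma poly_bounded_const: "poly_bounded sz (\<lambda>_. k)"
  by (rule poly_boundedI[of _ k _ 0]) auto

lemma poly_bounded_size: "poly_bounded sz sz"
  by (rule poly_boundedI[of _ 1 _ 1]) auto

lemma poly_bounded_add:
  assumes "poly_bounded sz f" "poly_bounded sz g"
  shows "poly_bounded sz (\<lambda>x. f x + g x)"
proof -
  obtain c d where c: "\<And>x. f x \<le> c * (sz x + 1) ^ c" and d: "\<And>x. g x \<le> d * (sz x + 1) ^ d"
    using assms by (auto simp: poly_bounded_def)
  show ?thesis
  proof (rule poly_boundedI)
    fix x
    have "c * (sz x + 1) ^ c \<le> c * (sz x + 1) ^ (c + d)"
      "d * (sz x + 1) ^ d \<le> d * (sz x + 1) ^ (c + d)"
      by (intro mult_left_mono power_increasing; simp)+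
    then show "f x + g x \<le> (c + d) * (sz x + 1) ^ (c + d)"
      using c[of x] d[of x] unfolding distrib_right by linarith
  qed
qed

lemma poly_bounded_mult:
  assumes "poly_bounded sz f" "poly_bounded sz g"
  shows "poly_bounded sz (\<lambda>x. f x * g x)"
proof -
  obtain c d where c: "\<And>x. f x \<le> c * (sz x + 1) ^ c" and d: "\<And>x. g x \<le> d * (sz x + 1) ^ d"
    using assms by (auto simp: poly_bounded_def)
  show ?thesis
  proof (rule poly_boundedI)
    fix x
    have "f x * g x \<le> (c * (sz x + 1) ^ c) * (d * (sz x + 1) ^ d)"
      using c d by (intro mult_mono) auto
    then show "f x * g x \<le> (c * d) * (sz x + 1) ^ (c + d)"
      by (simp add: power_add algebra_simps)
  qed
qed

lemma poly_bounded_power: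
  "poly_bounded sz f \<Longrightarrow> poly_bounded sz (\<lambda>x. f x ^ k)"
  by (induction k) (auto intro: poly_bounded_const[of _ 1, simplified] poly_bounded_mult)

lemma poly_bounded_compose:
  assumes "poly_bounded (\<lambda>N. N) g" "poly_bounded sz f"
  shows "poly_bounded sz (\<lambda>x. g (f x))"
proof -
  obtain c where c: "\<And>N. g N \<le> c * (N + 1) ^ c" using assms(1) by (auto simp: poly_bounded_def)
  show ?thesis
    by (rule poly_bounded_mono[where g = "\<lambda>x. c * (f x + 1) ^ c"])
      (auto intro!: poly_bounded_mult poly_bounded_power poly_bounded_add poly_bounded_const assms(2) c
        simp del: One_nat_def add_Suc_right Suc_eq_plus1_left)
qed

primrec count_regs :: "lprog \<Rightarrow> nat set" where
  "count_regs LSkip = {}"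
| "count_regs (LConst x c) = {}"
| "count_regs (LAdd x y z) = {}"
| "count_regs (LSub x y z) = {}"
| "count_regs (LLoad x a y) = {}"
| "count_regs (LStore a x y) = {}"
| "count_regs (A ;; B) = count_regs A \<union> count_regs B"
| "count_regs (LIf x A B) = count_regs A \<union> count_regs B"
| "count_regs (LFor i m B) = insert m (count_regs B)"

text \<open>A conditional is charged for both branches, so that the bound depends on the state only
  through the loop limits.\<close>

primrec cost_bound :: "(nat \<Rightarrow> nat) \<Rightarrow> lprog \<Rightarrow> nat" where
  "cost_bound b LSkip = 1"
| "cost_bound b (LConst x c) = 1"
| "cost_bound b (LAdd x y z) = 1"
| "cost_bound b (LSub x y z) = 1"
| "cost_bound b (LLoad x a y) = 1"
| "cost_bound b (LStore a x y) = 1"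
| "cost_bound b (A ;; B) = cost_bound b A + cost_bound b B"
| "cost_bound b (LIf x A B) = 1 + (cost_bound b A + cost_bound b B)"
| "cost_bound b (LFor i m B) = 3 + b m * (cost_bound b B + 4)"

text \<open>Loop limits that the program never overwrites keep their initial values, so the costs of
  nested loops simply multiply.\<close>

lemma lcost_le_cost_bound:
  assumes "count_regs P \<inter> wregs P = {}" and "\<And>m. m \<in> count_regs P \<Longrightarrow> regs s m \<le> b m"
  shows "lcost P s \<le> cost_bound b P"
  using assms
proof (induction P arbitrary: s)
  case (LSeq A B)
  have "lcost A s \<le> cost_bound b A" using LSeq.prems by (intro LSeq.IH) auto
  moreover have "lcost B (lsem A s) \<le> cost_bound b B"
  proof (intro LSeq.IH)
    fix m assume m: "m \<in> count_regs B"
    then have "m \<notin> wregs A" using LSeq.prems(1) by auto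
    then show "regs (lsem A s) m \<le> b m" using LSeq.prems(2) m by (simp add: lsem_frame_regs)
  qed (use LSeq.prems in auto)
  ultimately show ?case by simp
next
  case (LIf x A B)
  have "lcost A s \<le> cost_bound b A" using LIf.prems by (intro LIf.IH) auto
  moreover have "lcost B s \<le> cost_bound b B" using LIf.prems by (intro LIf.IH) auto
  ultimately show ?case by simp
next
  case (LFor i m B)
  let ?st = "\<lambda>k. (for_step i (regs s m) (lsem B) ^^ k) (for_init i (regs s m) s)"
  have "lcost B (?st k) \<le> cost_bound b B" for k
  proof (rule LFor.IH)
    fix m' assume m: "m' \<in> count_regs B"
    then have "m' \<notin> wregs B" "m' \<noteq> i" "m' \<noteq> Suc i" using LFor.prems(1) by auto
    then show "regs (?st k) m' \<le> b m'" using LFor.prems(2) m by (simp add: for_step_other)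
  qed (use LFor.prems in auto)
  then have "(\<Sum>k<regs s m. lcost B (?st k) + 4) \<le> (\<Sum>k<regs s m. cost_bound b B + 4)"
    by (intro sum_mono) simp
  also have "\<dots> \<le> b m * (cost_bound b B + 4)" using LFor.prems by simp
  finally show ?case by simp
qed auto

lemma poly_bounded_cost_bound: "poly_bounded (\<lambda>N. N) (\<lambda>N. cost_bound (\<lambda>_. N) P)"
  by (induction P)
    (auto simp del: One_nat_def add_Suc_right Suc_eq_plus1_left plus_1_eq_Suc
      intro!: poly_bounded_const poly_bounded_add poly_bounded_mult poly_bounded_size)

lemma bit_len_pow2_mult: "1 \<le> M \<Longrightarrow> bit_len (2 ^ k * M) = k + bit_len M"
proof (induction k)
  case (Suc k)
  have "(2::nat) ^ Suc k * M = (2 ^ k * M) * 2" by simp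
  then have "bit_len (2 ^ Suc k * M) = bit_len ((2 ^ k * M) * 2)" by (rule arg_cong)
  also have "\<dots> = bit_len (2 ^ k * M) + 1"
    using Suc.prems by (subst compute_floorlog) auto
  finally show ?case using Suc by simp
qed simp

text \<open>A step at most doubles the largest number, so lengths grow by at most \<open>K\<close>.
  This is good enough for phases of polynomially many steps.\<close>

lemma exec_compile_poly:
  assumes "lwf P" "count_regs P \<inter> wregs P = {}" "\<And>m. m \<in> count_regs P \<Longrightarrow> regs s m \<le> N"
    "max_const P \<le> M" "1 \<le> M" "bounded_state M s"
  defines "K \<equiv> cost_bound (\<lambda>_. N) P"
  shows "\<exists>t. exec (compile P) s t (lsem P s) \<and> t \<le> K * (1 + 2 * (K + bit_len M)) \<and>
    bounded_state (2 ^ K * M) (lsem P s)"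
proof -
  let ?c = "lcost P s"
  have c: "?c \<le> K" unfolding K_def using assms(2,3) by (rule lcost_le_cost_bound)
  have "\<exists>t. exec (compile P) s t (lsem P s) \<and> t \<le> ?c * (1 + 2 * bit_len (2 ^ ?c * M)) \<and>
    bounded_state (2 ^ ?c * M) (lsem P s)"
    by (rule exec_compile_growth[where V = "\<lambda>k M. 2 ^ k * M" and R = "{}" and Z = UNIV])
      (use assms in \<open>auto simp: power_add mult_ac intro: mult_mono\<close>)
  then obtain t where t: "exec (compile P) s t (lsem P s)" "t \<le> ?c * (1 + 2 * (?c + bit_len M))"
    "bounded_state (2 ^ ?c * M) (lsem P s)"
    using bit_len_pow2_mult[OF assms(5)] by auto
  have "?c * (1 + 2 * (?c + bit_len M)) \<le> K * (1 + 2 * (K + bit_len M))"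
    using c by (intro mult_mono) auto
  moreover have "2 ^ ?c * M \<le> 2 ^ K * M" using c by (intro mult_right_mono power_increasing) auto
  ultimately show ?thesis using t by (meson bounded_state_mono order_trans)
qed

text \<open>For runs of exponentially many steps: values grow by at most \<open>D\<close> per step,
  so the lengths are logarithmic in \<open>K\<close>, whereas doubling would only bound them by
  \<open>K\<close> itself.\<close>

lemma exec_compile_increments:
  assumes "lwf P" "summands P \<subseteq> R" "wregs P \<inter> R = {}" "\<And>r. r \<in> R \<Longrightarrow> regs s r \<le> D"
    "max_const P \<le> M" "1 \<le> M" "bounded_state M s" "lcost P s \<le> K"
  shows "\<exists>t. exec (compile P) s t (lsem P s) \<and> t \<le> K * (1 + 2 * bit_len (M + K * D))"
proof -
  let ?c = "lcost P s"
  have "\<exists>t. exec (compile P) s t (lsem P s) \<and> t \<le> ?c * (1 + 2 * bit_len (M + ?c * D)) \<and>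
    bounded_state (M + ?c * D) (lsem P s)"
    by (rule exec_compile_growth[where V = "\<lambda>k M. M + k * D" and R = R and Z = R and D = D])
      (use assms in \<open>auto simp: algebra_simps intro: add_mono mult_mono\<close>)
  then obtain t where t: "exec (compile P) s t (lsem P s)"
    "t \<le> ?c * (1 + 2 * bit_len (M + ?c * D))" by auto
  have "bit_len (M + ?c * D) \<le> bit_len (M + K * D)" using assms(8) by (intro bit_len_mono) simp
  then have "?c * (1 + 2 * bit_len (M + ?c * D)) \<le> K * (1 + 2 * bit_len (M + K * D))"
    using assms(8) by (intro mult_mono) auto
  then show ?thesis using t by (meson order_trans)
qed


subsection \<open>Running a program on shifted registers and arrays\<close>

lemma less_pow2_bit_len: "n < 2 ^ bit_len n"
  using floorlog_bounds[of n 2] by (cases "n = 0") auto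

text \<open>An instruction with a large constant pays for its length, so even arbitrary programs at
  most double the values per unit of cost. This bounds what an unknown solver leaves behind.\<close>

lemma exec_bounded_state:
  assumes "exec P s t s'" "bounded_state M s" "1 \<le> M"
  shows "bounded_state (2 ^ t * M) s'"
  using assms
proof (induction arbitrary: M rule: exec.induct)
  case (Skip s)
  then show ?case by (auto intro: bounded_state_mono)
next
  case (Const x c s)
  have "c \<le> 2 ^ (1 + bit_len c)" using less_pow2_bit_len[of c] by simp
  then have "c \<le> 2 ^ (1 + bit_len c) * M" using Const.prems(2) by (metis le_trans mult.right_neutral mult_le_mono2)
  then show ?case using Const by (auto intro!: bounded_state_set_reg intro: bounded_state_mono)
next
  case (Add x y z s)
  have "regs s y + regs s z \<le> 2 * M" using Add by (auto simp: bounded_state_def intro: add_mono simp: mult_2)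
  also have "\<dots> \<le> 2 ^ (1 + bit_len (regs s y) + bit_len (regs s z)) * M" by simp
  finally show ?case using Add by (auto intro!: bounded_state_set_reg intro: bounded_state_mono)
next
  case (Sub x y z s)
  have "regs s y - regs s z \<le> M" using Sub by (auto simp: bounded_state_def intro: order_trans[OF diff_le_self])
  also have "\<dots> \<le> 2 ^ (1 + bit_len (regs s y) + bit_len (regs s z)) * M" by simp
  finally show ?case using Sub by (auto intro!: bounded_state_set_reg intro: bounded_state_mono)
next
  case (Load x a y s)
  have "arrs s a (regs s y) \<le> M" using Load by (auto simp: bounded_state_def)
  also have "\<dots> \<le> 2 ^ (1 + bit_len (regs s y) + bit_len (arrs s a (regs s y))) * M" by simp
  finally show ?case using Load by (auto intro!: bounded_state_set_reg intro: bounded_state_mono)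
next
  case (Store a x y s)
  have "regs s y \<le> M" using Store by (auto simp: bounded_state_def)
  also have "\<dots> \<le> 2 ^ (1 + bit_len (regs s x) + bit_len (regs s y)) * M" by simp
  finally show ?case using Store by (auto intro!: bounded_state_set_cell intro: bounded_state_mono)
next
  case (Seq P s t s' P' t' s'')
  have "bounded_state (2 ^ t' * (2 ^ t * M)) s''"
    using Seq by simp
  then show ?case by (simp add: power_add mult_ac)
next
  case (If_nonzero s x P t s' P')
  have "bounded_state (2 ^ t * M) s'" using If_nonzero by simp
  then show ?case by (rule bounded_state_mono) (intro mult_right_mono power_increasing; simp)
next
  case (If_zero s x P' t s' P)
  have "bounded_state (2 ^ t * M) s'" using If_zero by simp
  then show ?case by (rule bounded_state_mono) (intro mult_right_mono power_increasing; simp)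
next
  case (While_zero s x P)
  then show ?case by (auto intro: bounded_state_mono)
next
  case (While_nonzero s x P t s' t' s'')
  have "bounded_state (2 ^ t' * (2 ^ t * M)) s''"
    using While_nonzero by simp
  then have "bounded_state (2 ^ (t + t') * M) s''" by (simp add: power_add mult_ac)
  then show ?case by (rule bounded_state_mono) (intro mult_right_mono power_increasing; simp)
qed

text \<open>Moves a program to the registers and arrays from \<open>K\<close> on, so that the data
  of its caller below \<open>K\<close> survive the run.\<close>

primrec shift_prog :: "nat \<Rightarrow> prog \<Rightarrow> prog" where
  "shift_prog K Skip = Skip"
| "shift_prog K (Const x c) = Const (K + x) c"
| "shift_prog K (Add x y z) = Add (K + x) (K + y) (K + z)"
| "shift_prog K (Sub x y z) = Sub (K + x) (K + y) (K + z)"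
| "shift_prog K (Load x a y) = Load (K + x) (K + a) (K + y)"
| "shift_prog K (Store a x y) = Store (K + a) (K + x) (K + y)"
| "shift_prog K (Seq P P') = Seq (shift_prog K P) (shift_prog K P')"
| "shift_prog K (If x P P') = If (K + x) (shift_prog K P) (shift_prog K P')"
| "shift_prog K (While x P) = While (K + x) (shift_prog K P)"

definition embed_state :: "nat \<Rightarrow> ram_state \<Rightarrow> ram_state \<Rightarrow> ram_state" where
  "embed_state K S s = \<lparr>regs = (\<lambda>r. if r < K then regs S r else regs s (r - K)),
     arrs = (\<lambda>a. if a < K then arrs S a else arrs s (a - K))\<rparr>"

lemma regs_embed_state [simp]: "regs (embed_state K S s) (K + x) = regs s x"
  and arrs_embed_state [simp]: "arrs (embed_state K S s) (K + a) = arrs s a"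
  by (simp_all add: embed_state_def)

lemma embed_state_set_reg: "embed_state K S (set_reg x v s) = set_reg (K + x) v (embed_state K S s)"
  by (auto simp: embed_state_def set_reg_def fun_eq_iff)

lemma embed_state_set_cell:
  "embed_state K S (set_cell a i v s) = set_cell (K + a) i v (embed_state K S s)"
  by (auto simp: embed_state_def set_cell_def fun_eq_iff)

text \<open>The cost depends on the contents of registers and cells, not on which registers and
  arrays hold them, so it carries over unchanged.\<close>

lemma exec_shift_prog:
  assumes "exec P s t s'"
  shows "exec (shift_prog K P) (embed_state K S s) t (embed_state K S s')"
  using assms
proof (induction rule: exec.induct)
  case (Add x y z s)
  show ?case using exec.Add[of "K + x" "K + y" "K + z" "embed_state K S s"]
    by (simp add: embed_state_set_reg)
next
  case (Sub x y z s)
  show ?case using exec.Sub[of "K + x" "K + y" "K + z" "embed_state K S s"]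
    by (simp add: embed_state_set_reg)
next
  case (Load x a y s)
  show ?case using exec.Load[of "K + x" "K + a" "K + y" "embed_state K S s"]
    by (simp add: embed_state_set_reg)
next
  case (Store a x y s)
  show ?case using exec.Store[of "K + a" "K + x" "K + y" "embed_state K S s"]
    by (simp add: embed_state_set_cell)
next
  case (If_nonzero s x P t s' P')
  then show ?case using exec.If_nonzero[of "embed_state K S s" "K + x"] by simp
next
  case (While_nonzero s x P t s' t' s'')
  then show ?case using exec.While_nonzero[of "embed_state K S s" "K + x"] by simp
qed (auto simp: embed_state_set_reg simp del: One_nat_def plus_1_eq_Suc intro: exec.intros)

section \<open>Hubs and partial colorings\<close>

text \<open>A partial coloring is a total function in which the color \<open>0\<close> means deleted.\<close>

definition partial_coloring :: "nat \<Rightarrow> 'a pair_pre_digraph \<Rightarrow> ('a \<Rightarrow> nat) \<Rightarrow> bool" where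
  "partial_coloring q G f \<longleftrightarrow> (\<forall>v\<in>pverts G. f v \<le> q) \<and>
     (\<forall>(u, v)\<in>parcs G. f u \<noteq> 0 \<longrightarrow> f u \<noteq> f v)"

definition deleted :: "'a pair_pre_digraph \<Rightarrow> ('a \<Rightarrow> nat) \<Rightarrow> 'a set" where
  "deleted G f = {v \<in> pverts G. f v = 0}"

lemma arcs_ends_delete_verts:
  "arcs_ends (delete_verts G X) = {(u, v). (u, v) \<in> parcs G \<and> u \<in> pverts G - X \<and> v \<in> pverts G - X}"
  by (auto simp: arcs_ends_def arc_to_ends_def delete_verts_def induce_subgraph_def with_proj_def
      image_iff)

lemma verts_delete_verts [simp]: "verts (delete_verts G X) = pverts G - X"
  by (simp add: delete_verts_def)

lemma coloring_deletion_set_deleted: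
  assumes "partial_coloring q G f"
  shows "coloring_deletion_set q G (deleted G f)"
  unfolding coloring_deletion_set_def proper_coloring_def
  using assms by (auto simp: partial_coloring_def deleted_def arcs_ends_delete_verts intro!: exI[of _ f])

lemma coloring_deletion_setE:
  assumes "coloring_deletion_set q G X"
  obtains f where "partial_coloring q G f" "deleted G f = X"
proof -
  obtain f where f: "X \<subseteq> pverts G" "proper_coloring q (delete_verts G X) f"
    using assms by (auto simp: coloring_deletion_set_def)
  let ?f = "\<lambda>v. if v \<in> pverts G - X then f v else 0"
  have "f v \<in> {1..q}" if "v \<in> pverts G - X" for v
    using f(2) that by (auto simp: proper_coloring_def)
  then have "deleted G ?f = X" using f(1) by (force simp: deleted_def)
  moreover have "partial_coloring q G ?f"
    unfolding partial_coloring_def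
  proof safe
    fix v assume "v \<in> pverts G" then show "?f v \<le> q"
      using f(2) by (auto simp: proper_coloring_def)
  next
    fix u v assume uv: "(u, v) \<in> parcs G" "?f u = ?f v" "0 < ?f u"
    then have "u \<in> pverts G - X" "v \<in> pverts G - X" by (auto split: if_splits)
    then show False using f(2) uv unfolding proper_coloring_def arcs_ends_delete_verts by auto
  qed
  ultimately show ?thesis using that by blast
qed

lemma min_coloring_deletion_setI:
  assumes "partial_coloring q G f" and "\<And>g. partial_coloring q G g \<Longrightarrow> card (deleted G f) \<le> card (deleted G g)"
  shows "min_coloring_deletion_set q G (deleted G f)"
  unfolding min_coloring_deletion_set_def
  using assms coloring_deletion_set_deleted by (auto elim!: coloring_deletion_setE)

text \<open>Turns an optimal solution into the answer to a threshold question, which is all that the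
  reduction asks of a solver.\<close>

lemma min_coloring_deletion_set_le_iff:
  assumes "min_coloring_deletion_set q G X"
  shows "card X \<le> B \<longleftrightarrow> (\<exists>f. partial_coloring q G f \<and> card (deleted G f) \<le> B)"
proof
  assume "card X \<le> B"
  then show "\<exists>f. partial_coloring q G f \<and> card (deleted G f) \<le> B"
    using assms by (auto simp: min_coloring_deletion_set_def elim!: coloring_deletion_setE)
next
  assume "\<exists>f. partial_coloring q G f \<and> card (deleted G f) \<le> B"
  then show "card X \<le> B"
    using assms coloring_deletion_set_deleted order_trans
    unfolding min_coloring_deletion_set_def by blast
qed

lemma sym_digraph_delete_verts:
  assumes "pair_graph G"
  shows "sym_digraph (delete_verts G X)"
proof -
  interpret pair_graph G by fact
  have sym: "sym (parcs G)" using pair_sym_arcs by (simp add: symmetric_def)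
  have "wf_digraph (delete_verts G X)"
    by unfold_locales (auto simp: delete_verts_def induce_subgraph_def)
  moreover have "symmetric (delete_verts G X)"
    using sym by (auto simp: symmetric_def arcs_ends_delete_verts sym_def)
  ultimately show ?thesis by (simp add: sym_digraph_def sym_digraph_axioms_def)
qed

text \<open>A component on which \<open>g\<close> deletes fewer vertices than \<open>f\<close> can be recolored according to
  \<open>g\<close>, as its neighbours outside are in the hub, where \<open>f\<close> and \<open>g\<close> agree.\<close>

lemma hub_local_improvement:
  assumes "pair_graph G" "hub \<sigma> \<delta> G Q" "partial_coloring q G f" "partial_coloring q G g"
    and agree: "\<And>v. v \<in> Q \<Longrightarrow> f v = g v" and less: "card (deleted G g) < card (deleted G f)"
  obtains h C where "partial_coloring q G h" "C \<subseteq> pverts G - Q" "card C \<le> \<sigma>"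
    "\<And>v. v \<notin> C \<Longrightarrow> h v = f v" "card (deleted G h) < card (deleted G f)"
proof -
  interpret pair_graph G by fact
  let ?H = "delete_verts G Q"
  interpret H: sym_digraph ?H by (rule sym_digraph_delete_verts) fact
  have Q: "Q \<subseteq> pverts G" using assms(2) by (simp add: hub_def)
  have fin: "finite (pverts G)" by simp
  have cover: "\<Union>H.sccs_verts = pverts G - Q"
    using H.sccs_verts_subsets H.in_scc_of_self H.scc_of_in_sccs_verts by fastforce
  have fin_sv: "finite H.sccs_verts"
    using fin cover by (metis finite_Diff finite_UnionD)
  have split: "card (deleted G e) = card {v\<in>Q. e v = 0} + (\<Sum>C\<in>H.sccs_verts. card {v\<in>C. e v = 0})"
    for e :: "'a \<Rightarrow> nat"
  proof -
    have "deleted G e = {v\<in>Q. e v = 0} \<union> (\<Union>C\<in>H.sccs_verts. {v\<in>C. e v = 0})"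
      using cover Q by (auto simp: deleted_def)
    moreover have "card (\<Union>C\<in>H.sccs_verts. {v\<in>C. e v = 0}) = (\<Sum>C\<in>H.sccs_verts. card {v\<in>C. e v = 0})"
    proof (rule card_UN_disjoint[OF fin_sv])
      show "\<forall>C\<in>H.sccs_verts. finite {v \<in> C. e v = 0}"
        using cover by (auto intro!: finite_subset[OF _ fin])
      show "\<forall>C\<in>H.sccs_verts. \<forall>D\<in>H.sccs_verts. C \<noteq> D \<longrightarrow> {v \<in> C. e v = 0} \<inter> {v \<in> D. e v = 0} = {}"
        using H.sccs_verts_disjoint by blast
    qed
    moreover have "card ({v\<in>Q. e v = 0} \<union> (\<Union>C\<in>H.sccs_verts. {v\<in>C. e v = 0})) =
        card {v\<in>Q. e v = 0} + card (\<Union>C\<in>H.sccs_verts. {v\<in>C. e v = 0})"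
    proof (rule card_Un_disjoint)
      show "finite {v \<in> Q. e v = 0}" using Q fin by (auto intro: finite_subset)
      show "finite (\<Union>C\<in>H.sccs_verts. {v \<in> C. e v = 0})"
        by (rule finite_subset[of _ "pverts G"]) (use cover fin in auto)
      show "{v \<in> Q. e v = 0} \<inter> (\<Union>C\<in>H.sccs_verts. {v \<in> C. e v = 0}) = {}" using cover by blast
    qed
    ultimately show ?thesis by simp
  qed
  have "{v\<in>Q. f v = 0} = {v\<in>Q. g v = 0}" using agree by auto
  \<comment> \<open>The hub contributes equally to both counts, so some component must account for
    the difference.\<close>
  then have "(\<Sum>C\<in>H.sccs_verts. card {v\<in>C. g v = 0}) < (\<Sum>C\<in>H.sccs_verts. card {v\<in>C. f v = 0})"
    using less split[of f] split[of g] by simp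
  then obtain C where C: "C \<in> H.sccs_verts" "card {v\<in>C. g v = 0} < card {v\<in>C. f v = 0}"
    by (metis (no_types, lifting) not_le sum_mono)
  have CV: "C \<subseteq> pverts G - Q" using C cover by auto
  define h where "h v = (if v \<in> C then g v else f v)" for v
  have "card C \<le> \<sigma>"
    using C(1) assms(2) H.sccs_verts_conv by (auto simp: hub_def)
  moreover have closed: "v \<in> C" if "(u, v) \<in> parcs G \<or> (v, u) \<in> parcs G" "u \<in> C" "v \<notin> Q" for u v
  proof -
    have "(u, v) \<in> parcs G" "(v, u) \<in> parcs G"
      using that(1) pair_sym_arcs by (auto simp: symmetric_def sym_def)
    moreover have "u \<in> pverts G - Q" "v \<in> pverts G - Q"
      using that CV calculation by (auto simp: in_arcsD2)
    ultimately have "u \<rightarrow>\<^bsub>?H\<^esub> v" "v \<rightarrow>\<^bsub>?H\<^esub> u" by (auto simp: arcs_ends_delete_verts)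
    then have "u \<rightarrow>\<^sup>*\<^bsub>?H\<^esub> v" "v \<rightarrow>\<^sup>*\<^bsub>?H\<^esub> u" by (auto intro: H.reachable_adjI)
    then show ?thesis using C(1) that(2) unfolding H.in_sccs_verts_conv_reachable by blast
  qed
  moreover have "partial_coloring q G h"
    unfolding partial_coloring_def
  proof safe
    fix v assume "v \<in> pverts G" then show "h v \<le> q"
      using assms(3,4) by (auto simp: h_def partial_coloring_def)
  next
    fix u v assume uv: "(u, v) \<in> parcs G" "0 < h u" "h u = h v"
    show False
    proof (cases "u \<in> C \<longleftrightarrow> v \<in> C")
      case True
      then show False using uv assms(3,4) by (auto simp: h_def partial_coloring_def split: if_splits)
    next
      case False
      \<comment> \<open>An edge leaving \<open>C\<close> ends in the hub, where \<open>f\<close> and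
        \<open>g\<close> agree; hence \<open>h\<close> equals \<open>g\<close> at both ends.\<close>
      then consider "u \<in> C" "v \<notin> C" "v \<in> Q" | "u \<notin> C" "v \<in> C" "u \<in> Q"
        using closed[of u v] closed[of v u] uv(1) by blast
      then have "h u = g u \<and> h v = g v" using agree by cases (simp_all add: h_def)
      then show False using uv assms(4) by (auto simp: partial_coloring_def)
    qed
  qed
  moreover have "card (deleted G h) < card (deleted G f)"
  proof -
    have eq: "card {v\<in>D. h v = 0} = card {v\<in>D. f v = 0}" if "D \<in> H.sccs_verts" "D \<noteq> C" for D
    proof -
      have "D \<inter> C = {}" using H.sccs_verts_disjoint that C(1) by blast
      then have "{v\<in>D. h v = 0} = {v\<in>D. f v = 0}" by (auto simp: h_def)
      then show ?thesis by simp
    qed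
    have "{v\<in>C. h v = 0} = {v\<in>C. g v = 0}" by (auto simp: h_def)
    then have "card {v\<in>C. h v = 0} < card {v\<in>C. f v = 0}" using C(2) by simp
    then have "(\<Sum>D\<in>H.sccs_verts. card {v\<in>D. h v = 0}) < (\<Sum>D\<in>H.sccs_verts. card {v\<in>D. f v = 0})"
    proof (intro sum_strict_mono_ex1[OF fin_sv] ballI bexI[of _ C])
      fix D assume "D \<in> H.sccs_verts"
      then show "card {v\<in>D. h v = 0} \<le> card {v\<in>D. f v = 0}"
        using eq[of D] \<open>card {v\<in>C. h v = 0} < card {v\<in>C. f v = 0}\<close> by (cases "D = C") auto
    qed (use C in auto)
    moreover have "{v\<in>Q. h v = 0} = {v\<in>Q. f v = 0}" using CV by (auto simp: h_def)
    ultimately show ?thesis using split[of h] split[of f] by simp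
  qed
  moreover have "\<And>v. v \<notin> C \<Longrightarrow> h v = f v" by (simp add: h_def)
  ultimately show ?thesis using CV that by blast
qed

text \<open>Paths outside \<open>Q\<close> preserve the label \<open>\<kappa>\<close>, so each
  component lies in one label class. Bounds for the classes therefore suffice, and the components of
  a constructed graph stay implicit.\<close>

lemma hubI:
  assumes "pair_graph G" "Q \<subseteq> pverts G"
    and inv: "\<And>u v. (u, v) \<in> parcs G \<Longrightarrow> u \<notin> Q \<Longrightarrow> v \<notin> Q \<Longrightarrow> \<kappa> u = \<kappa> v"
    and small: "\<And>i. card {u \<in> pverts G - Q. \<kappa> u = i} \<le> \<sigma>"
    and nbrs: "\<And>i. card {v \<in> Q. \<exists>u \<in> pverts G - Q. \<kappa> u = i \<and> (u, v) \<in> parcs G} \<le> \<delta>"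
  shows "hub \<sigma> \<delta> G Q"
  unfolding hub_def
proof (intro conjI ballI)
  interpret pair_graph G by fact
  let ?H = "delete_verts G Q"
  interpret H: sym_digraph ?H by (rule sym_digraph_delete_verts) fact
  have fin: "finite (pverts G)" by simp
  have fin': "finite {v \<in> pverts G - Q. \<kappa> v = i}" for i using fin by simp
  have reach: "\<kappa> u = \<kappa> v" if "u \<rightarrow>\<^sup>*\<^bsub>?H\<^esub> v" for u v
    using that
  proof (induction rule: H.reachable_induct)
    case base then show ?case by simp
  next
    case (step v w)
    then show ?case using inv[of v w] by (auto simp: arcs_ends_delete_verts)
  qed
  fix C assume C: "C \<in> H.sccs"
  then have "verts C \<in> H.sccs_verts" by (simp add: H.sccs_verts_conv)
  then obtain u where u: "u \<in> verts C" "\<forall>v\<in>verts C. u \<rightarrow>\<^sup>*\<^bsub>?H\<^esub> v"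
    unfolding H.in_sccs_verts_conv_reachable by blast
  have sub: "verts C \<subseteq> {v \<in> pverts G - Q. \<kappa> v = \<kappa> u}"
  proof
    fix v assume v: "v \<in> verts C"
    then have "v \<in> verts ?H" using H.sccs_verts_subsets[OF \<open>verts C \<in> H.sccs_verts\<close>] by blast
    moreover have "\<kappa> u = \<kappa> v" using u(2) v reach by blast
    ultimately show "v \<in> {v \<in> pverts G - Q. \<kappa> v = \<kappa> u}" by simp
  qed
  show "card (verts C) \<le> \<sigma>"
    using card_mono[OF fin' sub] small[of "\<kappa> u"] by linarith
  have "{v \<in> Q. \<exists>u\<in>verts C. (u, v) \<in> parcs G} \<subseteq>
      {v \<in> Q. \<exists>w \<in> pverts G - Q. \<kappa> w = \<kappa> u \<and> (w, v) \<in> parcs G}"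
    using sub by blast
  then have "card {v \<in> Q. \<exists>u\<in>verts C. (u, v) \<in> parcs G} \<le>
      card {v \<in> Q. \<exists>w \<in> pverts G - Q. \<kappa> w = \<kappa> u \<and> (w, v) \<in> parcs G}"
    using assms(2) fin by (intro card_mono) (auto intro: finite_subset)
  then show "card {v \<in> Q. \<exists>u\<in>verts C. (u, v) \<in> parcs G} \<le> \<delta>"
    using nbrs[of "\<kappa> u"] by linarith
qed (fact assms(2))

section \<open>The algorithm\<close>

text \<open>The frame conditions are carried along once and for all, so that invariants need only
  mention what the loop body changes.\<close>

lemma LFor_invariant_frame:
  assumes "lwf (LFor i m B)" and "regs s m = n"
    and "I 0 (for_init i n s)"
    and step: "\<And>k s'. k < n \<Longrightarrow> I k s' \<Longrightarrow> regs s' i = k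
      \<Longrightarrow> (\<And>r. r \<notin> wregs B \<Longrightarrow> r \<noteq> i \<Longrightarrow> r \<noteq> Suc i \<Longrightarrow> regs s' r = regs s r)
      \<Longrightarrow> (\<And>a. a \<notin> warrs B \<Longrightarrow> arrs s' a = arrs s a)
      \<Longrightarrow> I (Suc k) (for_step i n (lsem B) s')"
  shows "I n (lsem (LFor i m B) s)"
proof -
  let ?F = "\<lambda>s'. (\<forall>r. r \<notin> wregs B \<longrightarrow> r \<noteq> i \<longrightarrow> r \<noteq> Suc i \<longrightarrow> regs s' r = regs s r) \<and>
    (\<forall>a. a \<notin> warrs B \<longrightarrow> arrs s' a = arrs s a)"
  have "(\<lambda>k s'. I k s' \<and> ?F s') n (lsem (LFor i m B) s)"
    by (rule LFor_invariant[OF assms(1,2)])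
      (use assms(3) step in \<open>auto simp: lsem_frame_regs lsem_frame_arrs\<close>)
  then show ?thesis by simp
qed

section \<open>Registers, arrays and text of the hub algorithm\<close>

abbreviation (input) "rZERO \<equiv> 2 :: nat"
abbreviation (input) "rONE \<equiv> 3 :: nat"
abbreviation (input) "rN \<equiv> 4 :: nat"
abbreviation (input) "rQC \<equiv> 5 :: nat"
abbreviation (input) "rW \<equiv> 6 :: nat"
abbreviation (input) "rPTR \<equiv> 7 :: nat"
abbreviation (input) "rE \<equiv> 8 :: nat"
abbreviation (input) "rCNT \<equiv> 9 :: nat"
abbreviation (input) "rOK \<equiv> 10 :: nat"
abbreviation (input) "rCUR \<equiv> 11 :: nat"
abbreviation (input) "rFOUND \<equiv> 12 :: nat"
abbreviation (input) "rBEST \<equiv> 13 :: nat"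
abbreviation (input) "rFU \<equiv> 14 :: nat"
abbreviation (input) "rFV \<equiv> 15 :: nat"
abbreviation (input) "rD \<equiv> 16 :: nat"
abbreviation (input) "rCARRY \<equiv> 17 :: nat"
abbreviation (input) "rTMP \<equiv> 18 :: nat"
text \<open>A loop over register \<open>i\<close> also occupies \<open>Suc i\<close>, hence the
  gaps. Each depth of the search owns five registers: two loops and the old color.\<close>

abbreviation (input) "rU \<equiv> 20 :: nat"
abbreviation (input) "rV \<equiv> 22 :: nat"
abbreviation (input) "rIT \<equiv> 24 :: nat"
abbreviation (input) "rPASS \<equiv> 26 :: nat"
abbreviation (input) "rVd d \<equiv> 30 + 5 * d :: nat"
abbreviation (input) "rCd d \<equiv> 32 + 5 * d :: nat"
abbreviation (input) "rOLDd d \<equiv> 34 + 5 * d :: nat"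
abbreviation (input) "aIN \<equiv> 0 :: nat"
abbreviation (input) "aOUT \<equiv> 1 :: nat"
abbreviation (input) "aQ \<equiv> 2 :: nat"
abbreviation (input) "aF \<equiv> 3 :: nat"

text \<open>\<open>rPTR\<close> runs through the adjacency matrix once, which replaces the
  multiplication in addresses. Equality of two colors is tested by truncated subtraction in both
  directions.\<close>

definition check_row :: lprog where
  "check_row = LFor rV rN
     (LLoad rE aIN rPTR ;; LAdd rPTR rPTR rONE ;;
      LIf rE
        (LIf rFU
          (LLoad rFV aF rV ;; LSub rD rFU rFV ;;
           LIf rD LSkip (LSub rD rFV rFU ;; LIf rD LSkip (LConst rOK 0)))
          LSkip)
        LSkip)"

definition check :: lprog where
  "check = LConst rOK 1 ;; LConst rCNT 0 ;; LConst rPTR 1 ;;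
     LFor rU rN (LLoad rFU aF rU ;; LIf rFU LSkip (LAdd rCNT rCNT rONE) ;; check_row)"

text \<open>The recursion takes place when the program text is generated: depth \<open>d\<close>
  gives \<open>2 * d\<close> nested loops, which is polynomial for fixed \<open>d\<close>. The
  coloring is changed in place; a failed move is undone, a successful one is kept.\<close>

primrec try_moves :: "nat \<Rightarrow> lprog" where
  "try_moves 0 = check ;;
     LIf rOK (LSub rD rCUR rCNT ;; LIf rD (LConst rFOUND 1 ;; LAdd rCUR rCNT rZERO) LSkip) LSkip"
| "try_moves (Suc d) = LFor (rVd d) rN (LFor (rCd d) rQC
     (LLoad rE aQ (rVd d) ;;
      LIf rE LSkip (LIf rFOUND LSkip
        (LLoad (rOLDd d) aF (rVd d) ;; LStore aF (rVd d) (rCd d) ;; try_moves d ;;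
         LIf rFOUND LSkip (LStore aF (rVd d) (rOLDd d))))))"

text \<open>A successful pass lowers the number of deletions, which is at most \<open>n\<close> at
  the start, so \<open>n\<close> passes reach a local optimum.\<close>

definition search :: "nat \<Rightarrow> lprog" where
  "search \<sigma> = LAdd rCUR rCNT rZERO ;; LFor rPASS rN (LConst rFOUND 0 ;; try_moves \<sigma>)"

definition update_best :: lprog where
  "update_best = LSub rD rBEST rCUR ;;
     LIf rD (LAdd rBEST rCUR rZERO ;;
       LFor rU rN (LLoad rFU aF rU ;; LIf rFU (LStore aOUT rU rZERO) (LStore aOUT rU rONE))) LSkip"

text \<open>With everything outside the hub deleted, validity depends on the edges inside the hub
  only. This gives both the test of a hub coloring and the starting point of the search.\<close>

definition reset :: lprog where
  "reset = LFor rU rN (LLoad rE aQ rU ;; LIf rE LSkip (LStore aF rU rZERO))"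

definition odometer :: lprog where
  "odometer = LConst rCARRY 1 ;; LFor rU rN
     (LIf rCARRY
       (LLoad rE aQ rU ;; LIf rE
         (LLoad rFU aF rU ;; LAdd rFU rFU rONE ;; LSub rD rQC rFU ;;
          LIf rD (LStore aF rU rFU ;; LConst rCARRY 0) (LStore aF rU rZERO)) LSkip) LSkip)"

definition main_loop :: "nat \<Rightarrow> lprog" where
  "main_loop \<sigma> = LFor rIT rW
     (reset ;; check ;; LIf rOK (search \<sigma> ;; update_best) LSkip ;; odometer)"

lemma wregs_check_row: "wregs check_row = {rV, Suc rV, rE, rPTR, rFV, rD, rOK}"
  by (auto simp: check_row_def)

lemma wregs_check: "wregs check = {rU, Suc rU, rV, Suc rV, rE, rPTR, rFU, rFV, rD, rOK, rCNT}"
  by (auto simp: check_def wregs_check_row)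

lemma warrs_check_row: "warrs check_row = {}"
  by (auto simp: check_row_def)

lemma warrs_check: "warrs check = {}"
  by (auto simp: check_def warrs_check_row)

lemma lwf_check: "lwf check"
  by (auto simp: check_def check_row_def)

lemma wregs_try_moves:
  "wregs (try_moves d) \<subseteq> {rU, Suc rU, rV, Suc rV, rE, rPTR, rFU, rFV, rD, rOK, rCNT, rCUR, rFOUND}
     \<union> {30..<30 + 5 * d}"
  by (induction d) (auto simp: wregs_check)

lemma warrs_try_moves: "warrs (try_moves d) \<subseteq> {aF}"
  by (induction d) (auto simp: warrs_check)

lemma not_in_wregs_try_moves:
  "r \<notin> {rU, Suc rU, rV, Suc rV, rE, rPTR, rFU, rFV, rD, rOK, rCNT, rCUR, rFOUND} \<Longrightarrow>
   r < 30 \<or> 30 + 5 * d \<le> r \<Longrightarrow> r \<notin> wregs (try_moves d)"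
  using wregs_try_moves[of d] by auto

lemma lwf_try_moves: "lwf (try_moves d)"
  by (induction d) (auto simp: lwf_check not_in_wregs_try_moves)

section \<open>Correctness of the check and of the local search\<close>

locale hub_instance =
  fixes q \<sigma> \<delta> :: nat and G :: "nat pair_pre_digraph" and Q :: "nat set" and n :: nat
  assumes input: "input_graph G" and hub: "hub \<sigma> \<delta> G Q" and n_def: "n = card (pverts G)"
begin

lemma pverts_eq: "pverts G = {..<n}"
  using input by (simp add: input_graph_def n_def)

lemma pair_graph: "pair_graph G"
  using input by (simp add: input_graph_def)

lemma Q_subset: "Q \<subseteq> {..<n}"
  using hub by (simp add: hub_def pverts_eq)

lemma parcs_less: "(u, v) \<in> parcs G \<Longrightarrow> u < n \<and> v < n"
proof -
  interpret pair_graph G by (rule pair_graph)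
  show "(u, v) \<in> parcs G \<Longrightarrow> u < n \<and> v < n"
    using in_arcsD1[of u v] in_arcsD2[of u v] pverts_eq by auto
qed

definition loaded :: "ram_state \<Rightarrow> bool" where
  "loaded s \<longleftrightarrow> regs s rZERO = 0 \<and> regs s rONE = 1 \<and> regs s rN = n \<and> regs s rQC = Suc q \<and>
     (\<forall>u<n. \<forall>v<n. arrs s aIN (1 + u * n + v) = of_bool ((u, v) \<in> parcs G)) \<and>
     (\<forall>v<n. arrs s aQ v = of_bool (v \<in> Q))"

lemma loaded_cong:
  assumes "loaded s" "\<And>r. r \<in> {rZERO, rONE, rN, rQC} \<Longrightarrow> regs s' r = regs s r"
    "arrs s' aIN = arrs s aIN" "arrs s' aQ = arrs s aQ"
  shows "loaded s'"
  using assms unfolding loaded_def by simp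

lemma loaded_lsem:
  assumes "loaded s" "wregs P \<inter> {rZERO, rONE, rN, rQC} = {}" "warrs P \<inter> {aIN, aQ} = {}"
  shows "loaded (lsem P s)"
  by (rule loaded_cong[OF assms(1)])
    (use assms(2,3) in \<open>auto intro!: lsem_frame_regs lsem_frame_arrs\<close>)

definition conflict :: "(nat \<Rightarrow> nat) \<Rightarrow> nat \<Rightarrow> nat \<Rightarrow> bool" where
  "conflict f u v \<longleftrightarrow> (u, v) \<in> parcs G \<and> f u \<noteq> 0 \<and> f u = f v"

definition valid :: "(nat \<Rightarrow> nat) \<Rightarrow> bool" where
  "valid f \<longleftrightarrow> (\<forall>u<n. \<forall>v<n. \<not> conflict f u v)"

definition cost :: "(nat \<Rightarrow> nat) \<Rightarrow> nat" where
  "cost f = card {v. v < n \<and> f v = 0}"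

lemma partial_coloring_iff: "partial_coloring q G f \<longleftrightarrow> valid f \<and> (\<forall>v<n. f v \<le> q)"
  using parcs_less by (fastforce simp: partial_coloring_def valid_def conflict_def pverts_eq)

lemma cost_eq: "cost f = card (deleted G f)"
  by (simp add: cost_def deleted_def pverts_eq)

lemma check_row_spec:
  assumes "loaded s" "u < n" "regs s rPTR = 1 + u * n" "regs s rFU = arrs s aF u"
  defines "s' \<equiv> lsem check_row s"
  shows "regs s' rPTR = 1 + Suc u * n"
    "regs s' rOK = (if \<exists>v<n. conflict (arrs s aF) u v then 0 else regs s rOK)"
proof -
  let ?f = "arrs s aF"
  let ?body = "LLoad rE aIN rPTR ;; LAdd rPTR rPTR rONE ;;
      LIf rE
        (LIf rFU
          (LLoad rFV aF rV ;; LSub rD rFU rFV ;;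
           LIf rD LSkip (LSub rD rFV rFU ;; LIf rD LSkip (LConst rOK 0)))
          LSkip)
        LSkip"
  define I where "I k s' \<longleftrightarrow> regs s' rPTR = 1 + u * n + k \<and>
      regs s' rOK = (if \<exists>v<k. conflict ?f u v then 0 else regs s rOK)" for k and s' :: ram_state
  have "I n s'"
    unfolding s'_def check_row_def
  proof (rule LFor_invariant_frame, goal_cases)
    case 1 show ?case by simp
  next
    case 2 show ?case using assms(1) by (simp add: loaded_def)
  next
    case 3 show ?case using assms(3) by (simp add: I_def)
  next
    case (4 k s')
    have fr: "regs s' rFU = ?f u" "regs s' rONE = 1" "arrs s' = arrs s"
      using 4(4)[of rFU] 4(4)[of rONE] 4(5) assms(1,4) by (auto simp: loaded_def fun_eq_iff)
    have ex: "(\<exists>v<Suc k. conflict ?f u v) \<longleftrightarrow> (\<exists>v<k. conflict ?f u v) \<or> conflict ?f u k"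
      by (auto simp: less_Suc_eq)
    have "arrs s aIN (1 + u * n + k) = of_bool ((u, k) \<in> parcs G)"
      using assms(1,2) 4(1) by (simp add: loaded_def)
    then have b: "regs (for_step rV n (lsem ?body) s') rPTR = 1 + u * n + Suc k"
      "regs (for_step rV n (lsem ?body) s') rOK = (if conflict ?f u k then 0 else regs s' rOK)"
      using 4(2,3) fr by (auto simp: I_def conflict_def)
    have "regs s' rOK = (if \<exists>v<k. conflict ?f u v then 0 else regs s rOK)" using 4(2) by (simp add: I_def)
    then show ?case unfolding I_def b ex by auto
  qed
  then show "regs s' rPTR = 1 + Suc u * n"
    "regs s' rOK = (if \<exists>v<n. conflict (arrs s aF) u v then 0 else regs s rOK)"
    by (auto simp: I_def)
qed

lemma check_spec:
  assumes "loaded s"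
  defines "s' \<equiv> lsem check s" and "f \<equiv> arrs s aF"
  shows "regs s' rOK = of_bool (valid f)" "regs s' rCNT = cost f" "loaded s'" "arrs s' = arrs s"
proof -
  show fr: "arrs s' = arrs s"
    unfolding s'_def by (rule ext) (simp add: lsem_frame_arrs warrs_check)
  show "loaded s'" unfolding s'_def by (rule loaded_lsem[OF assms(1)]) (auto simp: wregs_check warrs_check)
  define I where "I k s' \<longleftrightarrow> regs s' rPTR = 1 + k * n \<and>
      regs s' rOK = of_bool (\<forall>u<k. \<forall>v<n. \<not> conflict f u v) \<and>
      regs s' rCNT = card {v. v < k \<and> f v = 0}" for k and s' :: ram_state
  define s0 where "s0 = lsem (LConst rOK 1 ;; LConst rCNT 0 ;; LConst rPTR 1) s"
  have s': "s' = lsem (LFor rU rN (LLoad rFU aF rU ;; LIf rFU LSkip (LAdd rCNT rCNT rONE) ;; check_row)) s0"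
    by (simp add: s'_def check_def s0_def)
  have "I n s'"
    unfolding s'
  proof (rule LFor_invariant_frame, goal_cases)
    case 1 show ?case using lwf_check by (simp add: check_def)
  next
    case 2 show ?case using assms(1) by (simp add: loaded_def s0_def)
  next
    case 3 show ?case by (simp add: I_def s0_def)
  next
    case (4 k s')
    have arr: "arrs s' = arrs s" using 4(5) by (auto simp: fun_eq_iff s0_def warrs_check_row)
    have ld: "loaded s'"
      by (rule loaded_cong[OF assms(1)]) (use 4(4) arr in \<open>auto simp: s0_def wregs_check_row\<close>)
    define s1 where "s1 = lsem (LLoad rFU aF rU ;; LIf rFU LSkip (LAdd rCNT rCNT rONE)) s'"
    have s1: "regs s1 rFU = f k" "arrs s1 = arrs s" "regs s1 rPTR = 1 + k * n"
      "regs s1 rOK = regs s' rOK"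
      "regs s1 rCNT = (if f k = 0 then Suc (regs s' rCNT) else regs s' rCNT)"
      using 4(2,3) arr ld by (auto simp: s1_def I_def f_def loaded_def)
    have ld1: "loaded s1" unfolding s1_def by (rule loaded_lsem[OF ld]) auto
    have row: "regs (lsem check_row s1) rPTR = 1 + Suc k * n"
      "regs (lsem check_row s1) rOK = (if \<exists>v<n. conflict f k v then 0 else regs s1 rOK)"
      using check_row_spec[OF ld1 4(1)] s1 by (auto simp: f_def)
    have cnt: "regs (lsem check_row s1) rCNT = regs s1 rCNT"
      by (rule lsem_frame_regs) (simp add: wregs_check_row)
    have set: "{v. v < Suc k \<and> f v = 0} = (if f k = 0 then insert k {v. v < k \<and> f v = 0} else {v. v < k \<and> f v = 0})"
      by (auto simp: less_Suc_eq)
    have "lsem (LLoad rFU aF rU ;; LIf rFU LSkip (LAdd rCNT rCNT rONE) ;; check_row) s' = lsem check_row s1"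
      by (simp add: s1_def)
    then show ?case
      using row cnt s1 4(2,3) unfolding I_def set by (auto simp: less_Suc_eq)
  qed
  then show "regs s' rOK = of_bool (valid f)" "regs s' rCNT = cost f"
    by (auto simp: I_def valid_def cost_def)
qed

text \<open>Exactly \<open>d\<close> recolorings, possibly of the same vertex or without effect,
  which is what the nested loops try.\<close>

primrec moves :: "nat \<Rightarrow> (nat \<Rightarrow> nat) \<Rightarrow> (nat \<Rightarrow> nat) \<Rightarrow> bool" where
  "moves 0 f g \<longleftrightarrow> g = f"
| "moves (Suc d) f g \<longleftrightarrow> (\<exists>v<n. v \<notin> Q \<and> (\<exists>c\<le>q. moves d (f(v := c)) g))"

definition improves :: "nat \<Rightarrow> (nat \<Rightarrow> nat) \<Rightarrow> nat \<Rightarrow> (nat \<Rightarrow> nat) \<Rightarrow> bool" where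
  "improves d f c g \<longleftrightarrow> moves d f g \<and> valid g \<and> cost g < c"

lemma moves_agree: "moves d f g \<Longrightarrow> v \<notin> {..<n} - Q \<Longrightarrow> g v = f v"
proof (induction d arbitrary: f)
  case (Suc d)
  then obtain w e where w: "w < n" "w \<notin> Q" "moves d (f(w := e)) g" by auto
  have "g v = (f(w := e)) v" by (rule Suc.IH) fact+
  moreover have "v \<noteq> w" using w Suc.prems(2) by auto
  ultimately show ?case by simp
qed simp

lemma moves_le: "moves d f g \<Longrightarrow> \<forall>v<n. f v \<le> q \<Longrightarrow> \<forall>v<n. g v \<le> q"
proof (induction d arbitrary: f)
  case (Suc d)
  then obtain w e where "e \<le> q" "moves d (f(w := e)) g" by auto
  moreover have "\<forall>v<n. (f(w := e)) v \<le> q" using Suc.prems(2) \<open>e \<le> q\<close> by simp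
  ultimately show ?case using Suc.IH by blast
qed simp

text \<open>Correct the vertices of \<open>C\<close> one by one. Surplus moves give a vertex outside
  the hub the color it already has; \<open>f \<noteq> g\<close> provides such a vertex.\<close>

lemma movesI:
  assumes "C \<subseteq> {..<n} - Q" "card C \<le> d" "\<And>v. v \<notin> C \<Longrightarrow> g v = f v" "\<forall>v<n. g v \<le> q" "f \<noteq> g"
  shows "moves d f g"
proof -
  obtain w where "f w \<noteq> g w" using assms(5) by auto
  then have "w \<in> C" using assms(3)[of w] by (cases "w \<in> C") auto
  then have w: "w < n" "w \<notin> Q" using assms(1) by auto
  have "moves d f g" if "C \<subseteq> {..<n} - Q" "card C \<le> d" "\<forall>v. v \<notin> C \<longrightarrow> g v = f v" for f C
    using that
  proof (induction d arbitrary: f C)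
    case 0
    then have "C = {}" by (metis card_0_eq finite_Diff finite_lessThan finite_subset le_zero_eq)
    then show ?case using 0 by auto
  next
    case (Suc d)
    show ?case
    proof (cases "C = {}")
      case True
      have "moves d (f(w := g w)) g" using Suc.prems True by (intro Suc.IH[of "{}"]) auto
      then show ?thesis using w assms(4) by auto
    next
      case False
      then obtain v where v: "v \<in> C" by auto
      have fin: "finite C" using Suc.prems by (auto intro: finite_subset)
      have "moves d (f(v := g v)) g"
        using Suc.prems v fin by (intro Suc.IH[of "C - {v}"]) (auto simp: card_Diff_singleton)
      moreover have "v < n" "v \<notin> Q" "g v \<le> q" using v Suc.prems assms(4) by auto
      ultimately show ?thesis unfolding moves.simps by blast
    qed
  qed
  then show ?thesis using assms by blast
qed

text \<open>The claim \<open>none\<close> is a parameter because the loops establish it only for the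
  moves tried so far.\<close>

definition try_result :: "nat \<Rightarrow> (nat \<Rightarrow> nat) \<Rightarrow> nat \<Rightarrow> bool \<Rightarrow> ram_state \<Rightarrow> bool" where
  "try_result d f c none s \<longleftrightarrow>
     (regs s rFOUND = 0 \<and> arrs s aF = f \<and> regs s rCUR = c \<and> none) \<or>
     (regs s rFOUND = 1 \<and> improves d f c (arrs s aF) \<and> regs s rCUR = cost (arrs s aF))"

lemma try_result_mono: "try_result d f c a s \<Longrightarrow> (a \<Longrightarrow> b) \<Longrightarrow> try_result d f c b s"
  unfolding try_result_def by blast

lemma try_moves_spec:
  assumes "loaded s" "regs s rFOUND = 0" "regs s rCUR = c" "arrs s aF = f"
  shows "try_result d f c (\<nexists>g. improves d f c g) (lsem (try_moves d) s)"
  using assms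
proof (induction d arbitrary: s f)
  case 0
  have "regs (lsem check s) rFOUND = 0" "regs (lsem check s) rCUR = c"
    using 0 by (auto simp: lsem_frame_regs wregs_check)
  then show ?case
    using check_spec[OF 0(1)] 0(4)
    by (auto simp: try_result_def improves_def loaded_def)
next
  case (Suc d)
  let ?body = "LLoad rE aQ (rVd d) ;;
      LIf rE LSkip (LIf rFOUND LSkip
        (LLoad (rOLDd d) aF (rVd d) ;; LStore aF (rVd d) (rCd d) ;; try_moves d ;;
         LIf rFOUND LSkip (LStore aF (rVd d) (rOLDd d))))"
  have wf: "lwf (LFor (rVd d) rN (LFor (rCd d) rQC ?body))"
    using lwf_try_moves[of "Suc d"] by simp
  have wr: "wregs ?body \<inter> {rZERO, rONE, rN, rQC} = {}"
    by (auto simp: not_in_wregs_try_moves)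
  have wa: "warrs ?body \<inter> {aIN, aQ} = {}"
    using warrs_try_moves[of d] by auto
  define I where "I k s \<longleftrightarrow> loaded s \<and>
      try_result (Suc d) f c (\<forall>v<k. v \<notin> Q \<longrightarrow> (\<forall>e\<le>q. \<nexists>g. improves d (f(v := e)) c g)) s" for k and s :: ram_state
  have "I n (lsem (LFor (rVd d) rN (LFor (rCd d) rQC ?body)) s)"
  proof (rule LFor_invariant_frame, goal_cases)
    case 1 show ?case by (rule wf)
  next
    case 2 show ?case using Suc.prems by (simp add: loaded_def)
  next
    case 3
    have "loaded (for_init (rVd d) n s)" by (rule loaded_cong[OF Suc.prems(1)]) auto
    then show ?case using Suc.prems by (auto simp: I_def try_result_def)
  next
    case (4 k s1)
    \<comment> \<open>Invariant of the inner loop: as long as nothing is found, all moves at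
      vertices below \<open>k\<close> and all moves of \<open>k\<close> to colors below
      \<open>j\<close> have failed.\<close>
    define J where "J j s \<longleftrightarrow> loaded s \<and> try_result (Suc d) f c
        ((\<forall>v<k. v \<notin> Q \<longrightarrow> (\<forall>e\<le>q. \<nexists>g. improves d (f(v := e)) c g)) \<and>
         (k \<notin> Q \<longrightarrow> (\<forall>e<j. \<nexists>g. improves d (f(k := e)) c g))) s" for j and s :: ram_state
    have "J (Suc q) (lsem (LFor (rCd d) rQC ?body) s1)"
    proof (rule LFor_invariant_frame, goal_cases)
      case 1 show ?case using wf by simp
    next
      case 2 show ?case using 4 by (simp add: I_def loaded_def)
    next
      case 3
      have "loaded (for_init (rCd d) (Suc q) s1)" by (rule loaded_cong[of s1]) (use 4 in \<open>auto simp: I_def\<close>)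
      then show ?case using 4 by (auto simp: I_def J_def try_result_def)
    next
      case (4 j s2)
      note inner = 4
      have ld2: "loaded s2" using inner(2) by (simp add: J_def)
      have rv: "regs s2 (rVd d) = k"
        using inner(4)[of "rVd d"] \<open>regs s1 (rVd d) = k\<close> by (simp add: not_in_wregs_try_moves)
      have E: "arrs s2 aQ k = of_bool (k \<in> Q)" using ld2 \<open>k < n\<close> by (simp add: loaded_def)
      have ld3: "loaded (for_step (rCd d) (Suc q) (lsem ?body) s2)"
        by (rule loaded_cong[OF loaded_lsem[OF ld2 wr wa]]) (auto simp del: lsem.simps)
      show ?case
      proof (cases "k \<in> Q \<or> regs s2 rFOUND \<noteq> 0")
        case True
        then show ?thesis using inner(2) ld3 E rv
          by (auto simp: J_def try_result_def)
      next
        case False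
        define s3 where "s3 = lsem (LLoad rE aQ (rVd d) ;; LLoad (rOLDd d) aF (rVd d) ;; LStore aF (rVd d) (rCd d)) s2"
        have f2: "arrs s2 aF = f" "regs s2 rCUR = c"
          and none: "\<forall>v<k. v \<notin> Q \<longrightarrow> (\<forall>e\<le>q. \<nexists>g. improves d (f(v := e)) c g)"
             "\<forall>e<j. \<nexists>g. improves d (f(k := e)) c g"
          using inner(2) False by (auto simp: J_def try_result_def)
        have s3: "regs s3 rFOUND = 0" "regs s3 rCUR = c" "arrs s3 aF = f(k := j)"
          "regs s3 (rOLDd d) = f k" "regs s3 (rVd d) = k"
          using False f2 rv inner(3) by (auto simp: s3_def)
        have "loaded s3" unfolding s3_def by (rule loaded_lsem[OF ld2]) auto
        define s4 where "s4 = lsem (try_moves d) s3"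
        have r: "try_result d (f(k := j)) c (\<nexists>g. improves d (f(k := j)) c g) s4"
          unfolding s4_def by (rule Suc.IH) fact+
        have s4: "regs s4 (rOLDd d) = f k" "regs s4 (rVd d) = k"
          using s3 by (auto simp: s4_def lsem_frame_regs not_in_wregs_try_moves)
        have eq: "lsem ?body s2 = (if regs s4 rFOUND \<noteq> 0 then s4 else set_cell aF k (f k) s4)"
          using False E rv s4 by (simp add: s4_def s3_def)
        show ?thesis
        proof (cases "regs s4 rFOUND = 0")
          case True
          with r have "\<nexists>g. improves d (f(k := j)) c g" by (auto simp: try_result_def)
          then have "\<forall>e<Suc j. \<nexists>g. improves d (f(k := e)) c g" using none by (auto simp: less_Suc_eq)
          then show ?thesis using True r eq ld3 none
            by (auto simp: J_def try_result_def)
        next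
          case F: False
          then have "improves d (f(k := j)) c (arrs s4 aF)" "regs s4 rCUR = cost (arrs s4 aF)"
            "regs s4 rFOUND = 1"
            using r by (auto simp: try_result_def)
          moreover have "j \<le> q" using inner(1) by simp
          ultimately have "improves (Suc d) f c (arrs s4 aF)"
            using False \<open>k < n\<close> by (auto simp: improves_def)
          then show ?thesis using F eq ld3 \<open>regs s4 rCUR = cost (arrs s4 aF)\<close> \<open>regs s4 rFOUND = 1\<close>
            by (simp add: J_def try_result_def)
        qed
      qed
    qed
    then have J: "loaded (lsem (LFor (rCd d) rQC ?body) s1)"
      "try_result (Suc d) f c
        ((\<forall>v<k. v \<notin> Q \<longrightarrow> (\<forall>e\<le>q. \<nexists>g. improves d (f(v := e)) c g)) \<and>
         (k \<notin> Q \<longrightarrow> (\<forall>e<Suc q. \<nexists>g. improves d (f(k := e)) c g)))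
        (lsem (LFor (rCd d) rQC ?body) s1)"
      unfolding J_def by blast+
    have "try_result (Suc d) f c (\<forall>v<Suc k. v \<notin> Q \<longrightarrow> (\<forall>e\<le>q. \<nexists>g. improves d (f(v := e)) c g))
        (lsem (LFor (rCd d) rQC ?body) s1)"
      by (rule try_result_mono[OF J(2)]) (auto simp: less_Suc_eq order_le_less)
    then have "try_result (Suc d) f c (\<forall>v<Suc k. v \<notin> Q \<longrightarrow> (\<forall>e\<le>q. \<nexists>g. improves d (f(v := e)) c g))
        (for_step (rVd d) n (lsem (LFor (rCd d) rQC ?body)) s1)"
      by (simp add: try_result_def del: lsem.simps)
    moreover have "loaded (for_step (rVd d) n (lsem (LFor (rCd d) rQC ?body)) s1)"
      by (rule loaded_cong[OF J(1)]) (auto simp del: lsem.simps)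
    ultimately show ?case unfolding I_def by blast
  qed
  then have "try_result (Suc d) f c
      (\<forall>v<n. v \<notin> Q \<longrightarrow> (\<forall>e\<le>q. \<nexists>g. improves d (f(v := e)) c g)) (lsem (try_moves (Suc d)) s)"
    unfolding I_def try_moves.simps by blast
  then show ?case by (rule try_result_mono) (auto simp: improves_def)
qed

end

context hub_instance
begin

text \<open>A better coloring with the same hub colors could be transferred to a single component by
  \<open>hub_local_improvement\<close>, and \<open>\<sigma>\<close> moves reach the result.\<close>

lemma no_improving_moves_optimal:
  assumes "valid f" "\<forall>v<n. f v \<le> q" "\<nexists>g. improves \<sigma> f (cost f) g"
    and "partial_coloring q G g" "\<And>v. v \<in> Q \<Longrightarrow> g v = f v"
  shows "cost f \<le> cost g"
proof (rule ccontr)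
  assume "\<not> cost f \<le> cost g"
  then have less: "card (deleted G g) < card (deleted G f)" by (simp add: cost_eq)
  have f: "partial_coloring q G f" using assms by (simp add: partial_coloring_iff)
  obtain h C where h: "partial_coloring q G h" "C \<subseteq> pverts G - Q" "card C \<le> \<sigma>"
    "\<And>v. v \<notin> C \<Longrightarrow> h v = f v" "card (deleted G h) < card (deleted G f)"
    using hub_local_improvement[OF pair_graph hub f assms(4) _ less] assms(5) by metis
  have "f \<noteq> h" using h(5) by auto
  then have "moves \<sigma> f h"
    using h by (intro movesI[of C]) (auto simp: pverts_eq partial_coloring_iff)
  then have "improves \<sigma> f (cost f) h"
    using h by (simp add: improves_def cost_eq partial_coloring_iff)
  then show False using assms(3) by blast
qed

lemma search_spec:
  assumes "loaded s" "arrs s aF = f" "valid f" "\<forall>v<n. f v \<le> q" "regs s rCNT = cost f"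
  defines "s' \<equiv> lsem (search \<sigma>) s"
  shows "loaded s'" "valid (arrs s' aF)" "\<forall>v<n. arrs s' aF v \<le> q" "\<forall>v\<in>Q. arrs s' aF v = f v"
    "regs s' rCUR = cost (arrs s' aF)"
    "\<And>g. partial_coloring q G g \<Longrightarrow> (\<And>v. v \<in> Q \<Longrightarrow> g v = f v) \<Longrightarrow> regs s' rCUR \<le> cost g"
proof -
  \<comment> \<open>Either every pass so far has lowered the cost, or a local optimum is reached.
    After \<open>n\<close> passes the first alternative leaves cost \<open>0\<close>, which is
    optimal as well.\<close>
  define I where "I k s \<longleftrightarrow> loaded s \<and> valid (arrs s aF) \<and> (\<forall>v<n. arrs s aF v \<le> q) \<and>
     (\<forall>v\<in>Q. arrs s aF v = f v) \<and> regs s rCUR = cost (arrs s aF) \<and>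
     (cost (arrs s aF) + k \<le> n \<or> (\<nexists>g. improves \<sigma> (arrs s aF) (cost (arrs s aF)) g))"
    for k and s :: ram_state
  define s0 where "s0 = lsem (LAdd rCUR rCNT rZERO) s"
  have "I n (lsem (LFor rPASS rN (LConst rFOUND 0 ;; try_moves \<sigma>)) s0)"
  proof (rule LFor_invariant_frame, goal_cases)
    case 1 show ?case by (auto simp: lwf_try_moves not_in_wregs_try_moves)
  next
    case 2 show ?case using assms(1) by (simp add: s0_def loaded_def)
  next
    case 3
    have "cost f \<le> n" unfolding cost_def using card_mono[of "{..<n}" "{v. v < n \<and> f v = 0}"] by auto
    moreover have "loaded (for_init rPASS n s0)"
      by (rule loaded_cong[OF assms(1)]) (auto simp: s0_def)
    ultimately show ?case using assms(1-5) by (simp add: I_def s0_def loaded_def)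
  next
    case (4 k s1)
    define f1 where "f1 = arrs s1 aF"
    define s2 where "s2 = lsem (LConst rFOUND 0) s1"
    have ld2: "loaded s2" unfolding s2_def using 4(2) by (intro loaded_lsem) (auto simp: I_def)
    have "arrs s2 aF = f1" "regs s2 rCUR = cost f1" "regs s2 rFOUND = 0"
      using 4(2) by (auto simp: I_def s2_def f1_def)
    then have r: "try_result \<sigma> f1 (cost f1) (\<nexists>g. improves \<sigma> f1 (cost f1) g) (lsem (try_moves \<sigma>) s2)"
      using try_moves_spec[OF ld2] by blast
    define s3 where "s3 = lsem (try_moves \<sigma>) s2"
    have ld3: "loaded s3" unfolding s3_def
      by (rule loaded_lsem[OF ld2]) (use warrs_try_moves[of \<sigma>] in \<open>auto simp: not_in_wregs_try_moves\<close>)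
    have I3: "I (Suc k) s3"
    proof (cases "regs s3 rFOUND = 0")
      case True
      then have "arrs s3 aF = f1" "regs s3 rCUR = cost f1" "\<nexists>g. improves \<sigma> f1 (cost f1) g"
        using r by (auto simp: try_result_def s3_def)
      then show ?thesis using 4(2) ld3 by (auto simp: I_def f1_def)
    next
      case False
      then have i: "improves \<sigma> f1 (cost f1) (arrs s3 aF)" "regs s3 rCUR = cost (arrs s3 aF)"
        using r by (auto simp: try_result_def s3_def)
      then have m: "moves \<sigma> f1 (arrs s3 aF)" "valid (arrs s3 aF)" "cost (arrs s3 aF) < cost f1"
        by (auto simp: improves_def)
      have "\<nexists>g. improves \<sigma> f1 (cost f1) g \<Longrightarrow> False" using i by blast
      then have "cost f1 + k \<le> n" using 4(2) by (auto simp: I_def f1_def)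
      moreover have "\<forall>v\<in>Q. arrs s3 aF v = f v"
        using moves_agree[OF m(1)] 4(2) by (auto simp: I_def f1_def)
      moreover have "\<forall>v<n. arrs s3 aF v \<le> q"
        using moves_le[OF m(1)] 4(2) by (auto simp: I_def f1_def)
      ultimately show ?thesis using m i ld3 unfolding I_def by auto
    qed
    have "loaded (for_step rPASS n (lsem (LConst rFOUND 0 ;; try_moves \<sigma>)) s1)"
      by (rule loaded_cong[OF ld3]) (auto simp: s3_def s2_def)
    then show ?case using I3 by (simp add: I_def s3_def s2_def)
  qed
  then have I: "I n s'" by (simp add: s'_def search_def s0_def)
  then show "loaded s'" "valid (arrs s' aF)" "\<forall>v<n. arrs s' aF v \<le> q" "\<forall>v\<in>Q. arrs s' aF v = f v"
    "regs s' rCUR = cost (arrs s' aF)" by (auto simp: I_def)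
  show "regs s' rCUR \<le> cost g" if "partial_coloring q G g" "\<And>v. v \<in> Q \<Longrightarrow> g v = f v" for g
  proof -
    have "cost (arrs s' aF) \<le> cost g" if "\<nexists>g. improves \<sigma> (arrs s' aF) (cost (arrs s' aF)) g"
      by (rule no_improving_moves_optimal[OF _ _ that]) (use I \<open>partial_coloring q G g\<close> \<open>\<And>v. v \<in> Q \<Longrightarrow> g v = f v\<close> in \<open>auto simp: I_def\<close>)
    then show ?thesis using I by (auto simp: I_def)
  qed
qed

lemma update_best_spec:
  assumes "loaded s"
  defines "s' \<equiv> lsem update_best s"
  shows "regs s rCUR < regs s rBEST \<Longrightarrow> regs s' rBEST = regs s rCUR"
    "regs s rCUR < regs s rBEST \<Longrightarrow> \<forall>v<n. arrs s' aOUT v = of_bool (arrs s aF v = 0)"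
    "\<not> regs s rCUR < regs s rBEST \<Longrightarrow> regs s' rBEST = regs s rBEST \<and> arrs s' aOUT = arrs s aOUT"
    "loaded s'" "arrs s' aF = arrs s aF"
proof -
  show "loaded s'" unfolding s'_def by (rule loaded_lsem[OF assms(1)]) (auto simp: update_best_def)
  show "arrs s' aF = arrs s aF" unfolding s'_def by (rule lsem_frame_arrs) (auto simp: update_best_def)
  show "regs s' rBEST = regs s rBEST \<and> arrs s' aOUT = arrs s aOUT" if "\<not> regs s rCUR < regs s rBEST"
    using that by (simp add: s'_def update_best_def)
  assume less: "regs s rCUR < regs s rBEST"
  define s0 where "s0 = lsem (LSub rD rBEST rCUR ;; LAdd rBEST rCUR rZERO) s"
  let ?body = "LLoad rFU aF rU ;; LIf rFU (LStore aOUT rU rZERO) (LStore aOUT rU rONE)"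
  have s': "s' = lsem (LFor rU rN ?body) s0"
    using less by (simp add: s'_def update_best_def s0_def)
  have "regs s' rBEST = regs s0 rBEST" unfolding s' by (rule lsem_frame_regs) auto
  then show "regs s' rBEST = regs s rCUR" using assms(1) by (simp add: s0_def loaded_def)
  define I where "I k s' \<longleftrightarrow> (\<forall>v<k. arrs s' aOUT v = of_bool (arrs s aF v = 0))" for k and s' :: ram_state
  have "I n s'" unfolding s'
  proof (rule LFor_invariant_frame, goal_cases)
    case 1 show ?case by simp
  next
    case 2 show ?case using assms(1) by (simp add: s0_def loaded_def)
  next
    case 3 show ?case by (simp add: I_def)
  next
    case (4 k s1)
    have "arrs s1 aF = arrs s aF" "regs s1 rZERO = 0" "regs s1 rONE = 1"
      using 4(4)[of rZERO] 4(4)[of rONE] 4(5)[of aF] assms(1) by (auto simp: s0_def loaded_def)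
    then show ?case using 4(2,3) by (auto simp: I_def less_Suc_eq)
  qed
  then show "\<forall>v<n. arrs s' aOUT v = of_bool (arrs s aF v = 0)" by (simp add: I_def)
qed

lemma reset_spec:
  assumes "loaded s"
  defines "s' \<equiv> lsem reset s"
  shows "arrs s' aF = (\<lambda>v. if v < n \<and> v \<notin> Q then 0 else arrs s aF v)" "loaded s'"
proof -
  show "loaded s'" unfolding s'_def by (rule loaded_lsem[OF assms(1)]) (auto simp: reset_def)
  define I where "I k s' \<longleftrightarrow> arrs s' aF = (\<lambda>v. if v < k \<and> v \<notin> Q then 0 else arrs s aF v)"
    for k and s' :: ram_state
  have "I n s'" unfolding s'_def reset_def
  proof (rule LFor_invariant_frame, goal_cases)
    case 1 show ?case by simp
  next
    case 2 show ?case using assms(1) by (simp add: loaded_def)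
  next
    case 3 show ?case by (simp add: I_def)
  next
    case (4 k s1)
    have "arrs s1 aQ k = of_bool (k \<in> Q)" "regs s1 rZERO = 0"
      using 4(4)[of rZERO] 4(5)[of aQ] 4(1) assms(1) by (auto simp: loaded_def)
    then show ?case using 4(2,3) by (auto simp: I_def fun_eq_iff less_Suc_eq)
  qed
  then show "arrs s' aF = (\<lambda>v. if v < n \<and> v \<notin> Q then 0 else arrs s aF v)" by (simp add: I_def)
qed

section \<open>Hub colorings as numerals in base q + 1\<close>

definition weight :: "nat \<Rightarrow> nat" where
  "weight k = Suc q ^ card (Q \<inter> {..<k})"

text \<open>The value of a numeral whose digits sit at the hub vertices; \<open>weight v\<close> is
  the place value at \<open>v\<close>, with the lowest hub vertex least significant.\<close>

definition rank :: "nat \<Rightarrow> (nat \<Rightarrow> nat) \<Rightarrow> nat" where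
  "rank k f = (\<Sum>v\<in>Q \<inter> {..<k}. f v * weight v)"

lemma Q_lessThan_Suc: "Q \<inter> {..<Suc k} = (if k \<in> Q then insert k (Q \<inter> {..<k}) else Q \<inter> {..<k})"
  by (auto simp: less_Suc_eq)

lemma weight_0 [simp]: "weight 0 = 1"
  by (simp add: weight_def)

lemma weight_Suc: "weight (Suc k) = (if k \<in> Q then Suc q * weight k else weight k)"
  by (simp add: weight_def Q_lessThan_Suc)

lemma rank_0 [simp]: "rank 0 f = 0"
  by (simp add: rank_def)

lemma rank_Suc: "rank (Suc k) f = (if k \<in> Q then rank k f + f k * weight k else rank k f)"
  by (simp add: rank_def Q_lessThan_Suc)

lemma rank_cong: "(\<And>v. v < k \<Longrightarrow> v \<in> Q \<Longrightarrow> f v = g v) \<Longrightarrow> rank k f = rank k g"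
  unfolding rank_def by (rule sum.cong) auto

lemma rank_less: "(\<forall>v<k. f v \<le> q) \<Longrightarrow> rank k f < weight k"
proof (induction k)
  case (Suc k)
  then have "rank k f + f k * weight k < weight k + q * weight k" by (intro add_less_le_mono) auto
  then show ?case using Suc by (simp add: rank_Suc weight_Suc)
qed simp

text \<open>The lower digits stay below the place value of the leading one, so quotient and
  remainder recover both.\<close>

lemma rank_inj:
  assumes "\<forall>v<k. f v \<le> q" "\<forall>v<k. g v \<le> q" "rank k f = rank k g" "v < k" "v \<in> Q"
  shows "f v = g v"
  using assms
proof (induction k)
  case (Suc k)
  have less: "rank k f < weight k" "rank k g < weight k" using Suc.prems by (auto intro: rank_less)
  have eq: "rank k f = rank k g \<and> (k \<in> Q \<longrightarrow> f k = g k)"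
  proof (cases "k \<in> Q")
    case True
    then have "rank k f + f k * weight k = rank k g + g k * weight k"
      using Suc.prems by (simp add: rank_Suc)
    then have "(rank k f + f k * weight k) div weight k = (rank k g + g k * weight k) div weight k"
      "(rank k f + f k * weight k) mod weight k = (rank k g + g k * weight k) mod weight k"
      by simp_all
    then show ?thesis using less by simp
  next
    case False
    then show ?thesis using Suc.prems by (simp add: rank_Suc)
  qed
  show ?case
  proof (cases "v = k")
    case True
    then show ?thesis using eq Suc.prems by simp
  next
    case False
    then have "v < k" using Suc.prems(4) by simp
    then show ?thesis using eq Suc.IH Suc.prems by simp
  qed
qed simp

lemma odometer_spec:
  assumes "loaded s" "arrs s aF = f" "\<forall>v<n. f v \<le> q"
  defines "s' \<equiv> lsem odometer s"
  shows "Suc (rank n f) < weight n \<Longrightarrow> rank n (arrs s' aF) = Suc (rank n f)"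
    "\<forall>v<n. arrs s' aF v \<le> q" "loaded s'"
proof -
  show "loaded s'" unfolding s'_def by (rule loaded_lsem[OF assms(1)]) (auto simp: odometer_def)
  \<comment> \<open>The processed digits together with the pending carry represent one more than the
    old digits did.\<close>
  define I where "I k s' \<longleftrightarrow> (\<forall>v<n. arrs s' aF v \<le> q) \<and> (\<forall>v\<ge>k. arrs s' aF v = f v) \<and>
     regs s' rCARRY \<le> 1 \<and> rank k (arrs s' aF) + regs s' rCARRY * weight k = Suc (rank k f)"
    for k and s' :: ram_state
  define s0 where "s0 = lsem (LConst rCARRY 1) s"
  let ?body = "LIf rCARRY
       (LLoad rE aQ rU ;; LIf rE
         (LLoad rFU aF rU ;; LAdd rFU rFU rONE ;; LSub rD rQC rFU ;;
          LIf rD (LStore aF rU rFU ;; LConst rCARRY 0) (LStore aF rU rZERO)) LSkip) LSkip"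
  have s': "s' = lsem (LFor rU rN ?body) s0" by (simp add: s'_def odometer_def s0_def)
  have "I n s'" unfolding s'
  proof (rule LFor_invariant_frame, goal_cases)
    case 1 show ?case by simp
  next
    case 2 show ?case using assms(1) by (simp add: s0_def loaded_def)
  next
    case 3 show ?case using assms(2,3) by (simp add: I_def s0_def)
  next
    case (4 k s1)
    have fr: "arrs s1 aQ k = of_bool (k \<in> Q)" "regs s1 rZERO = 0" "regs s1 rONE = 1" "regs s1 rQC = Suc q"
      using 4(4)[of rZERO] 4(4)[of rONE] 4(4)[of rQC] 4(5)[of aQ] 4(1) assms(1)
      by (auto simp: loaded_def s0_def)
    have fk: "arrs s1 aF k = f k" "f k \<le> q" using 4(1,2) assms(3) by (auto simp: I_def)
    let ?s2 = "for_step rU n (lsem ?body) s1"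
    have res: "arrs ?s2 aF = (if regs s1 rCARRY \<noteq> 0 \<and> k \<in> Q then (arrs s1 aF)(k := if f k < q then Suc (f k) else 0) else arrs s1 aF)"
      "regs ?s2 rCARRY = (if regs s1 rCARRY \<noteq> 0 \<and> k \<in> Q \<and> f k < q then 0 else regs s1 rCARRY)"
      using fr fk 4(3) by auto
    have rk: "rank k (arrs ?s2 aF) = rank k (arrs s1 aF)" unfolding res by (rule rank_cong) auto
    have c: "regs s1 rCARRY = 0 \<or> regs s1 rCARRY = 1" using 4(2) by (auto simp: I_def)
    have inv: "rank k (arrs s1 aF) + regs s1 rCARRY * weight k = Suc (rank k f)"
      using 4(2) by (simp add: I_def)
    have "rank (Suc k) (arrs ?s2 aF) + regs ?s2 rCARRY * weight (Suc k) = Suc (rank (Suc k) f)"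
      unfolding rank_Suc weight_Suc rk unfolding res using c inv fk by (auto simp: algebra_simps)
    moreover have "\<forall>v<n. arrs ?s2 aF v \<le> q" "\<forall>v\<ge>Suc k. arrs ?s2 aF v = f v" "regs ?s2 rCARRY \<le> 1"
      unfolding res using 4(2) by (auto simp: I_def)
    ultimately show ?case unfolding I_def by blast
  qed
  then have I: "\<forall>v<n. arrs s' aF v \<le> q" "rank n (arrs s' aF) + regs s' rCARRY * weight n = Suc (rank n f)"
    by (auto simp: I_def)
  then show "\<forall>v<n. arrs s' aF v \<le> q" by simp
  show "rank n (arrs s' aF) = Suc (rank n f)" if "Suc (rank n f) < weight n"
    using I(2) that by (cases "regs s' rCARRY") auto
qed

lemma weight_n: "weight n = Suc q ^ card Q"
  using Q_subset by (simp add: weight_def Int_absorb2)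

lemma lwf_main_loop: "lwf (main_loop \<sigma>)"
  by (auto simp: main_loop_def reset_def lwf_check search_def lwf_try_moves not_in_wregs_try_moves
      update_best_def odometer_def wregs_check)

text \<open>Iteration \<open>i\<close> handles the hub coloring of rank \<open>i\<close>. The ranks
  below \<open>weight n\<close> exhaust all hub colorings, so every partial coloring is eventually
  compared with the best one found.\<close>

lemma main_loop_spec:
  assumes "loaded s" "regs s rW = weight n" "arrs s aF = (\<lambda>_. 0)" "regs s rBEST = n"
    "\<forall>v<n. arrs s aOUT v = 1"
  defines "s' \<equiv> lsem (main_loop \<sigma>) s"
  shows "min_coloring_deletion_set q G {v \<in> pverts G. arrs s' aOUT v = 1}"
proof -
  \<comment> \<open>The claim on the rank is restricted to \<open>i < weight n\<close> because the
    odometer wraps around after the last hub coloring.\<close>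
  define I where "I i s \<longleftrightarrow> loaded s \<and> (\<forall>v<n. arrs s aF v \<le> q) \<and>
     (i < weight n \<longrightarrow> rank n (arrs s aF) = i) \<and>
     (\<exists>g. partial_coloring q G g \<and> (\<forall>v<n. arrs s aOUT v = of_bool (g v = 0)) \<and> regs s rBEST = cost g) \<and>
     (\<forall>g. partial_coloring q G g \<longrightarrow> rank n g < i \<longrightarrow> regs s rBEST \<le> cost g)"
    for i and s :: ram_state
  have "I (weight n) s'" unfolding s'_def main_loop_def
  proof (rule LFor_invariant_frame, goal_cases)
    case 1 show ?case using lwf_main_loop by (simp add: main_loop_def)
  next
    case 2 show ?case by (rule assms(2))
  next
    case 3
    have "cost (\<lambda>_. 0) = n" by (simp add: cost_def)
    moreover have "partial_coloring q G (\<lambda>_. 0)" by (simp add: partial_coloring_iff valid_def conflict_def)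
    moreover have "loaded (for_init rIT (weight n) s)" by (rule loaded_cong[OF assms(1)]) auto
    moreover have "rank n (\<lambda>_. 0) = 0" by (simp add: rank_def)
    ultimately show ?case using assms(3-5) unfolding I_def by auto
  next
    case (4 i s0)
    define s1 where "s1 = lsem reset s0"
    define s2 where "s2 = lsem check s1"
    define s3 where "s3 = lsem (LIf rOK (search \<sigma> ;; update_best) LSkip) s2"
    define s4 where "s4 = lsem odometer s3"
    define f where "f = arrs s0 aF"
    have ld0: "loaded s0" and f_le: "\<forall>v<n. f v \<le> q" and rk: "rank n f = i"
      using 4(1,2) by (auto simp: I_def f_def)
    define f1 where "f1 = (\<lambda>v. if v < n \<and> v \<notin> Q then 0 else f v)"
    have s1: "arrs s1 aF = f1" "loaded s1"
      using reset_spec[OF ld0] by (auto simp: s1_def f1_def f_def)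
    have keep1: "regs s1 rBEST = regs s0 rBEST" "arrs s1 aOUT = arrs s0 aOUT"
      unfolding s1_def
      by (rule lsem_frame_regs, simp add: reset_def) (rule lsem_frame_arrs, simp add: reset_def)
    have s2: "regs s2 rOK = of_bool (valid f1)" "regs s2 rCNT = cost f1" "loaded s2" "arrs s2 = arrs s1"
      using check_spec[OF s1(2)] s1(1) by (auto simp: s2_def)
    have keep2: "regs s2 rBEST = regs s0 rBEST"
      unfolding s2_def keep1(1)[symmetric] by (rule lsem_frame_regs) (auto simp: wregs_check)
    have f1_le: "\<forall>v<n. f1 v \<le> q" using f_le by (simp add: f1_def)
    obtain g0 where g0: "partial_coloring q G g0" "\<forall>v<n. arrs s0 aOUT v = of_bool (g0 v = 0)"
      "regs s0 rBEST = cost g0" using 4(2) by (auto simp: I_def)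
    have old: "regs s0 rBEST \<le> cost g" if "partial_coloring q G g" "rank n g < i" for g
      using 4(2) that by (auto simp: I_def)
    have agree: "g v = f1 v" if "partial_coloring q G g" "rank n g = i" "v \<in> Q" for g v
    proof -
      have "v < n" using that(3) Q_subset by auto
      then have "g v = f v" using rank_inj[of n g f v] that rk f_le by (simp add: partial_coloring_iff)
      then show ?thesis using that(3) by (simp add: f1_def)
    qed
    have s3: "loaded s3 \<and> (\<forall>v<n. arrs s3 aF v \<le> q) \<and> (\<forall>v\<in>Q. arrs s3 aF v = f1 v) \<and>
      (\<exists>g. partial_coloring q G g \<and> (\<forall>v<n. arrs s3 aOUT v = of_bool (g v = 0)) \<and> regs s3 rBEST = cost g) \<and>
      (\<forall>g. partial_coloring q G g \<longrightarrow> rank n g \<le> i \<longrightarrow> regs s3 rBEST \<le> cost g)"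
    proof (cases "valid f1")
      case False
      \<comment> \<open>A conflict of \<open>f1\<close> lies inside the hub, because
        \<open>f1\<close> deletes everything else, so it is shared by all colorings of this
        rank.\<close>
      have no: "rank n g \<noteq> i" if g: "partial_coloring q G g" for g
      proof
        assume "rank n g = i"
        note ag = agree[OF g this]
        obtain u v where uv: "u < n" "v < n" "conflict f1 u v" using False by (auto simp: valid_def)
        then have "u \<in> Q" "v \<in> Q" by (auto simp: conflict_def f1_def split: if_splits)
        then have "conflict g u v" using uv ag by (simp add: conflict_def)
        then show False using g uv by (auto simp: partial_coloring_iff valid_def)
      qed
      have "s3 = s2" using s2(1) False by (simp add: s3_def)
      then show ?thesis
        using s2 s1 keep1 keep2 f1_le g0 old no by (auto simp: le_less)
    next
      case True
      define r where "r = lsem (search \<sigma>) s2"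
      have s3eq: "s3 = lsem update_best r" using s2(1) True by (simp add: s3_def r_def)
      have se: "loaded r" "valid (arrs r aF)" "\<forall>v<n. arrs r aF v \<le> q" "\<forall>v\<in>Q. arrs r aF v = f1 v"
        "regs r rCUR = cost (arrs r aF)"
        and opt: "\<And>g. partial_coloring q G g \<Longrightarrow> (\<And>v. v \<in> Q \<Longrightarrow> g v = f1 v) \<Longrightarrow> regs r rCUR \<le> cost g"
        using search_spec[OF s2(3) _ True f1_le s2(2)] s1(1) s2(4) unfolding r_def by auto
      have keepr: "regs r rBEST = regs s0 rBEST" "arrs r aOUT = arrs s0 aOUT"
      proof -
        have "regs r rBEST = regs s2 rBEST"
          unfolding r_def by (rule lsem_frame_regs) (auto simp: search_def not_in_wregs_try_moves)
        then show "regs r rBEST = regs s0 rBEST" using keep2 by simp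
        have "arrs r aOUT = arrs s2 aOUT"
          unfolding r_def using warrs_try_moves[of \<sigma>] by (intro lsem_frame_arrs) (auto simp: search_def)
        then show "arrs r aOUT = arrs s0 aOUT" using keep1 s2(4) by simp
      qed
      note up = update_best_spec[OF se(1), folded s3eq]
      have pc: "partial_coloring q G (arrs r aF)" using se by (simp add: partial_coloring_iff)
      have le: "regs s3 rBEST \<le> regs r rCUR" "regs s3 rBEST \<le> regs s0 rBEST"
        using up keepr by (cases "regs r rCUR < regs r rBEST"; force)+
      have "regs s3 rBEST \<le> cost g" if g: "partial_coloring q G g" "rank n g \<le> i" for g
      proof (cases "rank n g = i")
        case True
        then show ?thesis using opt[OF g(1)] agree[OF g(1)] le by fastforce
      next
        case False
        then show ?thesis using old[OF g(1)] g(2) le by fastforce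
      qed
      moreover have "\<exists>g. partial_coloring q G g \<and> (\<forall>v<n. arrs s3 aOUT v = of_bool (g v = 0)) \<and> regs s3 rBEST = cost g"
      proof (cases "regs r rCUR < regs r rBEST")
        case True
        then show ?thesis using up pc se(5) by (intro exI[of _ "arrs r aF"]) auto
      next
        case False
        then show ?thesis using up keepr g0 by (intro exI[of _ g0]) auto
      qed
      ultimately show ?thesis using up(4,5) se by auto
    qed
    have "rank n (arrs s3 aF) = i"
      using rk s3 rank_cong[of n "arrs s3 aF" f] by (auto simp: f1_def)
    then have s4: "Suc i < weight n \<Longrightarrow> rank n (arrs s4 aF) = Suc i" "\<forall>v<n. arrs s4 aF v \<le> q" "loaded s4"
      using odometer_spec[of s3] s3 by (auto simp: s4_def)
    have keep4: "regs s4 rBEST = regs s3 rBEST" "arrs s4 aOUT = arrs s3 aOUT"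
      unfolding s4_def
      by (rule lsem_frame_regs, simp add: odometer_def) (rule lsem_frame_arrs, simp add: odometer_def)
    have "I (Suc i) s4"
      unfolding I_def using s4 s3 keep4 by (simp add: less_Suc_eq_le)
    moreover have "loaded (for_step rIT (weight n) (lsem (reset ;; check ;; LIf rOK (search \<sigma> ;; update_best) LSkip ;; odometer)) s0)"
      by (rule loaded_cong[OF s4(3)]) (auto simp: s4_def s3_def s2_def s1_def)
    ultimately show ?case
      unfolding I_def s4_def s3_def s2_def s1_def by simp
  qed
  then obtain g where g: "partial_coloring q G g" "\<forall>v<n. arrs s' aOUT v = of_bool (g v = 0)"
    "regs s' rBEST = cost g" and best: "\<And>h. partial_coloring q G h \<Longrightarrow> rank n h < weight n \<Longrightarrow> cost g \<le> cost h"
    by (auto simp: I_def)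
  have "{v \<in> pverts G. arrs s' aOUT v = 1} = deleted G g"
    using g(2) by (auto simp: deleted_def pverts_eq of_bool_def split: if_splits)
  moreover have "min_coloring_deletion_set q G (deleted G g)"
    using g(1) best by (intro min_coloring_deletion_setI) (auto simp: cost_eq partial_coloring_iff rank_less)
  ultimately show ?thesis by simp
qed

end

section \<open>Encoding of instances and initialization\<close>

lemma nth_concat_rows:
  assumes "i < m" "j < n"
  shows "concat (map (\<lambda>u. map (f u) [0..<n]) [0..<m]) ! (i * n + j) = f i j"
  using assms(1)
proof (induction m)
  case (Suc m)
  have len: "length (concat (map (\<lambda>u. map (f u) [0..<n]) [0..<m])) = m * n"
    by (simp add: length_concat comp_def sum_list_triv)
  show ?case
  proof (cases "i = m")
    case True
    then show ?thesis using assms(2) by (simp add: nth_append len)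
  next
    case False
    then have i: "i < m" using Suc.prems by simp
    then have "i * n + j < Suc i * n" "Suc i * n \<le> m * n" using assms(2) by (auto intro: mult_right_mono simp del: mult_Suc) auto
    then show ?thesis using Suc.IH[OF i] by (simp add: nth_append len)
  qed
qed simp

lemma encode_instance_nth:
  fixes G :: "nat pair_pre_digraph" and Q :: "nat set"
  defines "n \<equiv> card (pverts G)" and "A \<equiv> arrs (initial_state (encode_instance G Q)) 0"
  shows "A 0 = n" "u < n \<Longrightarrow> v < n \<Longrightarrow> A (1 + u * n + v) = of_bool ((u, v) \<in> parcs G)"
    "v < n \<Longrightarrow> A (1 + n * n + v) = of_bool (v \<in> Q)"
proof -
  let ?M = "concat (map (\<lambda>u. map (\<lambda>v. of_bool ((u, v) \<in> parcs G)) [0..<n]) [0..<n]) :: nat list"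
  let ?R = "map (\<lambda>v. of_bool (v \<in> Q)) [0..<n] :: nat list"
  have len: "length ?M = n * n" by (simp add: length_concat comp_def sum_list_triv)
  have A: "A i = (if i < Suc (n * n + n) then (n # ?M @ ?R) ! i else 0)" for i
    unfolding A_def initial_state_def encode_instance_def Let_def n_def[symmetric]
    using len by simp
  show "A 0 = n" by (simp add: A)
  show "A (1 + u * n + v) = of_bool ((u, v) \<in> parcs G)" if "u < n" "v < n"
  proof -
    have "u * n + v < Suc u * n" "Suc u * n \<le> n * n"
      using that by (auto intro: mult_right_mono simp del: mult_Suc) auto
    then show ?thesis
      using that nth_concat_rows[of u n v n "\<lambda>u v. of_bool ((u, v) \<in> parcs G)"]
      by (simp add: A nth_append len)
  qed
  show "A (1 + n * n + v) = of_bool (v \<in> Q)" if "v < n"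
    using that by (simp add: A nth_append len)
qed

lemma bounded_initial_state: "(\<And>x. x \<in> set xs \<Longrightarrow> x \<le> M) \<Longrightarrow> bounded_state M (initial_state xs)"
  by (auto simp: bounded_state_def initial_state_def)

lemma encode_instance_le: "x \<in> set (encode_instance G Q) \<Longrightarrow> x \<le> card (pverts G) + 1"
  by (auto simp: encode_instance_def Let_def)

text \<open>Multiplies \<open>rW\<close> by \<open>q + 1\<close>: with a copy of it in
  \<open>rTMP\<close>, the copy is added \<open>q\<close> times. One such multiplication per hub
  vertex gives the number of iterations.\<close>

primrec add_times :: "nat \<Rightarrow> lprog" where
  "add_times 0 = LSkip"
| "add_times (Suc k) = LAdd rW rW rTMP ;; add_times k"

lemma lsem_add_times: "lsem (add_times k) s = (if k = 0 then s else set_reg rW (regs s rW + k * regs s rTMP) s)"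
  by (induction k arbitrary: s) (auto simp: set_reg_def algebra_simps)

lemma add_times_static:
  "lwf (add_times k)" "wregs (add_times k) \<subseteq> {rW}" "warrs (add_times k) = {}"
  "count_regs (add_times k) = {}" "max_const (add_times k) = 0"
  by (induction k) auto

definition init_consts :: "nat \<Rightarrow> lprog" where
  "init_consts q = LConst rZERO 0 ;; LConst rONE 1 ;; LLoad rN aIN rZERO ;; LConst rQC (Suc q) ;;
     LConst rW 1 ;; LAdd rBEST rN rZERO ;; LConst rPTR 1"

text \<open>The first loop adds \<open>n\<close> to the pointer \<open>n\<close> times and thereby
  skips the adjacency matrix. The initial output deletes every vertex, in accordance with the
  initial value \<open>n\<close> of \<open>rBEST\<close>.\<close>

definition init_arrays :: "nat \<Rightarrow> lprog" where
  "init_arrays q = LFor rU rN (LAdd rPTR rPTR rN) ;;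
     LFor rU rN
       (LLoad rE aIN rPTR ;; LAdd rPTR rPTR rONE ;; LStore aQ rU rE ;; LStore aOUT rU rONE ;;
        LIf rE (LAdd rTMP rW rZERO ;; add_times q) LSkip)"

context hub_instance
begin

lemma init_spec:
  defines "s' \<equiv> lsem (init_arrays q) (lsem (init_consts q) (initial_state (encode_instance G Q)))"
  shows "loaded s'" "regs s' rW = weight n" "arrs s' aF = (\<lambda>_. 0)" "regs s' rBEST = n"
    "\<forall>v<n. arrs s' aOUT v = 1"
proof -
  define s where "s = initial_state (encode_instance G Q)"
  note enc = encode_instance_nth[where G = G and Q = Q, folded n_def s_def]
  define s0 where "s0 = lsem (init_consts q) s"
  have s0: "regs s0 rZERO = 0" "regs s0 rONE = 1" "regs s0 rN = n" "regs s0 rQC = Suc q" "regs s0 rW = 1"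
    "regs s0 rBEST = n" "regs s0 rPTR = 1" "arrs s0 = arrs s"
    using enc(1) by (auto simp: s0_def init_consts_def)
  define s1 where "s1 = lsem (LFor rU rN (LAdd rPTR rPTR rN)) s0"
  have p1: "regs s1 rPTR = 1 + n * n"
    unfolding s1_def
  proof (rule LFor_invariant_frame[where I = "\<lambda>k s. regs s rPTR = 1 + k * n"], goal_cases)
    case (4 k s)
    then show ?case using s0 by simp
  qed (use s0 in auto)
  have fr1: "r \<notin> {rU, Suc rU, rPTR} \<Longrightarrow> regs s1 r = regs s0 r" for r
    unfolding s1_def by (rule lsem_frame_regs) simp
  have ar1: "arrs s1 = arrs s" unfolding s0(8)[symmetric] s1_def by (rule ext, rule lsem_frame_arrs) simp
  let ?body = "LLoad rE aIN rPTR ;; LAdd rPTR rPTR rONE ;; LStore aQ rU rE ;; LStore aOUT rU rONE ;;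
        LIf rE (LAdd rTMP rW rZERO ;; add_times q) LSkip"
  have s': "s' = lsem (LFor rU rN ?body) s1"
    by (simp add: s'_def init_arrays_def s1_def s0_def s_def)
  have wb: "wregs ?body \<subseteq> {rE, rPTR, rTMP, rW}" "warrs ?body = {aQ, aOUT}"
    using add_times_static[of q] by auto
  define I where "I k s \<longleftrightarrow> regs s rPTR = 1 + n * n + k \<and> regs s rW = weight k \<and>
      (\<forall>v<k. arrs s aQ v = of_bool (v \<in> Q)) \<and> (\<forall>v<k. arrs s aOUT v = 1)" for k and s :: ram_state
  have "I n s'" unfolding s'
  proof (rule LFor_invariant_frame, goal_cases)
    case 1 show ?case using add_times_static[of q] by auto
  next
    case 2 show ?case using s0 fr1 by simp
  next
    case 3 show ?case using s0 fr1 p1 by (simp add: I_def)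
  next
    case (4 k s2)
    have "aIN \<notin> warrs ?body" "rONE \<notin> wregs ?body" "rZERO \<notin> wregs ?body" using wb by auto
    then have "arrs s2 aIN = arrs s aIN" "regs s2 rONE = 1" "regs s2 rZERO = 0"
      using 4(4)[of rONE] 4(4)[of rZERO] 4(5)[of aIN] fr1 s0 ar1 by auto
    then have "arrs s2 aIN (1 + n * n + k) = of_bool (k \<in> Q)" using enc(3) 4(1) by simp
    then show ?case
      using 4(2,3) \<open>regs s2 rONE = 1\<close> \<open>regs s2 rZERO = 0\<close>
      by (auto simp: I_def less_Suc_eq lsem_add_times weight_Suc)
  qed
  then show "regs s' rW = weight n" "\<forall>v<n. arrs s' aOUT v = 1" by (auto simp: I_def)
  have fr': "regs s' r = regs s0 r" if "r \<in> {rZERO, rONE, rN, rQC, rBEST}" for r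
  proof -
    have "regs s' r = regs s1 r" unfolding s' using wb that by (intro lsem_frame_regs) auto
    then show ?thesis using fr1 that by auto
  qed
  have ar': "arrs s' a = arrs s a" if "a \<notin> {aQ, aOUT}" for a
    unfolding ar1[symmetric] s' using that wb by (intro lsem_frame_arrs) simp
  show "loaded s'"
    using fr' ar'[of aIN] s0 enc(2) \<open>I n s'\<close> by (auto simp: loaded_def I_def)
  show "regs s' rBEST = n" using fr' s0 by simp
  show "arrs s' aF = (\<lambda>_. 0)" using ar'[of aF] by (simp add: s_def initial_state_def)
qed

end

section \<open>Running time of the hub algorithm\<close>

lemma cost_bound_cong: "(\<And>m. m \<in> count_regs P \<Longrightarrow> b m = b' m) \<Longrightarrow> cost_bound b P = cost_bound b' P"
  by (induction P) auto

lemma bit_len_le: "x \<le> 2 ^ e \<Longrightarrow> bit_len x \<le> e + 1"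
  using bit_len_mono[of x "2 ^ e"] bit_len_pow2_mult[of 1 e] by (simp add: compute_floorlog)

lemma bit_len_le_self: "bit_len x \<le> x + 1"
  by (rule bit_len_le) (simp add: less_imp_le)

text \<open>Kept separate because its cost is polynomial, in contrast to the number of its
  iterations.\<close>

definition main_body :: "nat \<Rightarrow> lprog" where
  "main_body \<sigma> = reset ;; check ;; LIf rOK (search \<sigma> ;; update_best) LSkip ;; odometer"

lemma count_regs_check: "count_regs check = {rN}"
  by (auto simp: check_def check_row_def)

lemma count_regs_try_moves: "count_regs (try_moves d) \<subseteq> {rN, rQC}"
  by (induction d) (auto simp: count_regs_check)

lemma count_regs_main_body: "count_regs (main_body \<sigma>) \<subseteq> {rN, rQC}"
  using count_regs_try_moves[of \<sigma>]
  by (auto simp: main_body_def reset_def count_regs_check search_def update_best_def odometer_def)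

lemma wregs_main_loop: "wregs (main_loop \<sigma>) \<inter> {rZERO, rONE, rN, rQC, rW} = {}"
  by (auto simp: main_loop_def reset_def wregs_check search_def update_best_def odometer_def
      not_in_wregs_try_moves)

lemma summands_check: "summands check \<subseteq> {rONE}"
  by (auto simp: check_def check_row_def)

lemma summands_try_moves: "summands (try_moves d) \<subseteq> {rZERO, rONE}"
  using summands_check by (induction d) auto

lemma summands_main_loop: "summands (main_loop \<sigma>) \<subseteq> {rZERO, rONE}"
  using summands_check summands_try_moves[of \<sigma>]
  by (auto simp: main_loop_def reset_def search_def update_best_def odometer_def)

lemma max_const_try_moves: "max_const (try_moves d) \<le> 1"
  by (induction d) (auto simp: check_def check_row_def)

lemma max_const_main_loop: "max_const (main_loop \<sigma>) \<le> 1"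
  using max_const_try_moves[of \<sigma>]
  by (auto simp: main_loop_def reset_def search_def update_best_def odometer_def check_def check_row_def)

text \<open>Initialization is polynomial and may double values in each step. The main loop obeys the
  linear growth estimate; since its iteration count is at most \<open>2 ^ (q * n)\<close>, all
  lengths are polynomial in \<open>n\<close>.\<close>

theorem hub_algorithm:
  "\<exists>P c. \<forall>G Q p. input_graph G \<and> hub \<sigma> \<delta> G Q \<and> card Q = p \<longrightarrow>
     solves_deletion_within P q G Q ((real q + 1) ^ p * poly_factor c (card (pverts G)))"
proof -
  define P where "P = Seq (compile (init_consts q)) (Seq (compile (init_arrays q)) (compile (main_loop \<sigma>)))"
  define K0 where "K0 = cost_bound (\<lambda>_. 0) (init_consts q)"
  define K1 where "K1 n = cost_bound (\<lambda>_. n) (init_arrays q)" for n :: nat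
  define KB where "KB n = cost_bound (\<lambda>_. n + q + 1) (main_body \<sigma>)" for n :: nat
  define M0 where "M0 n = n + q + 2" for n :: nat
  \<comment> \<open>\<open>2 ^ e n\<close> will bound the numbers of the main loop, and
    \<open>Z n\<close> the total cost divided by the number of its iterations.\<close>
  define e where "e n = K0 + K1 n + M0 n + q * n + KB n + 8" for n :: nat
  define Z where "Z n = K0 * (1 + 2 * (K0 + (M0 n + 1))) + K1 n * (1 + 2 * (K1 n + (K0 + (M0 n + 1)))) +
     (KB n + 7) * (1 + 2 * (e n + 1))" for n :: nat
  have poly_K1: "poly_bounded (\<lambda>n. n) K1" unfolding K1_def by (rule poly_bounded_cost_bound)
  have "poly_bounded (\<lambda>n. n) KB" unfolding KB_def
    by (rule poly_bounded_compose[OF poly_bounded_cost_bound])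
      (intro poly_bounded_add poly_bounded_const poly_bounded_size)
  then have "poly_bounded (\<lambda>n. n) Z"
    unfolding Z_def e_def M0_def
    by (intro poly_bounded_add poly_bounded_mult poly_bounded_const poly_bounded_size poly_K1)
  then obtain c where c: "\<And>n. Z n \<le> c * (n + 1) ^ c" by (auto simp: poly_bounded_def)
  have "solves_deletion_within P q G Q ((real q + 1) ^ p * poly_factor c (card (pverts G)))"
    if "input_graph G" "hub \<sigma> \<delta> G Q" "card Q = p" for G Q p
  proof -
    define n where "n = card (pverts G)"
    interpret hub_instance q \<sigma> \<delta> G Q n by unfold_locales (fact that n_def)+
    define s where "s = initial_state (encode_instance G Q)"
    define s0 where "s0 = lsem (init_consts q) s"
    define s1 where "s1 = lsem (init_arrays q) s0"
    define s2 where "s2 = lsem (main_loop \<sigma>) s1"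
    note init = init_spec[folded s_def s0_def s1_def]
    have rN0: "regs s0 rN = n" using encode_instance_nth(1)[where G = G and Q = Q]
      by (simp add: s0_def s_def init_consts_def n_def)
    have blM: "bit_len (M0 n) \<le> M0 n + 1" by (rule bit_len_le_self)
    have b: "bounded_state (M0 n) s" unfolding s_def
      by (rule bounded_initial_state) (use encode_instance_le[of _ G Q] in \<open>force simp: M0_def n_def\<close>)
    obtain t0 where t0: "exec (compile (init_consts q)) s t0 s0" "t0 \<le> K0 * (1 + 2 * (K0 + bit_len (M0 n)))"
      "bounded_state (2 ^ K0 * M0 n) s0"
      using exec_compile_poly[of "init_consts q" s 0 "M0 n"] b
      by (auto simp: init_consts_def M0_def s0_def K0_def)
    have static: "lwf (init_arrays q)" "count_regs (init_arrays q) \<inter> wregs (init_arrays q) = {}"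
      "count_regs (init_arrays q) = {rN}" "max_const (init_arrays q) = 0"
      using add_times_static[of q] by (auto simp: init_arrays_def)
    have M0: "1 \<le> M0 n" by (simp add: M0_def)
    then have M1: "1 \<le> 2 ^ K0 * M0 n" by simp
    obtain t1 where t1: "exec (compile (init_arrays q)) s0 t1 s1"
      "t1 \<le> K1 n * (1 + 2 * (K1 n + bit_len (2 ^ K0 * M0 n)))"
      "bounded_state (2 ^ K1 n * (2 ^ K0 * M0 n)) s1"
      using exec_compile_poly[OF static(1,2) _ _ M1 t0(3), of n] static rN0
      by (auto simp: s1_def K1_def)
    define M2 where "M2 = 2 ^ K1 n * (2 ^ K0 * M0 n)"
    define W where "W = Suc q ^ p"
    define K where "K = 3 + W * (KB n + 4)"
    have rW: "regs s1 rW = W" using init(2) weight_n that(3) by (simp add: W_def)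
    \<comment> \<open>The number of iterations gets a bound of its own; every other loop limit is at
      most linear in \<open>n\<close>.\<close>
    define bd where "bd = (\<lambda>r. if r = rW then W else n + q + 1)"
    have cr: "count_regs (main_loop \<sigma>) = insert rW (count_regs (main_body \<sigma>))"
      by (simp add: main_loop_def main_body_def)
    have "lcost (main_loop \<sigma>) s1 \<le> cost_bound bd (main_loop \<sigma>)"
    proof (rule lcost_le_cost_bound)
      show "count_regs (main_loop \<sigma>) \<inter> wregs (main_loop \<sigma>) = {}"
        using wregs_main_loop[of \<sigma>] count_regs_main_body[of \<sigma>] cr by auto
      fix m assume "m \<in> count_regs (main_loop \<sigma>)"
      then have "m = rW \<or> m = rN \<or> m = rQC" using count_regs_main_body[of \<sigma>] cr by auto
      then show "regs s1 m \<le> bd m" using rW init(1) by (auto simp: bd_def loaded_def)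
    qed
    also have "cost_bound bd (main_loop \<sigma>) = 3 + W * (cost_bound bd (main_body \<sigma>) + 4)"
      by (simp add: main_loop_def main_body_def bd_def)
    also have "cost_bound bd (main_body \<sigma>) = KB n"
      unfolding KB_def using count_regs_main_body[of \<sigma>] by (intro cost_bound_cong) (auto simp: bd_def)
    finally have lc: "lcost (main_loop \<sigma>) s1 \<le> K" by (simp add: K_def)
    have M2: "1 \<le> M2" using M0 by (simp add: M2_def)
    have "\<exists>t. exec (compile (main_loop \<sigma>)) s1 t (lsem (main_loop \<sigma>) s1) \<and> t \<le> K * (1 + 2 * bit_len (M2 + K * M2))"
    proof (rule exec_compile_increments[OF lwf_main_loop summands_main_loop])
      show "wregs (main_loop \<sigma>) \<inter> {rZERO, rONE} = {}" using wregs_main_loop[of \<sigma>] by auto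
      show "bounded_state M2 s1" using t1(3) by (simp add: M2_def)
      then show "regs s1 r \<le> M2" for r by (simp add: bounded_state_def)
      show "max_const (main_loop \<sigma>) \<le> M2" using max_const_main_loop[of \<sigma>] M2 by simp
    qed (fact M2 lc)+
    then obtain t2 where t2: "exec (compile (main_loop \<sigma>)) s1 t2 s2" "t2 \<le> K * (1 + 2 * bit_len (M2 + K * M2))"
      by (auto simp: s2_def)
    have W1: "1 \<le> W" by (simp add: W_def)
    have K_le: "K \<le> W * (KB n + 7)" using W1 by (simp add: K_def algebra_simps)
    \<comment> \<open>Comparison with a power of two shows that the length of the iteration count is
      linear in \<open>n\<close> for fixed \<open>q\<close>.\<close>
    have "Suc q \<le> 2 ^ q" by (induction q) auto
    then have "W \<le> (2 ^ q) ^ p" unfolding W_def by (rule power_mono) simp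
    also have "\<dots> = 2 ^ (q * p)" by (simp add: power_mult)
    also have "\<dots> \<le> 2 ^ (q * n)"
      using card_mono[OF _ Q_subset] that(3) by (intro power_increasing mult_left_mono) auto
    finally have W_le: "W \<le> 2 ^ (q * n)" .
    have "M2 + K * M2 \<le> 2 ^ e n"
    proof -
      have "1 + K \<le> W * (KB n + 8)" using K_le W1 by (simp add: algebra_simps)
      also have "\<dots> \<le> 2 ^ (q * n) * 2 ^ (KB n + 8)" using W_le by (intro mult_mono) (auto simp: less_imp_le)
      finally have "M2 * (1 + K) \<le> (2 ^ K1 n * (2 ^ K0 * 2 ^ M0 n)) * (2 ^ (q * n) * 2 ^ (KB n + 8))"
        unfolding M2_def by (intro mult_mono) (auto simp: less_imp_le)
      also have "\<dots> = 2 ^ e n" by (simp add: e_def power_add)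
      finally show ?thesis by (simp add: algebra_simps)
    qed
    then have bl2: "bit_len (M2 + K * M2) \<le> e n + 1" by (rule bit_len_le)
    have "t0 \<le> K0 * (1 + 2 * (K0 + (M0 n + 1)))"
      using blM by (intro order_trans[OF t0(2)] mult_left_mono) auto
    moreover have "t1 \<le> K1 n * (1 + 2 * (K1 n + (K0 + (M0 n + 1))))"
      using blM bit_len_pow2_mult[OF M0] by (intro order_trans[OF t1(2)] mult_left_mono) auto
    moreover have "t2 \<le> W * ((KB n + 7) * (1 + 2 * (e n + 1)))"
    proof -
      have "K * (1 + 2 * bit_len (M2 + K * M2)) \<le> (W * (KB n + 7)) * (1 + 2 * (e n + 1))"
        using K_le bl2 by (intro mult_mono) auto
      then show ?thesis using t2(2) unfolding mult.assoc by (rule order_trans[rotated])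
    qed
    moreover have "x \<le> W * x" for x using W1 by simp
    ultimately have "t0 + (t1 + t2) \<le> W * (K0 * (1 + 2 * (K0 + (M0 n + 1)))) +
       (W * (K1 n * (1 + 2 * (K1 n + (K0 + (M0 n + 1))))) + W * ((KB n + 7) * (1 + 2 * (e n + 1))))"
      by (intro add_mono) (meson order_trans)+
    also have "\<dots> = W * Z n" by (simp only: Z_def distrib_left add.assoc)
    also have "\<dots> \<le> W * (c * (n + 1) ^ c)" using c by simp
    finally have "real (t0 + (t1 + t2)) \<le> real (W * (c * (n + 1) ^ c))" by (simp only: of_nat_le_iff)
    also have "\<dots> = (real q + 1) ^ p * poly_factor c n"
      by (simp add: W_def poly_factor_def add.commute)
    finally have time: "real (t0 + (t1 + t2)) \<le> (real q + 1) ^ p * poly_factor c (card (pverts G))"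
      by (simp add: n_def)
    have "exec P s (t0 + (t1 + t2)) s2" unfolding P_def
      by (rule exec.Seq[OF t0(1) exec.Seq[OF t1(1) t2(1)]])
    then have "computes P (encode_instance G Q) (t0 + (t1 + t2)) (arrs s2 1)"
      by (auto simp: computes_def s_def)
    moreover have "min_coloring_deletion_set q G {v \<in> pverts G. arrs s2 1 v = 1}"
      unfolding s2_def by (rule main_loop_spec) (fact init)+
    ultimately show ?thesis using time unfolding solves_deletion_within_def by blast
  qed
  then show ?thesis by blast
qed

section \<open>Gadgets forbidding color patterns up to renaming of colors\<close>

text \<open>
  A block is a clique, given by the list of neighbours outside the gadget of each of its vertices;
  its vertex \<open>0\<close> is its root. In a gadget the roots of all blocks form another clique.
\<close>

definition same_block :: "nat \<Rightarrow> 'v \<Rightarrow> 'v \<Rightarrow> 'v list list" where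
  "same_block q a b = [b] # replicate (q - 1) [a]"

text \<open>For nonzero colors of \<open>a\<close> and \<open>b\<close>, pigeonhole decides:
  \<open>q - 1\<close> clique vertices avoiding both colors fit into \<open>{1..q}\<close> iff the
  colors coincide. Conversely, the \<open>q\<close> vertices of \<open>same_block\<close> fit iff
  the colors differ, with the root taking the color of \<open>a\<close>.\<close>

definition diff_block :: "nat \<Rightarrow> 'v \<Rightarrow> 'v \<Rightarrow> 'v list list" where
  "diff_block q a b = replicate (q - 1) [a, b]"

text \<open>Never colorable, but colorable without its root. Thanks to it, even a gadget without
  tests, which every coloring violates, costs one extra deletion.\<close>

definition const_block :: "nat \<Rightarrow> 'v list list" where
  "const_block q = replicate (Suc q) []"

definition test_block :: "nat \<Rightarrow> (nat \<Rightarrow> 'v) \<Rightarrow> nat list \<Rightarrow> nat \<Rightarrow> nat \<Rightarrow> 'v list list" where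
  "test_block q pos w a b =
     (if w ! a = w ! b then same_block q (pos a) (pos b) else diff_block q (pos a) (pos b))"

text \<open>The pairs with \<open>a = b\<close> matter: if the color of \<open>h\<close> is at most
  \<open>q\<close>, then \<open>same_block q h h\<close> is uncolorable iff \<open>h\<close> is not
  deleted.\<close>

definition word_blocks :: "nat \<Rightarrow> (nat \<Rightarrow> 'v) \<Rightarrow> nat list \<Rightarrow> 'v list list list" where
  "word_blocks q pos w = map (\<lambda>(a, b). test_block q pos w a b)
     (filter (\<lambda>(a, b). w ! a \<noteq> 0 \<and> w ! b \<noteq> 0) (List.product [0..<length w] [0..<length w]))"

definition gadget_tests :: "nat \<Rightarrow> ((nat \<Rightarrow> 'v) \<times> nat list) list \<Rightarrow> 'v list list list" where
  "gadget_tests q ws = concat (map (\<lambda>(pos, w). word_blocks q pos w) ws)"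

definition gadget_blocks :: "nat \<Rightarrow> ((nat \<Rightarrow> 'v) \<times> nat list) list \<Rightarrow> 'v list list list" where
  "gadget_blocks q ws = const_block q # gadget_tests q ws @ replicate (q - 1) [[]]"

text \<open>A zero of \<open>w\<close> is a wildcard, as no test looks at that position, so the
  relation is not symmetric. Renaming of colors is built in because colors are only compared with
  each other.\<close>

definition matches :: "nat list \<Rightarrow> (nat \<Rightarrow> nat) \<Rightarrow> bool" where
  "matches w y \<longleftrightarrow> (\<forall>a<length w. \<forall>b<length w. w ! a \<noteq> 0 \<longrightarrow> w ! b \<noteq> 0 \<longrightarrow>
     y a \<noteq> 0 \<and> (w ! a = w ! b \<longleftrightarrow> y a = y b))"

text \<open>\<open>J\<close> is the part of the block to be colored without deletions, either all of
  it or all but the root. A deleted neighbour has color \<open>0\<close> and thus forbids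
  nothing.\<close>

definition feasible :: "nat \<Rightarrow> ('v \<Rightarrow> nat) \<Rightarrow> 'v list list \<Rightarrow> nat set \<Rightarrow> (nat \<Rightarrow> nat) \<Rightarrow> bool" where
  "feasible q x blk J c \<longleftrightarrow> inj_on c J \<and> (\<forall>i\<in>J. c i \<in> {1..q} \<and> (\<forall>h\<in>set (blk ! i). c i \<noteq> x h))"

lemma ex_feasible:
  assumes "finite J" "finite F" "card J + card (F \<inter> {1..q}) \<le> q" "\<And>i h. i \<in> J \<Longrightarrow> h \<in> set (blk ! i) \<Longrightarrow> x h \<in> insert 0 F"
  obtains c where "feasible q x blk J c" "c ` J \<inter> F = {}"
proof -
  have "card ({1..q} - F) = q - card (F \<inter> {1..q})"
    using assms(2) by (simp add: card_Diff_subset_Int Int_commute)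
  then have "card J \<le> card ({1..q} - F)" using assms(3) by linarith
  then obtain c where c: "inj_on c J" "c ` J \<subseteq> {1..q} - F"
    using card_le_inj[OF assms(1), of "{1..q} - F"] by auto
  then have "feasible q x blk J c" unfolding feasible_def using assms(4) by fastforce
  then show ?thesis using c(2) that by blast
qed

lemma ex_feasible_card:
  assumes "finite J" "finite F" "card J + card F \<le> q" "\<And>i h. i \<in> J \<Longrightarrow> h \<in> set (blk ! i) \<Longrightarrow> x h \<in> F"
  shows "\<exists>c. feasible q x blk J c"
proof -
  have "card (F \<inter> {1..q}) \<le> card F" using assms(2) by (intro card_mono) auto
  then have "card J + card (F \<inter> {1..q}) \<le> q" using assms(3) by linarith
  then obtain c where "feasible q x blk J c"
    by (rule ex_feasible[OF assms(1,2), of q blk x]) (use assms(4) in auto)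
  then show ?thesis by blast
qed

text \<open>The vertices of \<open>J\<close> have distinct colors, and none of these lies in
  \<open>F\<close>.\<close>

lemma feasible_card:
  assumes "feasible q x blk J c" "finite J" "F \<subseteq> {1..q}" "\<And>i. i \<in> J \<Longrightarrow> F \<subseteq> x ` set (blk ! i)"
  shows "card J + card F \<le> q"
proof -
  have "c ` J \<subseteq> {1..q} - F" using assms unfolding feasible_def by fastforce
  then have "card (c ` J) \<le> card ({1..q} - F)" by (intro card_mono) auto
  also have "\<dots> = q - card F" using assms(3) by (simp add: card_Diff_subset finite_subset)
  finally have "card J \<le> q - card F" using assms(1) by (simp add: card_image feasible_def)
  moreover have "card F \<le> q" using card_mono[OF _ assms(3)] by simp
  ultimately show ?thesis by linarith
qed

lemma word_blocks_iff:
  "blk \<in> set (word_blocks q pos w) \<longleftrightarrow> (\<exists>a<length w. \<exists>b<length w. w ! a \<noteq> 0 \<and> w ! b \<noteq> 0 \<and>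
     blk = test_block q pos w a b)"
  by (auto simp: word_blocks_def; blast)

text \<open>Under a match, either \<open>q\<close> clique vertices all avoid one color or
  \<open>q - 1\<close> of them all avoid two; in both cases one color is missing.\<close>

lemma word_blocks_infeasible:
  assumes "blk \<in> set (word_blocks q pos w)" "matches w (x \<circ> pos)" "\<forall>a<length w. x (pos a) \<le> q"
  shows "\<nexists>c. feasible q x blk {..<length blk} c"
proof
  assume "\<exists>c. feasible q x blk {..<length blk} c"
  then obtain c where c: "feasible q x blk {..<length blk} c" ..
  obtain a b where ab: "a < length w" "b < length w" "w ! a \<noteq> 0" "w ! b \<noteq> 0"
    "blk = (if w ! a = w ! b then same_block q (pos a) (pos b) else diff_block q (pos a) (pos b))"
    using assms(1) by (auto simp: word_blocks_iff test_block_def)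
  have "x (pos a) \<noteq> 0" "x (pos b) \<noteq> 0" and iff: "w ! a = w ! b \<longleftrightarrow> x (pos a) = x (pos b)"
    using ab(1-4) assms(2) unfolding matches_def comp_def by blast+
  then have x: "x (pos a) \<in> {1..q}" "x (pos b) \<in> {1..q}"
    using ab(1,2) assms(3) by (auto simp: Suc_le_eq)
  show False
  proof (cases "w ! a = w ! b")
    case True
    have "card {..<length blk} + card {x (pos a)} \<le> q"
      using c
    proof (rule feasible_card)
      fix i assume "i \<in> {..<length blk}"
      then show "{x (pos a)} \<subseteq> x ` set (blk ! i)"
        using ab True iff by (cases i) (auto simp: same_block_def)
    qed (use x in auto)
    moreover have "1 \<le> q" using x by auto
    ultimately show False using ab True by (simp add: same_block_def)
  next
    case False
    have "card {..<length blk} + card {x (pos a), x (pos b)} \<le> q"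
      using c
    proof (rule feasible_card)
      fix i assume "i \<in> {..<length blk}"
      then show "{x (pos a), x (pos b)} \<subseteq> x ` set (blk ! i)"
        using ab False by (auto simp: diff_block_def)
    qed (use x in auto)
    moreover have "1 \<le> q" using x by auto
    ultimately show False using ab False iff by (simp add: diff_block_def)
  qed
qed

text \<open>If the match fails, then a vertex that \<open>w\<close> keeps is deleted, or two kept
  vertices are in the wrong equality relation. The block of that pair is colorable.\<close>

lemma word_blocks_feasible:
  assumes "\<not> matches w (x \<circ> pos)" "\<forall>a<length w. x (pos a) \<le> q" "1 \<le> q"
  shows "\<exists>blk\<in>set (word_blocks q pos w). \<exists>c. feasible q x blk {..<length blk} c"
proof -
  have blk: "(if w ! a = w ! b then same_block q (pos a) (pos b) else diff_block q (pos a) (pos b))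
      \<in> set (word_blocks q pos w)" if "a < length w" "b < length w" "w ! a \<noteq> 0" "w ! b \<noteq> 0" for a b
    using that unfolding word_blocks_iff test_block_def by blast
  show ?thesis
  proof (cases "\<exists>a<length w. w ! a \<noteq> 0 \<and> x (pos a) = 0")
    case True
    then obtain a where a: "a < length w" "w ! a \<noteq> 0" "x (pos a) = 0" by auto
    \<comment> \<open>All neighbours outside the block are deleted, so the colors
      \<open>1, ..., q\<close> are free.\<close>
    have "\<exists>c. feasible q x (same_block q (pos a) (pos a)) {..<q} c"
      using assms(3) a by (intro exI[of _ Suc]) (auto simp: feasible_def same_block_def nth_Cons')
    then show ?thesis using blk[OF a(1) a(1)] a assms(3)
      by (intro bexI[of _ "same_block q (pos a) (pos a)"]) (auto simp: same_block_def)
  next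
    case False
    obtain a b where ab: "a < length w" "b < length w" "w ! a \<noteq> 0" "w ! b \<noteq> 0"
      and not: "\<not> (x (pos a) \<noteq> 0 \<and> (w ! a = w ! b \<longleftrightarrow> x (pos a) = x (pos b)))"
      using assms(1) unfolding matches_def comp_def not_all not_imp by (elim exE conjE) (rule that)
    have nz: "x (pos a) \<noteq> 0" "x (pos b) \<noteq> 0" using False ab by auto
    then have neq: "(w ! a = w ! b) \<noteq> (x (pos a) = x (pos b))" using not by simp
    have x: "x (pos a) \<in> {1..q}" "x (pos b) \<in> {1..q}"
      using nz ab assms(2) by (auto simp: Suc_le_eq)
    show ?thesis
    proof (cases "w ! a = w ! b")
      case True
      let ?blk = "same_block q (pos a) (pos b)"
      obtain c where c: "feasible q x ?blk {1..<q} c" "c ` {1..<q} \<inter> {x (pos a)} = {}"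
        by (rule ex_feasible[of "{1..<q}" "{x (pos a)}" q ?blk x])
          (use x in \<open>auto simp: same_block_def nth_Cons'\<close>)
      have "{..<q} = insert 0 {1..<q}" using assms(3) by auto
      \<comment> \<open>The root takes the color of \<open>pos a\<close>, which all other block
        vertices avoid; the root itself only has to differ from \<open>pos b\<close>.\<close>
      then have "feasible q x ?blk {..<q} (c(0 := x (pos a)))"
        using c x ab neq True unfolding feasible_def
        by (auto simp: inj_on_def same_block_def)
      moreover have "length ?blk = q" using assms(3) by (simp add: same_block_def)
      ultimately show ?thesis using blk[OF ab(1-4)] True by (intro bexI[of _ ?blk]) auto
    next
      case False
      let ?blk = "diff_block q (pos a) (pos b)"
      obtain c where "feasible q x ?blk {..<q - 1} c"
        by (rule ex_feasible[of "{..<q - 1}" "{x (pos a)}" q ?blk x])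
          (use x ab neq False in \<open>auto simp: diff_block_def\<close>)
      moreover have "length ?blk = q - 1" by (simp add: diff_block_def)
      ultimately show ?thesis using blk[OF ab(1-4)] False by (intro bexI[of _ ?blk]) auto
    qed
  qed
qed

text \<open>Without the root, \<open>q - 1\<close> vertices face one forbidden color or
  \<open>q - 2\<close> vertices face two, which always fits. Deleting the root therefore settles a
  block whatever the hub colors are.\<close>

lemma word_blocks_rootless:
  assumes "blk \<in> set (word_blocks q pos w)" "\<forall>a<length w. w ! a \<le> q" "1 \<le> q"
  shows "\<exists>c. feasible q x blk {1..<length blk} c" "1 \<le> length blk" "length blk \<le> Suc q"
proof -
  obtain a b where ab: "a < length w" "b < length w" "w ! a \<noteq> 0" "w ! b \<noteq> 0"
    "blk = (if w ! a = w ! b then same_block q (pos a) (pos b) else diff_block q (pos a) (pos b))"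
    using assms(1) by (auto simp: word_blocks_iff test_block_def)
  \<comment> \<open>Two distinct nonzero entries require two colors; this guarantees that a
    \<open>diff_block\<close> has a root.\<close>
  have q: "2 \<le> q" if "w ! a \<noteq> w ! b"
  proof -
    have "w ! a \<le> q" "w ! b \<le> q" using ab assms(2) by auto
    then show ?thesis using that ab by linarith
  qed
  show "1 \<le> length blk" "length blk \<le> Suc q"
    using ab q assms(3) by (auto simp: same_block_def diff_block_def)
  show "\<exists>c. feasible q x blk {1..<length blk} c"
  proof (cases "w ! a = w ! b")
    case True
    have att: "set (blk ! i) = {pos a}" if "i \<in> {1..<length blk}" for i
      using ab(5) True that by (cases i) (auto simp: same_block_def)
    have "length blk = q" using ab(5) True assms(3) by (simp add: same_block_def)
    then show ?thesis using assms(3) att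
      by (intro ex_feasible_card[of "{1..<length blk}" "{x (pos a)}"]) simp_all
  next
    case False
    have att: "set (blk ! i) = {pos a, pos b}" if "i \<in> {1..<length blk}" for i
      using ab(5) False that by (auto simp: diff_block_def)
    have "length blk = q - 1" using ab(5) False by (simp add: diff_block_def)
    moreover have "card {x (pos a), x (pos b)} \<le> 2" by (simp add: card_insert_if)
    ultimately show ?thesis using q[OF False] att
      by (intro ex_feasible_card[of "{1..<length blk}" "{x (pos a), x (pos b)}"]) (simp, simp, simp, auto)
  qed
qed

lemma length_const_block [simp]: "length (const_block q) = Suc q"
  by (simp add: const_block_def)

lemma const_block_infeasible: "\<nexists>c. feasible q x (const_block q) {..<Suc q} c"
  using feasible_card[of q x "const_block q" "{..<Suc q}" _ "{}"] by auto

lemma const_block_rootless: "\<exists>c. feasible q x (const_block q) {1..<Suc q} c"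
  by (rule ex_feasible_card[of _ "{}"]) (simp_all add: const_block_def del: replicate_Suc)

text \<open>
  Vertex \<open>i\<close> of block \<open>e\<close> has the number \<open>e * S + i\<close> within the gadget. There may
  be unused numbers, which belong to isolated vertices.
\<close>

definition gadget_edges :: "(nat \<Rightarrow> 'v) \<Rightarrow> nat \<Rightarrow> 'v list list list \<Rightarrow> ('v \<times> 'v) list" where
  "gadget_edges lv S blks =
     [(lv (e * S + j), lv (e * S + i)). e \<leftarrow> [0..<length blks], j \<leftarrow> [0..<length (blks ! e)], i \<leftarrow> [0..<j]] @
     [(lv (e * S + j), h). e \<leftarrow> [0..<length blks], j \<leftarrow> [0..<length (blks ! e)], h \<leftarrow> blks ! e ! j] @
     [(lv (e * S), lv (d * S)). e \<leftarrow> [0..<length blks], d \<leftarrow> [0..<e]]"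

definition gadget_coloring :: "nat \<Rightarrow> 'v list list list \<Rightarrow> ('v \<Rightarrow> nat) \<Rightarrow> (nat \<Rightarrow> nat) \<Rightarrow> bool" where
  "gadget_coloring S blks x c \<longleftrightarrow>
     (\<forall>e<length blks. \<forall>j<length (blks ! e). \<forall>i<j. c (e * S + j) \<noteq> 0 \<longrightarrow> c (e * S + j) \<noteq> c (e * S + i)) \<and>
     (\<forall>e<length blks. \<forall>j<length (blks ! e). \<forall>h\<in>set (blks ! e ! j). c (e * S + j) \<noteq> 0 \<longrightarrow> c (e * S + j) \<noteq> x h) \<and>
     (\<forall>e<length blks. \<forall>d<e. c (e * S) \<noteq> 0 \<longrightarrow> c (e * S) \<noteq> c (d * S))"

lemma set_gadget_edges:
  "set (gadget_edges lv S blks) =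
     (\<Union>e<length blks. \<Union>j<length (blks ! e). (\<lambda>i. (lv (e * S + j), lv (e * S + i))) ` {..<j}) \<union>
     (\<Union>e<length blks. \<Union>j<length (blks ! e). (\<lambda>h. (lv (e * S + j), h)) ` set (blks ! e ! j)) \<union>
     (\<Union>e<length blks. (\<lambda>d. (lv (e * S), lv (d * S))) ` {..<e})"
  by (simp add: gadget_edges_def atLeast0LessThan Un_assoc)

section \<open>Deletions forced and sufficient in a single gadget\<close>

lemma gadget_coloring_iff:
  "gadget_coloring S blks f (\<lambda>a. f (lv a)) \<longleftrightarrow>
     (\<forall>(u, v)\<in>set (gadget_edges lv S blks). f u \<noteq> 0 \<longrightarrow> f u \<noteq> f v)"
  unfolding gadget_coloring_def set_gadget_edges
  by (simp add: ball_Un ball_UN Ball_def[of "{..<_}"]) (intro conj_cong refl; auto)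

text \<open>The roots form a clique, of which at most \<open>q\<close> can survive.\<close>

lemma gadget_coloring_zeros_ge:
  assumes "gadget_coloring S blks x c" "\<forall>a<length blks * S. c a \<le> q" "0 < S"
  shows "length blks \<le> card {a. a < length blks * S \<and> c a = 0} + q"
proof -
  let ?L = "{..<length blks}" and ?r = "\<lambda>e. e * S"
  have inj: "inj ?r" using assms(3) by (auto simp: inj_def)
  have less: "e * S < length blks * S" if "e < length blks" for e using that assms(3) by simp
  have "inj_on (\<lambda>e. c (e * S)) {e \<in> ?L. c (e * S) \<noteq> 0}"
  proof (rule linorder_inj_onI')
    fix d e assume "d \<in> {e \<in> ?L. c (e * S) \<noteq> 0}" "e \<in> {e \<in> ?L. c (e * S) \<noteq> 0}" "d < e"
    then show "c (d * S) \<noteq> c (e * S)" using assms(1) unfolding gadget_coloring_def by fastforce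
  qed
  then have "card {e \<in> ?L. c (e * S) \<noteq> 0} \<le> card {1..q}"
    by (rule card_inj_on_le) (use assms(2) less in \<open>auto simp: Suc_le_eq\<close>)
  moreover have "card (?r ` {e \<in> ?L. c (e * S) = 0}) \<le> card {a. a < length blks * S \<and> c a = 0}"
    by (rule card_mono) (use less in auto)
  moreover have "card (?r ` {e \<in> ?L. c (e * S) = 0}) = card {e \<in> ?L. c (e * S) = 0}"
    by (rule card_image) (rule inj_on_subset[OF inj], simp)
  moreover have "card ?L = card {e \<in> ?L. c (e * S) \<noteq> 0} + card {e \<in> ?L. c (e * S) = 0}"
  proof -
    have "?L = {e \<in> ?L. c (e * S) \<noteq> 0} \<union> {e \<in> ?L. c (e * S) = 0}" by auto
    then have "card ?L = card ({e \<in> ?L. c (e * S) \<noteq> 0} \<union> {e \<in> ?L. c (e * S) = 0})" by (rule arg_cong)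
    also have "\<dots> = card {e \<in> ?L. c (e * S) \<noteq> 0} + card {e \<in> ?L. c (e * S) = 0}"
      by (rule card_Un_disjoint) auto
    finally show ?thesis .
  qed
  ultimately show ?thesis by simp
qed

text \<open>Every uncolorable block loses a vertex, and blocks of length at most \<open>S\<close>
  have disjoint sets of vertex numbers.\<close>

lemma gadget_coloring_infeasible_zeros_ge:
  assumes "gadget_coloring S blks x c" "\<forall>a<length blks * S. c a \<le> q"
    and "m \<le> length blks" "\<And>e. e < m \<Longrightarrow> length (blks ! e) \<le> S"
    and inf: "\<And>e. e < m \<Longrightarrow> \<nexists>k. feasible q x (blks ! e) {..<length (blks ! e)} k"
  shows "m \<le> card {a. a < length blks * S \<and> c a = 0}"
proof -
  have "\<exists>i<length (blks ! e). c (e * S + i) = 0" if e: "e < m" for e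
  proof (rule ccontr)
    assume "\<not> ?thesis"
    then have nz: "\<And>i. i < length (blks ! e) \<Longrightarrow> c (e * S + i) \<noteq> 0" by auto
    have le: "e * S + i < length blks * S" if "i < length (blks ! e)" for i
    proof -
      have "e * S + i < Suc e * S" using that assms(4)[OF e] by simp
      also have "\<dots> \<le> length blks * S" using e assms(3) by (intro mult_right_mono) auto
      finally show ?thesis .
    qed
    have el: "e < length blks" using e assms(3) by simp
    have "feasible q x (blks ! e) {..<length (blks ! e)} (\<lambda>i. c (e * S + i))"
      unfolding feasible_def
    proof (intro conjI ballI)
      show "inj_on (\<lambda>i. c (e * S + i)) {..<length (blks ! e)}"
      proof (rule linorder_inj_onI')
        fix i j assume "i \<in> {..<length (blks ! e)}" "j \<in> {..<length (blks ! e)}" "i < j"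
        then show "c (e * S + i) \<noteq> c (e * S + j)"
          using assms(1) el nz[of j] unfolding gadget_coloring_def by (metis lessThan_iff)
      qed
      fix i assume i: "i \<in> {..<length (blks ! e)}"
      then show "c (e * S + i) \<in> {1..q}" using nz[of i] le[of i] assms(2) by (simp add: Suc_le_eq)
      fix h assume "h \<in> set (blks ! e ! i)"
      then show "c (e * S + i) \<noteq> x h"
        using assms(1) el i nz[of i] unfolding gadget_coloring_def by simp
    qed
    then show False using inf[OF e] by blast
  qed
  then obtain i where i: "\<And>e. e < m \<Longrightarrow> i e < length (blks ! e) \<and> c (e * S + i e) = 0" by metis
  have iS: "i e < S" if "e < m" for e using i[OF that] assms(4)[OF that] by simp
  have "inj_on (\<lambda>e. e * S + i e) {..<m}"
  proof (rule inj_onI)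
    fix d e assume "d \<in> {..<m}" "e \<in> {..<m}" "d * S + i d = e * S + i e"
    then have "(d * S + i d) div S = (e * S + i e) div S" by simp
    moreover have "i d < S" "i e < S" using iS \<open>d \<in> {..<m}\<close> \<open>e \<in> {..<m}\<close> by auto
    ultimately show "d = e" by simp
  qed
  then have "card {..<m} \<le> card {a. a < length blks * S \<and> c a = 0}"
  proof (rule card_inj_on_le)
    show "(\<lambda>e. e * S + i e) ` {..<m} \<subseteq> {a. a < length blks * S \<and> c a = 0}"
    proof safe
      fix e assume e: "e < m"
      have "e * S + i e < Suc e * S" using iS[OF e] by simp
      also have "\<dots> \<le> length blks * S" using e assms(3) by (intro mult_right_mono) auto
      finally show "e * S + i e < length blks * S" .
      show "c (e * S + i e) = 0" using i e by simp
    qed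
  qed simp
  then show ?thesis by simp
qed

text \<open>
  The roots of all tests but the feasible one are deleted; the color of the remaining root is
  avoided by the \<open>q - 1\<close> blocks without neighbours.
\<close>

lemma ex_gadget_coloring:
  assumes "blks = ts @ replicate (q - 1) [[]]" "1 \<le> q" "e0 < length ts"
    and "feasible q x (ts ! e0) {..<length (ts ! e0)} k0"
    and rootless: "\<And>e. e < length ts \<Longrightarrow> \<exists>k. feasible q x (ts ! e) {1..<length (ts ! e)} k"
    and len: "\<And>e. e < length ts \<Longrightarrow> 1 \<le> length (ts ! e) \<and> length (ts ! e) \<le> S" and "1 \<le> S"
  shows "\<exists>c. gadget_coloring S blks x c \<and> (\<forall>a. c a \<le> q) \<and>
     {a. c a = 0} = (\<lambda>e. e * S) ` ({..<length ts} - {e0})"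
proof -
  obtain kr where kr: "\<And>e. e < length ts \<Longrightarrow> feasible q x (ts ! e) {1..<length (ts ! e)} (kr e)"
    using rootless by metis
  have inj0: "k0 j \<noteq> k0 i" if "i < j" "j < length (ts ! e0)" for i j
    using assms(4) that inj_onD[of k0 "{..<length (ts ! e0)}" j i] by (auto simp: feasible_def)
  have avoid0: "k0 j \<noteq> x h" if "j < length (ts ! e0)" "h \<in> set (ts ! e0 ! j)" for j h
    using assms(4) that unfolding feasible_def by blast
  have injr: "kr e j \<noteq> kr e i" if "e < length ts" "0 < i" "i < j" "j < length (ts ! e)" for e i j
    using kr[OF that(1)] that inj_onD[of "kr e" "{1..<length (ts ! e)}" j i] by (auto simp: feasible_def)
  have colr: "kr e j \<in> {1..q}" if "e < length ts" "0 < j" "j < length (ts ! e)" for e j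
  proof -
    have "j \<in> {1..<length (ts ! e)}" using that by simp
    then show ?thesis using kr[OF that(1)] unfolding feasible_def by blast
  qed
  have avoidr: "kr e j \<noteq> x h" if "e < length ts" "0 < j" "j < length (ts ! e)" "h \<in> set (ts ! e ! j)" for e j h
  proof -
    have "j \<in> {1..<length (ts ! e)}" using that by simp
    then show ?thesis using kr[OF that(1)] that(4) unfolding feasible_def by blast
  qed
  have k00: "k0 0 \<in> {1..q}" using assms(3,4) len[of e0] by (auto simp: feasible_def)
  have "card ({1..q} - {k0 0}) = q - 1" using k00 by simp
  then obtain g where g: "inj_on g {..<q - 1}" "g ` {..<q - 1} \<subseteq> {1..q} - {k0 0}"
    using card_le_inj[of "{..<q - 1}" "{1..q} - {k0 0}"] by auto
  \<comment> \<open>Block \<open>e0\<close> is colored completely, every other test block loses its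
    root, and the \<open>q - 1\<close> single vertices share the colors that the root of
    \<open>e0\<close> leaves.\<close>
  define k where "k e i = (if e = e0 then k0 i else if e < length ts then (if i = 0 then 0 else kr e i)
     else g (e - length ts))" for e i
  define c where "c a = (if a div S < length blks \<and> a mod S < length (blks ! (a div S))
     then k (a div S) (a mod S) else 1)" for a
  have lb: "length blks = length ts + (q - 1)" using assms(1) by simp
  have nth: "blks ! e = (if e < length ts then ts ! e else [[]])" if "e < length blks" for e
    using that lb by (simp add: assms(1) nth_append)
  have blen: "1 \<le> length (blks ! e)" "length (blks ! e) \<le> S" if "e < length blks" for e
    using that nth[OF that] len assms(7) by auto
  have c: "c (e * S + i) = k e i" if "e < length blks" "i < length (blks ! e)" for e i
    using that blen[OF that(1)] by (simp add: c_def)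
  have c0: "c (e * S) = k e 0" if "e < length blks" for e
  proof -
    have "0 < length (blks ! e)" using blen(1)[OF that] by linarith
    then show ?thesis using c[OF that, of 0] by simp
  qed
  have k_le: "k e i \<le> q" if "e < length blks" "i < length (blks ! e)" for e i
  proof -
    consider "e = e0" | "e \<noteq> e0" "e < length ts" | "length ts \<le> e" by linarith
    then show ?thesis
    proof cases
      case 1
      then show ?thesis using assms(3,4) that nth[OF that(1)] by (auto simp: k_def feasible_def)
    next
      case 2
      then show ?thesis using kr[OF 2(2)] that nth[OF that(1)] by (auto simp: k_def feasible_def)
    next
      case 3
      then have "e - length ts < q - 1" using that lb by simp
      then show ?thesis using 3 g(2) assms(3) by (auto simp: k_def)
    qed
  qed
  have k_pos: "k e i \<noteq> 0" if "e < length blks" "i < length (blks ! e)" "\<not> (e < length ts \<and> e \<noteq> e0 \<and> i = 0)" for e i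
  proof -
    consider "e = e0" | "e \<noteq> e0" "e < length ts" | "length ts \<le> e" by linarith
    then show ?thesis
    proof cases
      case 1
      then have "i \<in> {..<length (ts ! e0)}" using assms(3) that nth[OF that(1)] by simp
      then have "k0 i \<in> {1..q}" using assms(4) unfolding feasible_def by blast
      then show ?thesis using 1 by (simp add: k_def)
    next
      case 2
      then have "i \<in> {1..<length (ts ! e)}" using that nth[OF that(1)] by (auto simp: Suc_le_eq)
      then have "kr e i \<in> {1..q}" using kr[OF 2(2)] unfolding feasible_def by blast
      then show ?thesis using 2 that by (simp add: k_def)
    next
      case 3
      then have "e - length ts < q - 1" using that lb by simp
      then show ?thesis using 3 g(2) assms(3) by (auto simp: k_def)
    qed
  qed
  have "gadget_coloring S blks x c"
    unfolding gadget_coloring_def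
  proof (intro conjI allI impI ballI)
    fix e j i assume e: "e < length blks" and j: "j < length (blks ! e)" and i: "i < j"
      and nz: "c (e * S + j) \<noteq> 0"
    have et: "e < length ts" using j i nth[OF e] by (auto split: if_splits)
    have "k e j \<noteq> k e i"
    proof (cases "e = e0")
      case True
      then show ?thesis using inj0[OF i] j nth[OF e] et by (simp add: k_def)
    next
      case False
      have "kr e j \<in> {1..q}" using colr[OF et, of j] i j nth[OF e] et by simp
      moreover have "i \<noteq> 0 \<Longrightarrow> kr e j \<noteq> kr e i"
        using injr[OF et, of i j] i j nth[OF e] et by simp
      ultimately show ?thesis using False et i by (auto simp: k_def)
    qed
    then show "c (e * S + j) \<noteq> c (e * S + i)" using c e j i by simp
  next
    fix e j h assume e: "e < length blks" and j: "j < length (blks ! e)" and h: "h \<in> set (blks ! e ! j)"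
      and nz: "c (e * S + j) \<noteq> 0"
    have et: "e < length ts" using j h nth[OF e] by (auto split: if_splits)
    have "k e j \<noteq> 0" using nz c e j by simp
    then have "k e j \<noteq> x h"
      using avoid0[of j h] avoidr[OF et, of j h] j h nth[OF e] et by (auto simp: k_def split: if_splits)
    then show "c (e * S + j) \<noteq> x h" using c e j by simp
  next
    fix e d assume e: "e < length blks" and d: "d < e" and nz: "c (e * S) \<noteq> 0"
    have ke: "k e 0 \<noteq> 0" using nz c0[OF e] by simp
    have dl: "d < length blks" using d e by simp
    have "k e 0 \<noteq> k d 0"
    proof (cases "e < length ts")
      case True
      then have "e = e0" using ke by (auto simp: k_def split: if_splits)
      then show ?thesis using d True ke by (auto simp: k_def)
    next
      case False
      then have ge: "k e 0 = g (e - length ts)" "e - length ts < q - 1"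
        using assms(3) e lb by (auto simp: k_def)
      consider "d = e0" | "d \<noteq> e0" "d < length ts" | "length ts \<le> d" by linarith
      then show ?thesis
      proof cases
        case 1
        then show ?thesis using ge g(2) by (auto simp: k_def)
      next
        case 2
        then show ?thesis using ke by (simp add: k_def)
      next
        case 3
        then have gd: "k d 0 = g (d - length ts)" "d - length ts < q - 1"
          using assms(3) dl lb by (auto simp: k_def)
        have "g (e - length ts) \<noteq> g (d - length ts)"
          using inj_onD[OF g(1), of "e - length ts" "d - length ts"] ge(2) gd(2) d 3 by auto
        then show ?thesis using ge gd by simp
      qed
    qed
    then show "c (e * S) \<noteq> c (d * S)" using c0 e dl by simp
  qed
  moreover have "c a \<le> q" for a using k_le assms(2) by (simp add: c_def)
  moreover have "{a. c a = 0} = (\<lambda>e. e * S) ` ({..<length ts} - {e0})"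
  proof (intro equalityI subsetI)
    fix a assume "a \<in> {a. c a = 0}"
    then have a: "a div S < length blks" "a mod S < length (blks ! (a div S))" "k (a div S) (a mod S) = 0"
      by (auto simp: c_def split: if_splits)
    then have "a div S < length ts \<and> a div S \<noteq> e0 \<and> a mod S = 0" using k_pos by blast
    then show "a \<in> (\<lambda>e. e * S) ` ({..<length ts} - {e0})"
      by (intro image_eqI[of _ _ "a div S"]) (auto simp: mod_0_imp_dvd)
  next
    fix a assume "a \<in> (\<lambda>e. e * S) ` ({..<length ts} - {e0})"
    then obtain e where e: "a = e * S" "e < length ts" "e \<noteq> e0" by auto
    then have "c a = k e 0" using c0[of e] lb by simp
    then show "a \<in> {a. c a = 0}" using e by (simp add: k_def)
  qed
  ultimately show ?thesis by blast
qed

section \<open>Graphs composed of gadgets\<close>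

text \<open>
  A gadget is given by pairs \<open>(b, w)\<close>: it is violated by a coloring if for all of them
  the colors of the hub vertices \<open>b, b + 1, \<dots>\<close> match the word \<open>w\<close>.
\<close>

definition shifted :: "(nat \<times> nat list) list \<Rightarrow> ((nat \<Rightarrow> nat) \<times> nat list) list" where
  "shifted g = map (\<lambda>(b, w). ((+) b, w)) g"

text \<open>The number of unavoidable deletions: with the constant block and the
  \<open>q - 1\<close> single vertices, the clique of roots has \<open>gadget_cost q g + q\<close>
  members.\<close>

definition gadget_cost :: "nat \<Rightarrow> (nat \<times> nat list) list \<Rightarrow> nat" where
  "gadget_cost q g = length (gadget_tests q (shifted g))"

definition violated :: "(nat \<Rightarrow> nat) \<Rightarrow> (nat \<times> nat list) list \<Rightarrow> bool" where
  "violated f g \<longleftrightarrow> (\<forall>(b, w)\<in>set g. matches w (\<lambda>j. f (b + j)))"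

definition placed_edges :: "nat \<Rightarrow> nat \<Rightarrow> (nat \<times> nat list) list \<Rightarrow> (nat \<times> nat) list" where
  "placed_edges q N g = gadget_edges ((+) N) (Suc q) (gadget_blocks q (shifted g))"

definition all_edges :: "nat \<Rightarrow> nat \<Rightarrow> nat \<Rightarrow> (nat \<times> nat list) list list \<Rightarrow> (nat \<times> nat) list" where
  "all_edges q H SZ gs = concat (map (\<lambda>i. placed_edges q (H + i * SZ) (gs ! i)) [0..<length gs])"

lemma all_edges_snoc:
  "all_edges q H SZ (gs @ [g]) = all_edges q H SZ gs @ placed_edges q (H + length gs * SZ) g"
proof -
  have "map (\<lambda>i. placed_edges q (H + i * SZ) ((gs @ [g]) ! i)) [0..<length gs] =
      map (\<lambda>i. placed_edges q (H + i * SZ) (gs ! i)) [0..<length gs]"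
    by (rule map_cong) (auto simp: nth_append)
  then show ?thesis by (simp add: all_edges_def del: map_eq_conv)
qed

text \<open>Hub vertices come first. Every gadget owns a range of \<open>SZ\<close> numbers, a
  uniform reservation that makes gadget and position a quotient and a remainder.\<close>

definition instance_graph :: "nat \<Rightarrow> nat \<Rightarrow> nat \<Rightarrow> (nat \<times> nat list) list list \<Rightarrow> nat pair_pre_digraph" where
  "instance_graph q H SZ gs = \<lparr>pverts = {..<H + length gs * SZ},
     parcs = set (all_edges q H SZ gs) \<union> (set (all_edges q H SZ gs))\<inverse>\<rparr>"

text \<open>Stated for arbitrary parameters because it is applied both to the gadgets and, with
  \<open>H = 0\<close>, to the groups of hub vertices.\<close>

lemma card_deleted_split:
  fixes H SZ m :: nat and f :: "nat \<Rightarrow> nat"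
  shows "card {v. v < H + m * SZ \<and> f v = 0} = card {v. v < H \<and> f v = 0} +
     (\<Sum>i<m. card {a. a < SZ \<and> f (H + i * SZ + a) = 0})"
proof (induction m)
  case (Suc m)
  let ?N = "H + m * SZ"
  have "{v. v < H + Suc m * SZ \<and> f v = 0} =
      {v. v < ?N \<and> f v = 0} \<union> (+) ?N ` {a. a < SZ \<and> f (?N + a) = 0}"
  proof (intro equalityI subsetI)
    fix v assume v: "v \<in> {v. v < H + Suc m * SZ \<and> f v = 0}"
    show "v \<in> {v. v < ?N \<and> f v = 0} \<union> (+) ?N ` {a. a < SZ \<and> f (?N + a) = 0}"
    proof (cases "v < ?N")
      case False
      then have "v = ?N + (v - ?N)" "v - ?N < SZ" using v by auto
      then show ?thesis using v by (metis (mono_tags, lifting) UnCI image_eqI mem_Collect_eq)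
    qed (use v in simp)
  qed auto
  then have "card {v. v < H + Suc m * SZ \<and> f v = 0} =
      card {v. v < ?N \<and> f v = 0} + card ((+) ?N ` {a. a < SZ \<and> f (?N + a) = 0})"
    by (simp only:) (rule card_Un_disjoint, auto)
  also have "card ((+) ?N ` {a. a < SZ \<and> f (?N + a) = 0}) = card {a. a < SZ \<and> f (?N + a) = 0}"
    by (rule card_image) simp
  finally show ?case using Suc by simp
qed simp

lemma word_blocks_att:
  assumes "blk \<in> set (word_blocks q pos w)" "j < length blk" "h \<in> set (blk ! j)"
  shows "\<exists>a<length w. h = pos a"
proof -
  obtain a b where "a < length w" "b < length w" "blk = test_block q pos w a b"
    using assms(1) by (auto simp: word_blocks_iff)
  then show ?thesis using assms(2,3)
    by (cases j) (auto simp: test_block_def same_block_def diff_block_def split: if_splits)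
qed

locale gadget_instance =
  fixes q t H SZ :: nat and gs :: "(nat \<times> nat list) list list"
  assumes q: "1 \<le> q" and SZ: "1 \<le> SZ"
    and fits: "\<And>g. g \<in> set gs \<Longrightarrow> (gadget_cost q g + q) * Suc q \<le> SZ"
    and words: "\<And>g b w. g \<in> set gs \<Longrightarrow> (b, w) \<in> set g \<Longrightarrow> length w = t \<and> b + t \<le> H \<and> (\<forall>a<t. w ! a \<le> q)"
begin

abbreviation "G \<equiv> instance_graph q H SZ gs"
abbreviation "blocks g \<equiv> gadget_blocks q (shifted g)"
abbreviation "tests g \<equiv> const_block q # gadget_tests q (shifted g)"

lemma blocks_eq: "blocks g = tests g @ replicate (q - 1) [[]]"
  by (simp add: gadget_blocks_def)

lemma length_blocks: "length (blocks g) = gadget_cost q g + q"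
  using q by (simp add: gadget_blocks_def gadget_cost_def)

lemma in_tests:
  "blk \<in> set (tests g) \<Longrightarrow> blk = const_block q \<or> (\<exists>b w. (b, w) \<in> set g \<and> blk \<in> set (word_blocks q ((+) b) w))"
  by (auto simp: gadget_tests_def shifted_def)

lemma tests_length:
  assumes "g \<in> set gs" "blk \<in> set (tests g)"
  shows "1 \<le> length blk" "length blk \<le> Suc q" "\<exists>c. feasible q x blk {1..<length blk} c"
  using in_tests[OF assms(2)] word_blocks_rootless[of blk q] words[OF assms(1)] q const_block_rootless[of q]
  by (auto 4 3)

lemma block_length:
  assumes "g \<in> set gs" "e < length (blocks g)"
  shows "length (blocks g ! e) \<le> Suc q"
proof -
  have "blocks g ! e \<in> set (tests g) \<or> blocks g ! e = [[]]"
    using nth_mem[OF assms(2)] unfolding blocks_eq set_append by (auto split: if_splits)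
  then show ?thesis using tests_length(2)[OF assms(1)] by auto
qed

lemma blocks_att:
  assumes "g \<in> set gs" "e < length (blocks g)" "j < length (blocks g ! e)" "h \<in> set (blocks g ! e ! j)"
  shows "\<exists>(b, w)\<in>set g. h \<in> {b..<b + t}"
proof -
  have "blocks g ! e \<in> set (tests g) \<or> blocks g ! e = [[]]"
    using nth_mem[OF assms(2)] unfolding blocks_eq set_append by (auto split: if_splits)
  moreover have "blocks g ! e \<noteq> [[]]" using assms(3,4) by auto
  moreover have "blocks g ! e \<noteq> const_block q"
  proof
    assume "blocks g ! e = const_block q"
    then have "set (blocks g ! e ! j) = {}" using assms(3) by (simp add: const_block_def del: replicate_Suc)
    then show False using assms(4) by simp
  qed
  ultimately obtain b w where bw: "(b, w) \<in> set g" "blocks g ! e \<in> set (word_blocks q ((+) b) w)"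
    using in_tests by blast
  then have "h \<in> {b..<b + t}" using word_blocks_att[OF bw(2) assms(3,4)] words[OF assms(1) bw(1)] by auto
  then show ?thesis using bw(1) by blast
qed

lemma placed_edgesD:
  assumes "g \<in> set gs" "(u, v) \<in> set (placed_edges q N g)"
  shows "\<exists>a<SZ. u = N + a \<and> ((\<exists>a'<SZ. v = N + a' \<and> a \<noteq> a') \<or> (\<exists>(b, w)\<in>set g. v \<in> {b..<b + t}))"
proof -
  let ?B = "blocks g"
  have idx: "e * Suc q + j < SZ" if "e < length ?B" "j \<le> q" for e j
  proof -
    have "e * Suc q + j < Suc e * Suc q" using that by simp
    also have "\<dots> \<le> length ?B * Suc q" using that by (intro mult_right_mono) auto
    also have "\<dots> \<le> SZ" using fits[OF assms(1)] by (simp only: length_blocks)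
    finally show ?thesis .
  qed
  have jq: "j \<le> q" if "e < length ?B" "j < length (?B ! e)" for e j
    using block_length[OF assms(1) that(1)] that(2) by simp
  consider (a) e j i where "e < length ?B" "j < length (?B ! e)" "i < j" "u = N + (e * Suc q + j)" "v = N + (e * Suc q + i)"
    | (b) e j where "e < length ?B" "j < length (?B ! e)" "v \<in> set (?B ! e ! j)" "u = N + (e * Suc q + j)"
    | (c) e d where "e < length ?B" "d < e" "u = N + e * Suc q" "v = N + d * Suc q"
    using assms(2) unfolding placed_edges_def set_gadget_edges by blast
  then show ?thesis
  proof cases
    case a
    then show ?thesis using idx[OF a(1) jq[OF a(1,2)]] idx[of e i] jq[OF a(1,2)] by auto
  next
    case b
    then show ?thesis using idx[OF b(1) jq[OF b(1,2)]] blocks_att[OF assms(1) b(1-3)] by blast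
  next
    case c
    then have "e * Suc q \<noteq> d * Suc q" unfolding mult_cancel2 by simp
    moreover have "e * Suc q < SZ" "d * Suc q < SZ" using c(1,2) idx[of e 0] idx[of d 0] by simp_all
    ultimately show ?thesis using c(3,4) by blast
  qed
qed

lemma all_edgesD:
  assumes "(u, v) \<in> set (all_edges q H SZ gs)"
  obtains i a where "i < length gs" "a < SZ" "u = H + i * SZ + a"
    "(\<exists>a'<SZ. v = H + i * SZ + a' \<and> a \<noteq> a') \<or> (\<exists>(b, w)\<in>set (gs ! i). v \<in> {b..<b + t}) \<and> v < H"
proof -
  obtain i where i: "i < length gs" "(u, v) \<in> set (placed_edges q (H + i * SZ) (gs ! i))"
    using assms by (auto simp: all_edges_def)
  have g: "gs ! i \<in> set gs" using i by simp
  have "v < H" if "(b, w) \<in> set (gs ! i)" "v \<in> {b..<b + t}" for b w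
    using words[OF g that(1)] that(2) by auto
  then show ?thesis using placed_edgesD[OF g i(2)] i(1) that by blast
qed

lemma index_less: "i < length gs \<Longrightarrow> a < SZ \<Longrightarrow> H + i * SZ + a < H + length gs * SZ"
proof -
  assume "i < length gs" "a < SZ"
  then have "i * SZ + a < Suc i * SZ" "Suc i * SZ \<le> length gs * SZ"
    by (auto intro: mult_right_mono simp del: mult_Suc) auto
  then show ?thesis by linarith
qed

lemma input_graph: "input_graph G"
proof -
  let ?E = "set (all_edges q H SZ gs)"
  have e: "u < H + length gs * SZ \<and> v < H + length gs * SZ \<and> u \<noteq> v" if "(u, v) \<in> ?E" for u v
    using all_edgesD[OF that] index_less by (smt (verit) add_left_cancel trans_less_add1 le_add1 not_less)
  have "pair_graph G"
    by unfold_locales (auto simp: instance_graph_def symmetric_def sym_def dest: e)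
  then show ?thesis by (simp add: input_graph_def instance_graph_def)
qed

text \<open>No edge joins two gadgets, so the quotient by \<open>SZ\<close> is a labelling as
  required by \<open>hubI\<close>. A gadget meets the hub only in the \<open>t\<close> positions of
  each of its words.\<close>

lemma hub:
  assumes "\<And>g. g \<in> set gs \<Longrightarrow> length g * t \<le> \<delta>"
  shows "hub SZ \<delta> G {..<H}"
proof -
  let ?E = "set (all_edges q H SZ gs)"
  let ?k = "\<lambda>v. (v - H) div SZ"
  have k: "?k (H + i * SZ + a) = i" if "a < SZ" for i a using that by simp
  have e: "u \<ge> H" "v \<ge> H \<Longrightarrow> ?k u = ?k v"
    "v < H \<Longrightarrow> ?k u < length gs \<and> (\<exists>(b, w)\<in>set (gs ! ?k u). v \<in> {b..<b + t})" if uv: "(u, v) \<in> ?E" for u v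
  proof -
    obtain i a where i: "i < length gs" "a < SZ" "u = H + i * SZ + a" and
      v: "(\<exists>a'<SZ. v = H + i * SZ + a' \<and> a \<noteq> a') \<or> (\<exists>(b, w)\<in>set (gs ! i). v \<in> {b..<b + t}) \<and> v < H"
      by (rule all_edgesD[OF uv])
    have ku: "?k u = i" using k[OF i(2)] i(3) by simp
    show "u \<ge> H" using i by simp
    show "?k u = ?k v" if "v \<ge> H" using v that k ku by auto
    show "?k u < length gs \<and> (\<exists>(b, w)\<in>set (gs ! ?k u). v \<in> {b..<b + t})" if "v < H"
      using v that i(1) unfolding ku by auto
  qed
  show ?thesis
  proof (rule hubI[where \<kappa> = ?k])
    show "pair_graph G" using input_graph by (simp add: input_graph_def)
    show "{..<H} \<subseteq> pverts G" by (auto simp: instance_graph_def)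
    show "?k u = ?k v" if "(u, v) \<in> parcs G" "u \<notin> {..<H}" "v \<notin> {..<H}" for u v
      using that e(2)[of u v] e(2)[of v u] by (auto simp: instance_graph_def)
    show "card {u \<in> pverts G - {..<H}. ?k u = i} \<le> SZ" for i
    proof -
      have "{u \<in> pverts G - {..<H}. ?k u = i} \<subseteq> (\<lambda>a. H + i * SZ + a) ` {..<SZ}"
      proof
        fix u assume "u \<in> {u \<in> pverts G - {..<H}. ?k u = i}"
        then have u: "u \<ge> H" "(u - H) div SZ = i" by auto
        have "u - H = i * SZ + (u - H) mod SZ" unfolding u(2)[symmetric] by (simp only: div_mult_mod_eq)
        with u(1) have "u = H + i * SZ + (u - H) mod SZ" by linarith
        then show "u \<in> (\<lambda>a. H + i * SZ + a) ` {..<SZ}" using SZ by (metis imageI lessThan_iff mod_less_divisor less_le_trans zero_less_one)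
      qed
      then have "card {u \<in> pverts G - {..<H}. ?k u = i} \<le> card ((\<lambda>a. H + i * SZ + a) ` {..<SZ})"
        by (intro card_mono) auto
      also have "\<dots> \<le> SZ" using card_image_le[of "{..<SZ}"] by simp
      finally show ?thesis .
    qed
    show "card {v \<in> {..<H}. \<exists>u\<in>pverts G - {..<H}. ?k u = i \<and> (u, v) \<in> parcs G} \<le> \<delta>" for i
    proof (cases "i < length gs")
      case True
      have "{v \<in> {..<H}. \<exists>u\<in>pverts G - {..<H}. ?k u = i \<and> (u, v) \<in> parcs G} \<subseteq>
         (\<Union>(b, w)\<in>set (gs ! i). {b..<b + t})"
      proof
        fix v assume "v \<in> {v \<in> {..<H}. \<exists>u\<in>pverts G - {..<H}. ?k u = i \<and> (u, v) \<in> parcs G}"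
        then obtain u where "v < H" "u \<in> pverts G - {..<H}" "?k u = i" "(u, v) \<in> parcs G" by blast
        then have u: "v < H" "u \<ge> H" "?k u = i" "(u, v) \<in> parcs G" by auto
        then have "(u, v) \<in> ?E" using e(1)[of v u] by (auto simp: instance_graph_def)
        then obtain b w where "(b, w) \<in> set (gs ! i)" "v \<in> {b..<b + t}" using e(3)[of u v] u by blast
        then show "v \<in> (\<Union>(b, w)\<in>set (gs ! i). {b..<b + t})" by (intro UN_I[of "(b, w)"]) auto
      qed
      then have "card {v \<in> {..<H}. \<exists>u\<in>pverts G - {..<H}. ?k u = i \<and> (u, v) \<in> parcs G} \<le>
         card (\<Union>(b, w)\<in>set (gs ! i). {b..<b + t})"
        by (intro card_mono) auto
      also have "\<dots> \<le> (\<Sum>p\<in>set (gs ! i). card (case p of (b, w) \<Rightarrow> {b..<b + t}))"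
        by (rule card_UN_le) simp
      also have "\<dots> = card (set (gs ! i)) * t" by (simp add: case_prod_beta)
      also have "\<dots> \<le> length (gs ! i) * t" by (intro mult_right_mono card_length) simp
      also have "\<dots> \<le> \<delta>" using assms True by simp
      finally show ?thesis .
    next
      case False
      have "{v \<in> {..<H}. \<exists>u\<in>pverts G - {..<H}. ?k u = i \<and> (u, v) \<in> parcs G} = {}"
        using False e(1,3) by (fastforce simp: instance_graph_def)
      then show ?thesis by (simp only: card.empty)
    qed
  qed
qed

lemma partial_coloring_iff:
  "partial_coloring q G f \<longleftrightarrow> (\<forall>v<H + length gs * SZ. f v \<le> q) \<and>
     (\<forall>i<length gs. gadget_coloring (Suc q) (blocks (gs ! i)) f (\<lambda>a. f (H + i * SZ + a)))"
proof -
  have "partial_coloring q G f \<longleftrightarrow> (\<forall>v<H + length gs * SZ. f v \<le> q) \<and>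
     (\<forall>(u, v)\<in>set (all_edges q H SZ gs). f u \<noteq> 0 \<longrightarrow> f u \<noteq> f v)"
    unfolding partial_coloring_def instance_graph_def by (auto simp: Ball_def) metis
  also have "(\<forall>(u, v)\<in>set (all_edges q H SZ gs). f u \<noteq> 0 \<longrightarrow> f u \<noteq> f v) \<longleftrightarrow>
     (\<forall>i<length gs. \<forall>(u, v)\<in>set (placed_edges q (H + i * SZ) (gs ! i)). f u \<noteq> 0 \<longrightarrow> f u \<noteq> f v)"
    unfolding all_edges_def by auto
  also have "\<dots> \<longleftrightarrow> (\<forall>i<length gs. gadget_coloring (Suc q) (blocks (gs ! i)) f (\<lambda>a. f (H + i * SZ + a)))"
    unfolding placed_edges_def gadget_coloring_iff[symmetric] ..
  finally show ?thesis .
qed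

text \<open>The clique of roots forces \<open>gadget_cost\<close>. If the gadget is violated, all
  its tests and the constant block are uncolorable and lose a vertex each, which is one
  more.\<close>

lemma gadget_zeros_ge:
  assumes "partial_coloring q G f" "i < length gs"
  shows "gadget_cost q (gs ! i) + of_bool (violated f (gs ! i)) \<le> card {a. a < SZ \<and> f (H + i * SZ + a) = 0}"
proof -
  let ?g = "gs ! i" and ?c = "\<lambda>a. f (H + i * SZ + a)"
  have g: "?g \<in> set gs" using assms by simp
  have gc: "gadget_coloring (Suc q) (blocks ?g) f ?c" and f_le: "\<forall>v<H + length gs * SZ. f v \<le> q"
    using assms by (auto simp: partial_coloring_iff)
  have len: "length (blocks ?g) * Suc q \<le> SZ" using fits[OF g] by (simp only: length_blocks)
  have c_le: "\<forall>a<length (blocks ?g) * Suc q. ?c a \<le> q"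
    using f_le index_less[OF assms(2)] len by auto
  have "card {a. a < length (blocks ?g) * Suc q \<and> ?c a = 0} \<le> card {a. a < SZ \<and> ?c a = 0}"
    using len by (intro card_mono) auto
  moreover have "length (blocks ?g) \<le> card {a. a < length (blocks ?g) * Suc q \<and> ?c a = 0} + q"
    by (rule gadget_coloring_zeros_ge[OF gc c_le]) simp
  moreover have "Suc (gadget_cost q ?g) \<le> card {a. a < length (blocks ?g) * Suc q \<and> ?c a = 0}"
    if v: "violated f ?g"
  proof (rule gadget_coloring_infeasible_zeros_ge[OF gc c_le])
    show "Suc (gadget_cost q ?g) \<le> length (blocks ?g)" using q by (simp add: length_blocks)
    fix e assume e: "e < Suc (gadget_cost q ?g)"
    then have el: "e < length (tests ?g)" by (simp add: gadget_cost_def)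
    then have nth: "blocks ?g ! e = tests ?g ! e" unfolding blocks_eq by (rule nth_append_left)
    have mem: "tests ?g ! e \<in> set (tests ?g)" using el by (rule nth_mem)
    show "length (blocks ?g ! e) \<le> Suc q" unfolding nth by (rule tests_length(2)[OF g mem])
    show "\<nexists>k. feasible q f (blocks ?g ! e) {..<length (blocks ?g ! e)} k"
      using in_tests[OF mem] unfolding nth
    proof
      assume eq: "tests ?g ! e = const_block q"
      show "\<nexists>k. feasible q f (tests ?g ! e) {..<length (tests ?g ! e)} k"
        unfolding eq length_const_block by (rule const_block_infeasible)
    next
      assume "\<exists>b w. (b, w) \<in> set ?g \<and> tests ?g ! e \<in> set (word_blocks q ((+) b) w)"
      then obtain b w where bw: "(b, w) \<in> set ?g" "tests ?g ! e \<in> set (word_blocks q ((+) b) w)" by blast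
      have "matches w (f \<circ> (+) b)" using v bw(1) by (auto simp: violated_def comp_def)
      then show "\<nexists>k. feasible q f (tests ?g ! e) {..<length (tests ?g ! e)} k"
        using words[OF g bw(1)] f_le by (intro word_blocks_infeasible[OF bw(2)]) auto
    qed
  qed
  ultimately show ?thesis by (auto simp: length_blocks)
qed

lemma card_deleted_ge:
  assumes "partial_coloring q G f"
  shows "card {v. v < H \<and> f v = 0} + (\<Sum>i<length gs. gadget_cost q (gs ! i) + of_bool (violated f (gs ! i)))
     \<le> card (deleted G f)"
proof -
  have "deleted G f = {v. v < H + length gs * SZ \<and> f v = 0}" by (auto simp: deleted_def instance_graph_def)
  then show ?thesis
    using gadget_zeros_ge[OF assms] by (simp only: card_deleted_split) (intro add_left_mono sum_mono, simp)
qed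

text \<open>A gadget that is not violated has a word that does not match and hence a colorable test.
  Keeping that block and deleting the roots of the other tests and of the constant block attains the
  lower bound in every gadget independently.\<close>

lemma ex_partial_coloring:
  assumes "\<forall>v<H. x v \<le> q" "\<And>g. g \<in> set gs \<Longrightarrow> \<not> violated x g"
  shows "\<exists>f. partial_coloring q G f \<and>
     card (deleted G f) = card {v. v < H \<and> x v = 0} + (\<Sum>i<length gs. gadget_cost q (gs ! i))"
proof -
  have "\<exists>c. gadget_coloring (Suc q) (blocks g) x c \<and> (\<forall>a. c a \<le> q) \<and>
     card {a. a < SZ \<and> c a = 0} = gadget_cost q g" if g: "g \<in> set gs" for g
  proof -
    obtain b w where bw: "(b, w) \<in> set g" "\<not> matches w (x \<circ> (+) b)"
      using assms(2)[OF g] by (auto simp: violated_def comp_def)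
    have "\<forall>a<length w. x (b + a) \<le> q" using words[OF g bw(1)] assms(1) by auto
    then obtain blk c where c: "blk \<in> set (word_blocks q ((+) b) w)" "feasible q x blk {..<length blk} c"
      using word_blocks_feasible[OF bw(2) _ q] by blast
    have "blk \<in> set (tests g)" using c(1) bw(1) by (auto simp: gadget_tests_def shifted_def intro!: bexI[of _ "(b, w)"])
    then obtain e0 where e0: "e0 < length (tests g)" "tests g ! e0 = blk" unfolding in_set_conv_nth by blast
    have "\<exists>c. gadget_coloring (Suc q) (blocks g) x c \<and> (\<forall>a. c a \<le> q) \<and>
      {a. c a = 0} = (\<lambda>e. e * Suc q) ` ({..<length (tests g)} - {e0})"
    proof (rule ex_gadget_coloring[OF blocks_eq q e0(1)])
      show "feasible q x (tests g ! e0) {..<length (tests g ! e0)} c" unfolding e0(2) by (rule c(2))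
    qed (use tests_length[OF g nth_mem] in auto)
    then obtain c where gc: "gadget_coloring (Suc q) (blocks g) x c" "\<forall>a. c a \<le> q"
      and z: "{a. c a = 0} = (\<lambda>e. e * Suc q) ` ({..<length (tests g)} - {e0})" by blast
    have "e * Suc q < SZ" if "e < length (tests g)" for e
    proof -
      have "e * Suc q < length (tests g) * Suc q" using that by (intro mult_strict_right_mono) simp_all
      also have "\<dots> \<le> (gadget_cost q g + q) * Suc q"
        using q by (intro mult_right_mono) (auto simp: gadget_cost_def)
      also have "\<dots> \<le> SZ" by (rule fits[OF g])
      finally show ?thesis .
    qed
    then have "{a. a < SZ \<and> c a = 0} = {a. c a = 0}" using z by auto
    also have "card \<dots> = card ({..<length (tests g)} - {e0})"
      unfolding z by (rule card_image) (simp add: inj_on_def del: mult_Suc_right)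
    also have "\<dots> = gadget_cost q g" using e0(1) by (simp add: gadget_cost_def)
    finally show ?thesis using gc by blast
  qed
  then obtain c where c: "\<And>g. g \<in> set gs \<Longrightarrow> gadget_coloring (Suc q) (blocks g) x (c g) \<and> (\<forall>a. c g a \<le> q) \<and>
     card {a. a < SZ \<and> c g a = 0} = gadget_cost q g" by metis
  \<comment> \<open>The gadgets do not see each other, so their colorings can be glued along
    quotient and remainder.\<close>
  define f where "f v = (if v < H then x v else if v < H + length gs * SZ then c (gs ! ((v - H) div SZ)) ((v - H) mod SZ) else 0)" for v
  have f: "f (H + i * SZ + a) = c (gs ! i) a" if "i < length gs" "a < SZ" for i a
    using that index_less[OF that] by (simp add: f_def)
  have fx: "f v = x v" if "v < H" for v using that by (simp add: f_def)
  have "f v \<le> q" if "v < H + length gs * SZ" for v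
  proof (cases "v < H")
    case False
    then have "v - H < length gs * SZ" using that by linarith
    then have "(v - H) div SZ < length gs" by (simp add: less_mult_imp_div_less)
    then show ?thesis using c that by (simp add: f_def assms(1))
  qed (use assms(1) in \<open>simp add: f_def\<close>)
  moreover have "gadget_coloring (Suc q) (blocks (gs ! i)) f (\<lambda>a. f (H + i * SZ + a))" if i: "i < length gs" for i
  proof -
    let ?g = "gs ! i"
    have g: "?g \<in> set gs" using i by simp
    have gc: "gadget_coloring (Suc q) (blocks ?g) x (c ?g)" using c g by blast
    have idx: "f (H + i * SZ + (e * Suc q + j)) = c ?g (e * Suc q + j)" if "e < length (blocks ?g)" "j \<le> q" for e j
    proof (rule f[OF i])
      have "e * Suc q + j < Suc e * Suc q" using that by simp
      also have "\<dots> \<le> length (blocks ?g) * Suc q" using that by (intro mult_right_mono) auto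
      also have "\<dots> \<le> SZ" using fits[OF g] by (simp only: length_blocks)
      finally show "e * Suc q + j < SZ" .
    qed
    have jq: "j \<le> q" if "e < length (blocks ?g)" "j < length (blocks ?g ! e)" for e j
      using block_length[OF g that(1)] that(2) by simp
    have att: "f h = x h" if hh: "e < length (blocks ?g)" "j < length (blocks ?g ! e)" "h \<in> set (blocks ?g ! e ! j)" for e j h
    proof -
      obtain b w where bw: "(b, w) \<in> set ?g" "h \<in> {b..<b + t}" using blocks_att[OF g hh] by blast
      then show ?thesis using words[OF g bw(1)] by (intro fx) auto
    qed
    have idx0: "f (H + i * SZ + e * Suc q) = c ?g (e * Suc q)" if "e < length (blocks ?g)" for e
      using idx[OF that, of 0] by simp
    show ?thesis
      unfolding gadget_coloring_def
    proof (intro conjI allI impI ballI)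
      fix e j k assume e: "e < length (blocks ?g)" and j: "j < length (blocks ?g ! e)" and k: "k < j"
        and nz: "f (H + i * SZ + (e * Suc q + j)) \<noteq> 0"
      have "k \<le> q" using jq[OF e j] k by simp
      then show "f (H + i * SZ + (e * Suc q + j)) \<noteq> f (H + i * SZ + (e * Suc q + k))"
        using gc e j k nz idx[OF e jq[OF e j]] idx[OF e] unfolding gadget_coloring_def by simp
    next
      fix e j h assume e: "e < length (blocks ?g)" and j: "j < length (blocks ?g ! e)"
        and h: "h \<in> set (blocks ?g ! e ! j)" and nz: "f (H + i * SZ + (e * Suc q + j)) \<noteq> 0"
      then show "f (H + i * SZ + (e * Suc q + j)) \<noteq> f h"
        using gc idx[OF e jq[OF e j]] att[OF e j h] unfolding gadget_coloring_def by simp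
    next
      fix e d assume e: "e < length (blocks ?g)" and d: "d < e" and nz: "f (H + i * SZ + e * Suc q) \<noteq> 0"
      then show "f (H + i * SZ + e * Suc q) \<noteq> f (H + i * SZ + d * Suc q)"
        using gc idx0[OF e] idx0[of d] unfolding gadget_coloring_def by simp
    qed
  qed
  ultimately have "partial_coloring q G f" by (simp add: partial_coloring_iff)
  moreover have "card (deleted G f) = card {v. v < H \<and> x v = 0} + (\<Sum>i<length gs. gadget_cost q (gs ! i))"
  proof -
    have "deleted G f = {v. v < H + length gs * SZ \<and> f v = 0}" by (auto simp: deleted_def instance_graph_def)
    then have "card (deleted G f) = card {v. v < H \<and> f v = 0} + (\<Sum>i<length gs. card {a. a < SZ \<and> f (H + i * SZ + a) = 0})"
      by (simp only: card_deleted_split)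
    moreover have "{v. v < H \<and> f v = 0} = {v. v < H \<and> x v = 0}" using fx by auto
    moreover have "card {a. a < SZ \<and> f (H + i * SZ + a) = 0} = gadget_cost q (gs ! i)" if i: "i < length gs" for i
    proof -
      have "{a. a < SZ \<and> f (H + i * SZ + a) = 0} = {a. a < SZ \<and> c (gs ! i) a = 0}" using f[OF i] by auto
      then show ?thesis using c[of "gs ! i"] i by simp
    qed
    ultimately show ?thesis by simp
  qed
  ultimately show ?thesis by blast
qed

end

section \<open>Encoding assignments by color patterns\<close>

definition zeros :: "nat list \<Rightarrow> nat" where
  "zeros w = card {j. j < length w \<and> w ! j = 0}"

lemma zeros_le: "zeros w \<le> length w"
  using card_mono[of "{..<length w}" "{j. j < length w \<and> w ! j = 0}"] by (auto simp: zeros_def)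

lemma matches_self: "matches w ((!) w)"
  by (simp add: matches_def)

lemma matches_cong: "(\<And>j. j < length w \<Longrightarrow> y j = y' j) \<Longrightarrow> matches w y \<longleftrightarrow> matches w y'"
  by (simp add: matches_def)

text \<open>Comparing a position with itself shows that positions kept by \<open>w\<close> are kept
  by \<open>v\<close>.\<close>

lemma matches_zero_subset:
  assumes "matches w ((!) v)" "length v = length w"
  shows "{j. j < length v \<and> v ! j = 0} \<subseteq> {j. j < length w \<and> w ! j = 0}"
proof safe
  fix j assume j: "j < length v" "v ! j = 0"
  show "j < length w" using j assms(2) by simp
  then show "w ! j = 0" using assms(1) j unfolding matches_def by blast
qed

lemma matches_zeros_le:
  assumes "matches w ((!) v)" "length v = length w"
  shows "zeros v \<le> zeros w"
  unfolding zeros_def by (rule card_mono[OF _ matches_zero_subset[OF assms]]) simp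

lemma matches_zero_iff:
  assumes "matches w ((!) v)" "length v = length w" "zeros v = zeros w" "j < length w"
  shows "v ! j = 0 \<longleftrightarrow> w ! j = 0"
proof -
  have "{j. j < length v \<and> v ! j = 0} = {j. j < length w \<and> w ! j = 0}"
    by (rule card_subset_eq[OF _ matches_zero_subset[OF assms(1,2)]]) (use assms(3) in \<open>auto simp: zeros_def\<close>)
  then show ?thesis using assms(2,4) by auto
qed

text \<open>With equally many zeros the inclusion of the zero sets becomes an equality, and what
  remains is a symmetric comparison of equality patterns. This is what a common number of zeros
  buys.\<close>

lemma matches_sym:
  assumes "matches w ((!) v)" "length v = length w" "zeros v = zeros w"
  shows "matches v ((!) w)"
  unfolding matches_def
proof (intro allI impI)
  fix a b assume ab: "a < length v" "b < length v" "v ! a \<noteq> 0" "v ! b \<noteq> 0"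
  then have nz: "w ! a \<noteq> 0" "w ! b \<noteq> 0" using matches_zero_iff[OF assms] assms(2) by auto
  have "w ! a = w ! b \<longleftrightarrow> v ! a = v ! b" using assms(1,2) ab(1,2) nz unfolding matches_def by simp
  then show "w ! a \<noteq> 0 \<and> (v ! a = v ! b \<longleftrightarrow> w ! a = w ! b)" using nz by simp
qed

lemma length_word_blocks: "length (word_blocks q pos w) \<le> length w * length w"
  unfolding word_blocks_def length_map by (rule order_trans[OF length_filter_le]) simp

lemma ex_bits: "\<exists>a::nat. a < 2 ^ b \<and> (\<forall>r<b. odd (a div 2 ^ r) = \<beta> r)"
proof (induction b arbitrary: \<beta>)
  case (Suc b)
  from Suc[of "\<lambda>r. \<beta> (Suc r)"] obtain a :: nat where a: "a < 2 ^ b" "\<forall>r<b. odd (a div 2 ^ r) = \<beta> (Suc r)" by auto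
  let ?a = "2 * a + of_bool (\<beta> 0)"
  have "?a div 2 ^ Suc r = a div 2 ^ r" for r
  proof -
    have "?a div 2 = a" by simp
    moreover have "?a div 2 ^ Suc r = ?a div 2 div 2 ^ r" by (simp only: power_Suc div_mult2_eq)
    ultimately show ?thesis by simp
  qed
  then have "odd (?a div 2 ^ r) = \<beta> r" if "r < Suc b" for r
    using that a(2) by (cases r) auto
  moreover have "?a < 2 ^ Suc b" using a(1) by simp
  ultimately show ?case by blast
qed auto

text \<open>The values of \<open>b\<close> variables are carried by \<open>t\<close> hub vertices,
  of which \<open>z\<close> are deleted. The last assumption makes a gadget against one code word
  harmless for colorings that carry another.\<close>

locale coded_formulas =
  fixes q t z b :: nat and enc :: "nat \<Rightarrow> nat list"
  assumes q1: "1 \<le> q" and t1: "1 \<le> t" and b1: "1 \<le> b"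
    and enc: "\<And>a. a < 2 ^ b \<Longrightarrow> length (enc a) = t \<and> set (enc a) \<subseteq> {..q} \<and> zeros (enc a) = z"
    and enc_inj: "\<And>a a'. a < 2 ^ b \<Longrightarrow> a' < 2 ^ b \<Longrightarrow> matches (enc a) ((!) (enc a')) \<Longrightarrow> a = a'"
begin

text \<open>Words with more than \<open>z\<close> zeros are absent because the budget itself
  excludes them.\<close>

definition bad_words :: "nat list list" where
  "bad_words = filter (\<lambda>w. zeros w < z \<or> zeros w = z \<and> (\<forall>a<2 ^ b. \<not> matches (enc a) ((!) w)))
     (List.n_lists t [0..<Suc q])"

definition literal_words :: "nat \<Rightarrow> bool \<Rightarrow> nat list list" where
  "literal_words r s = map enc (filter (\<lambda>a. odd (a div 2 ^ r) \<noteq> s) [0..<2 ^ b])"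

text \<open>
  Violating a copy of the gadgets for bad words costs \<open>1\<close>, whereas a group of hub vertices cannot save
  more than \<open>z \<le> t\<close> deletions.
\<close>

definition group_gadgets :: "nat \<Rightarrow> (nat \<times> nat list) list list" where
  "group_gadgets g = concat (replicate (Suc t) (map (\<lambda>w. [(g * t, w)]) bad_words))"

text \<open>\<open>literal_words\<close> lists the codes that falsify one literal, so each gadget
  forbids one way of falsifying the whole clause. The empty clause yields a single gadget without
  words, which every coloring violates.\<close>

definition clause_gadgets :: "(nat \<times> bool) list \<Rightarrow> (nat \<times> nat list) list list" where
  "clause_gadgets cl =
     product_lists (map (\<lambda>(v, s). map (Pair (v div b * t)) (literal_words (v mod b) s)) cl)"

definition groups :: "nat \<Rightarrow> nat" where
  "groups n = Suc (n div b)"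

definition gadgets :: "nat \<Rightarrow> cnf \<Rightarrow> (nat \<times> nat list) list list" where
  "gadgets n \<phi> = concat (map group_gadgets [0..<groups n]) @ concat (map clause_gadgets \<phi>)"

text \<open>There is one word in a group gadget and at most \<open>k\<close> in a clause gadget, so
  \<open>Suc k\<close> covers both. Each word has at most \<open>t * t\<close> tests;
  \<open>q\<close> further blocks and \<open>Suc q\<close> numbers per block complete the
  count.\<close>

definition gadget_size :: "nat \<Rightarrow> nat" where
  "gadget_size k = (Suc k * (t * t) + q) * Suc q"

definition budget :: "nat \<Rightarrow> cnf \<Rightarrow> nat" where
  "budget n \<phi> = groups n * z + sum_list (map (gadget_cost q) (gadgets n \<phi>))"

lemma z_le: "z \<le> t"
  using enc[of 0] zeros_le[of "enc 0"] by simp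

lemma set_bad_words:
  "w \<in> set bad_words \<longleftrightarrow> length w = t \<and> set w \<subseteq> {..q} \<and>
     (zeros w < z \<or> zeros w = z \<and> (\<forall>a<2 ^ b. \<not> matches (enc a) ((!) w)))"
proof -
  have "set [0..<Suc q] = {..q}" by auto
  then show ?thesis by (auto simp: bad_words_def set_n_lists simp del: upt_Suc)
qed

lemma set_literal_words:
  "w \<in> set (literal_words r s) \<longleftrightarrow> (\<exists>a<2 ^ b. w = enc a \<and> odd (a div 2 ^ r) \<noteq> s)"
  by (auto simp: literal_words_def)

lemma in_clause_gadgets:
  "g \<in> set (clause_gadgets cl) \<longleftrightarrow>
     list_all2 (\<lambda>p (v, s). fst p = v div b * t \<and> snd p \<in> set (literal_words (v mod b) s)) g cl"
proof -
  have "(\<lambda>p x. p \<in> set (case x of (v, s) \<Rightarrow> map (Pair (v div b * t)) (literal_words (v mod b) s))) =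
     (\<lambda>p (v, s). fst p = v div b * t \<and> snd p \<in> set (literal_words (v mod b) s))"
    by (auto simp: fun_eq_iff image_iff)
  then show ?thesis by (simp add: clause_gadgets_def product_lists_set list_all2_map2)
qed

lemma gadget_words:
  assumes "k_cnf k n \<phi>" "g \<in> set (gadgets n \<phi>)" "(c, w) \<in> set g"
  shows "length w = t \<and> c + t \<le> groups n * t \<and> set w \<subseteq> {..q}"
proof -
  consider (group) i where "i < groups n" "g \<in> set (group_gadgets i)"
    | (clause) cl where "cl \<in> set \<phi>" "g \<in> set (clause_gadgets cl)"
    using assms(2) by (auto simp: gadgets_def)
  then show ?thesis
  proof cases
    case group
    then have "c = i * t" "w \<in> set bad_words" using assms(3) by (auto simp: group_gadgets_def split: if_splits)
    moreover have "i * t + t = Suc i * t" by simp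
    moreover have "Suc i * t \<le> groups n * t" using group(1) by (intro mult_right_mono) auto
    ultimately show ?thesis by (simp only: set_bad_words)
  next
    case clause
    obtain i where i: "i < length g" "g ! i = (c, w)" using assms(3) by (auto simp: in_set_conv_nth)
    obtain v s where vs: "cl ! i = (v, s)" by fastforce
    have len: "length g = length cl" using clause(2) by (auto simp: in_clause_gadgets dest: list_all2_lengthD)
    have cw: "c = v div b * t" "w \<in> set (literal_words (v mod b) s)"
      using list_all2_nthD[OF clause(2)[unfolded in_clause_gadgets] i(1)] i(2) vs by auto
    have "(v, s) \<in> set cl" using vs i(1) len by (metis nth_mem)
    then have "v < n" using assms(1) clause(1) by (auto simp: k_cnf_def)
    then have "v div b < groups n" by (simp add: groups_def div_le_mono less_Suc_eq_le)
    then have "Suc (v div b) * t \<le> groups n * t" by (intro mult_right_mono) auto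
    then have "c + t \<le> groups n * t" using cw by (simp only: mult_Suc)
    then show ?thesis using cw(2) enc by (auto simp: set_literal_words)
  qed
qed

lemma length_gadget:
  assumes "k_cnf k n \<phi>" "g \<in> set (gadgets n \<phi>)"
  shows "length g \<le> Suc k"
proof -
  consider (group) i where "g \<in> set (group_gadgets i)"
    | (clause) cl where "cl \<in> set \<phi>" "g \<in> set (clause_gadgets cl)"
    using assms(2) by (auto simp: gadgets_def)
  then show ?thesis
  proof cases
    case group
    then show ?thesis by (auto simp: group_gadgets_def split: if_splits)
  next
    case clause
    then have "length g = length cl" by (auto simp: in_clause_gadgets dest: list_all2_lengthD)
    then show ?thesis using assms(1) clause(1) by (auto simp: k_cnf_def)
  qed
qed

lemma gadget_cost_le:
  assumes "\<And>c w. (c, w) \<in> set g \<Longrightarrow> length w = t"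
  shows "gadget_cost q g \<le> length g * (t * t)"
  using assms
proof (induction g)
  case (Cons p g)
  obtain c w where p: "p = (c, w)" by fastforce
  have "length (word_blocks q ((+) c) w) \<le> t * t" using length_word_blocks[of q "(+) c" w] Cons.prems p by auto
  moreover have "gadget_cost q g \<le> length g * (t * t)" using Cons.prems by (intro Cons.IH) auto
  ultimately show ?case by (simp add: gadget_cost_def gadget_tests_def shifted_def p)
qed (simp add: gadget_cost_def gadget_tests_def shifted_def)

section \<open>Satisfying assignments and colorings within the budget\<close>

lemma gadget_instance:
  assumes "k_cnf k n \<phi>"
  shows "gadget_instance q t (groups n * t) (gadget_size k) (gadgets n \<phi>)"
proof
  show "1 \<le> gadget_size k" using q1 by (simp add: gadget_size_def)
  fix g assume g: "g \<in> set (gadgets n \<phi>)"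
  have "gadget_cost q g \<le> length g * (t * t)" using gadget_words[OF assms g] by (intro gadget_cost_le) blast
  also have "\<dots> \<le> Suc k * (t * t)" using length_gadget[OF assms g] by (rule mult_right_mono) simp
  finally show "(gadget_cost q g + q) * Suc q \<le> gadget_size k"
    unfolding gadget_size_def by (intro mult_right_mono add_right_mono) auto
  fix c w assume "(c, w) \<in> set g"
  from gadget_words[OF assms g this] show "length w = t \<and> c + t \<le> groups n * t \<and> (\<forall>a<t. w ! a \<le> q)"
    using nth_mem[of _ w] by blast
qed (fact q1)

lemma sum_list_concat: "sum_list (map f (concat xss)) = sum_list (map (\<lambda>xs. sum_list (map f xs)) xss)"
  for f :: "'x \<Rightarrow> nat"
  by (induction xss) auto

text \<open>Each group takes the code of its part of the assignment. No gadget is then violated,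
  which leaves \<open>z\<close> deletions per group and the unavoidable ones.\<close>

lemma satisfiable_imp_coloring:
  assumes "k_cnf k n \<phi>" "satisfiable \<phi>"
  shows "\<exists>f. partial_coloring q (instance_graph q (groups n * t) (gadget_size k) (gadgets n \<phi>)) f \<and>
     card (deleted (instance_graph q (groups n * t) (gadget_size k) (gadgets n \<phi>)) f) = budget n \<phi>"
proof -
  interpret gi: gadget_instance q t "groups n * t" "gadget_size k" "gadgets n \<phi>"
    by (rule gadget_instance) fact
  obtain \<alpha> where \<alpha>: "\<forall>cl\<in>set \<phi>. \<exists>(v, s)\<in>set cl. \<alpha> v = s" using assms(2) by (auto simp: satisfiable_def)
  have "\<forall>g. \<exists>a::nat. a < 2 ^ b \<and> (\<forall>r<b. odd (a div 2 ^ r) = \<alpha> (g * b + r))"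
    by (intro allI ex_bits)
  then obtain a :: "nat \<Rightarrow> nat" where a: "\<And>g. a g < 2 ^ b \<and> (\<forall>r<b. odd (a g div 2 ^ r) = \<alpha> (g * b + r))"
    by metis
  have bit: "odd (a (v div b) div 2 ^ (v mod b)) = \<alpha> v" for v
    using a[of "v div b"] b1 by simp
  define x where "x v = enc (a (v div t)) ! (v mod t)" for v
  have x: "x (g * t + j) = enc (a g) ! j" if "j < t" for g j using that by (simp add: x_def)
  have match: "matches w (\<lambda>j. x (g * t + j)) \<longleftrightarrow> matches w ((!) (enc (a g)))" if "length w = t" for g w
    using that by (intro matches_cong) (simp add: x)
  have "x v \<le> q" for v
  proof -
    have "v mod t < length (enc (a (v div t)))" using enc[of "a (v div t)"] a t1 by simp
    then show ?thesis using enc[of "a (v div t)"] a nth_mem unfolding x_def by blast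
  qed
  moreover have "\<not> violated x g" if g: "g \<in> set (gadgets n \<phi>)" for g
  proof
    assume viol: "violated x g"
    consider (group) i w where "w \<in> set bad_words" "g = [(i * t, w)]"
      | (clause) cl where "cl \<in> set \<phi>" "g \<in> set (clause_gadgets cl)"
      using g by (auto simp: gadgets_def group_gadgets_def split: if_splits)
    then show False
    proof cases
      case group
      have w: "length w = t" using group(1) by (simp add: set_bad_words)
      have m: "matches w ((!) (enc (a i)))" using viol group(2) match[OF w] by (simp add: violated_def)
      have e: "length (enc (a i)) = t" "zeros (enc (a i)) = z" using enc a by auto
      \<comment> \<open>A bad word matched by a code word cannot have fewer zeros. With equally
        many, the match can be reversed, so the word would not be bad.\<close>
      have "z \<le> zeros w" using matches_zeros_le[OF m] e w by simp
      moreover have "matches (enc (a i)) ((!) w)" if "zeros w = z"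
        using matches_sym[OF m] e w that by simp
      ultimately show False using group(1) a by (auto simp: set_bad_words)
    next
      case clause
      obtain v s where vs: "(v, s) \<in> set cl" "\<alpha> v = s" using \<alpha> clause(1) by blast
      obtain i where i: "i < length cl" "cl ! i = (v, s)" using vs(1) by (auto simp: in_set_conv_nth)
      have len: "length g = length cl" using clause(2) by (auto simp: in_clause_gadgets dest: list_all2_lengthD)
      obtain c w where cw: "g ! i = (c, w)" by fastforce
      have "c = v div b * t" "w \<in> set (literal_words (v mod b) s)"
        using list_all2_nthD2[OF clause(2)[unfolded in_clause_gadgets] i(1)] i(2) cw by auto
      then obtain d where d: "d < 2 ^ b" "w = enc d" "odd (d div 2 ^ (v mod b)) \<noteq> s" "c = v div b * t"
        by (auto simp: set_literal_words)
      have "(c, w) \<in> set g" using cw i(1) len by (metis nth_mem)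
      then have "matches w (\<lambda>j. x (c + j))" using viol by (auto simp: violated_def)
      then have "matches (enc d) ((!) (enc (a (v div b))))" using match[of w] enc[OF d(1)] d by simp
      \<comment> \<open>A code word matches no other code word, but the bit of \<open>d\<close>
        falsifies a literal that the assignment satisfies.\<close>
      then have "d = a (v div b)" using enc_inj d(1) a by blast
      then show False using bit[of v] d(3) vs(2) by simp
    qed
  qed
  ultimately obtain f where f: "partial_coloring q gi.G f"
    "card (deleted gi.G f) = card {v. v < groups n * t \<and> x v = 0} + (\<Sum>i<length (gadgets n \<phi>). gadget_cost q (gadgets n \<phi> ! i))"
    using gi.ex_partial_coloring[of x] by blast
  have split: "card {v. v < 0 + groups n * t \<and> x v = 0} = card {v. v < (0::nat) \<and> x v = 0} +
     (\<Sum>i<groups n. card {j. j < t \<and> x (0 + i * t + j) = 0})" by (rule card_deleted_split)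
  have zi: "card {j. j < t \<and> x (0 + i * t + j) = 0} = z" for i
  proof -
    have eq: "{j. j < t \<and> x (0 + i * t + j) = 0} = {j. j < length (enc (a i)) \<and> enc (a i) ! j = 0}"
      using enc[of "a i"] a x by auto
    have "zeros (enc (a i)) = z" using enc[of "a i"] a by blast
    then show ?thesis unfolding eq zeros_def .
  qed
  have "card {v. v < groups n * t \<and> x v = 0} = groups n * z" using split unfolding zi by simp
  moreover have "(\<Sum>i<length (gadgets n \<phi>). gadget_cost q (gadgets n \<phi> ! i)) = sum_list (map (gadget_cost q) (gadgets n \<phi>))"
    by (simp add: sum_list_sum_nth atLeast0LessThan)
  ultimately show ?thesis using f by (auto simp: budget_def)
qed

text \<open>Every group accounts for at least \<open>z\<close>, in hub deletions plus violated
  copies, and the budget allows no more than \<open>z\<close> per group beyond the unavoidable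
  deletions. Equality throughout means that every group carries a code word up to renaming and no
  clause gadget is violated.\<close>

lemma coloring_imp_satisfiable:
  assumes "k_cnf k n \<phi>"
    "partial_coloring q (instance_graph q (groups n * t) (gadget_size k) (gadgets n \<phi>)) f"
    "card (deleted (instance_graph q (groups n * t) (gadget_size k) (gadgets n \<phi>)) f) \<le> budget n \<phi>"
  shows "satisfiable \<phi>"
proof -
  interpret gi: gadget_instance q t "groups n * t" "gadget_size k" "gadgets n \<phi>"
    by (rule gadget_instance) fact
  define V :: "(nat \<times> nat list) list list \<Rightarrow> nat"
    where "V gs = sum_list (map (\<lambda>g. of_bool (violated f g)) gs)" for gs
  have V_concat: "V (concat gss) = sum_list (map V gss)" for gss
    unfolding V_def by (rule sum_list_concat)
  define ze where "ze g = card {j. j < t \<and> f (0 + g * t + j) = 0}" for g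
  define word where "word g = map (\<lambda>j. f (g * t + j)) [0..<t]" for g
  have word: "length (word g) = t" "zeros (word g) = ze g" for g
  proof -
    show "length (word g) = t" by (simp add: word_def)
    have "{j. j < t \<and> word g ! j = 0} = {j. j < t \<and> f (0 + g * t + j) = 0}" by (auto simp: word_def)
    then show "zeros (word g) = ze g" by (simp add: zeros_def ze_def word_def)
  qed
  have match: "matches w (\<lambda>j. f (g * t + j)) \<longleftrightarrow> matches w ((!) (word g))" if "length w = t" for g w
    using that by (intro matches_cong) (simp add: word_def)
  have f_le: "f v \<le> q" if "v < groups n * t" for v
    using assms(2) that by (auto simp: partial_coloring_def instance_graph_def)
  have word_le: "set (word g) \<subseteq> {..q}" if "g < groups n" for g
  proof -
    have "g * t + j < groups n * t" if "j < t" for j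
    proof -
      have "g * t + j < Suc g * t" using that by simp
      also have "\<dots> \<le> groups n * t" using \<open>g < groups n\<close> by (intro mult_right_mono) auto
      finally show ?thesis .
    qed
    then show ?thesis using f_le by (auto simp: word_def)
  qed
  have "card {v. v < 0 + groups n * t \<and> f v = 0} = card {v. v < (0::nat) \<and> f v = 0} + (\<Sum>g<groups n. ze g)"
    unfolding ze_def by (rule card_deleted_split)
  then have hubz: "card {v. v < groups n * t \<and> f v = 0} = (\<Sum>g<groups n. ze g)" by simp
  have "(\<Sum>i<length (gadgets n \<phi>). gadget_cost q (gadgets n \<phi> ! i) + of_bool (violated f (gadgets n \<phi> ! i)))
     = sum_list (map (gadget_cost q) (gadgets n \<phi>)) + V (gadgets n \<phi>)"
    by (simp add: V_def sum_list_sum_nth atLeast0LessThan sum.distrib)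
  then have le: "(\<Sum>g<groups n. ze g) + V (gadgets n \<phi>) \<le> groups n * z"
    using gi.card_deleted_ge[OF assms(2)] assms(3) hubz by (simp add: budget_def)
  have V_eq: "V (gadgets n \<phi>) = (\<Sum>g<groups n. V (group_gadgets g)) + sum_list (map V (map clause_gadgets \<phi>))"
  proof -
    have "V (gadgets n \<phi>) = V (concat (map group_gadgets [0..<groups n])) + V (concat (map clause_gadgets \<phi>))"
      by (simp add: gadgets_def V_def)
    also have "V (concat (map group_gadgets [0..<groups n])) = (\<Sum>g<groups n. V (group_gadgets g))"
      unfolding V_concat by (simp add: sum_list_distinct_conv_sum_set atLeast0LessThan comp_def)
    finally show ?thesis unfolding V_concat .
  qed
  have group: "z < ze g + V (group_gadgets g) \<or> (ze g + V (group_gadgets g) = z \<and> (\<exists>a<2 ^ b. matches (enc a) ((!) (word g))))"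
    if g: "g < groups n" for g
  proof (cases "word g \<in> set bad_words")
    case True
    have "violated f [(g * t, word g)]"
      using match[OF word(1)] matches_self by (simp add: violated_def)
    then have "1 \<le> V (map (\<lambda>w. [(g * t, w)]) bad_words)"
      unfolding V_def using True member_le_sum_list[of 1 "map (\<lambda>g. of_bool (violated f g)) (map (\<lambda>w. [(g * t, w)]) bad_words)"]
      by (simp add: image_iff) force
    \<comment> \<open>All \<open>t + 1\<close> copies are violated at once, more than the at most
      \<open>z \<le> t\<close> deletions that the group could save.\<close>
    then have "Suc t * 1 \<le> Suc t * V (map (\<lambda>w. [(g * t, w)]) bad_words)" by (rule mult_left_mono) simp
    also have "\<dots> = V (group_gadgets g)"
      unfolding group_gadgets_def V_concat by (simp add: sum_list_replicate)
    finally show ?thesis using z_le by simp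
  next
    case False
    then have "z \<le> ze g" "ze g = z \<Longrightarrow> \<exists>a<2 ^ b. matches (enc a) ((!) (word g))"
      using word[of g] word_le[OF g] unfolding set_bad_words by auto
    then show ?thesis by (metis le_add1 le_antisym le_neq_implies_less order.trans)
  qed
  have "(\<Sum>g<groups n. z) \<le> (\<Sum>g<groups n. ze g + V (group_gadgets g))"
    using group by (intro sum_mono) force
  moreover have "(\<Sum>g<groups n. ze g + V (group_gadgets g)) + sum_list (map V (map clause_gadgets \<phi>)) \<le> (\<Sum>g<groups n. z)"
    using le V_eq by (simp add: sum.distrib)
  \<comment> \<open>Two opposite inequalities squeeze the sums: no group exceeds \<open>z\<close>,
    and the clause gadgets contribute nothing.\<close>
  ultimately have eq: "(\<Sum>g<groups n. ze g + V (group_gadgets g)) = (\<Sum>g<groups n. z)"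
    and cl0: "sum_list (map V (map clause_gadgets \<phi>)) = 0" by linarith+
  have "\<exists>a<2 ^ b. matches (enc a) ((!) (word g))" if g: "g < groups n" for g
  proof (rule ccontr)
    assume no: "\<not> ?thesis"
    then have "z < ze g + V (group_gadgets g)" using group[OF g] by blast
    then have "(\<Sum>g<groups n. z) < (\<Sum>g<groups n. ze g + V (group_gadgets g))"
      using group g by (intro sum_strict_mono_ex1) (auto, force)
    then show False using eq by simp
  qed
  then obtain a where a: "\<And>g. g < groups n \<Longrightarrow> a g < 2 ^ b \<and> matches (enc (a g)) ((!) (word g))" by metis
  define \<alpha> where "\<alpha> v = odd (a (v div b) div 2 ^ (v mod b))" for v
  have "\<exists>(v, s)\<in>set cl. \<alpha> v = s" if cl: "cl \<in> set \<phi>" for cl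
  proof (rule ccontr)
    assume no: "\<not> ?thesis"
    have vn: "v < n" if "(v, s) \<in> set cl" for v s using assms(1) cl that by (auto simp: k_cnf_def)
    then have vg: "v div b < groups n" if "(v, s) \<in> set cl" for v s
      using that by (metis groups_def div_le_mono less_Suc_eq_le less_imp_le_nat)
    \<comment> \<open>If all literals of the clause fail, the codes carried by their groups form one
      of the forbidden combinations.\<close>
    define g where "g = map (\<lambda>(v, s). (v div b * t, enc (a (v div b)))) cl"
    have "g \<in> set (clause_gadgets cl)"
      unfolding in_clause_gadgets g_def list_all2_map1 list_all2_same
    proof (intro ballI)
      fix p assume p: "p \<in> set cl"
      obtain v s where vs: "p = (v, s)" by fastforce
      have "odd (a (v div b) div 2 ^ (v mod b)) \<noteq> s" using no p vs by (auto simp: \<alpha>_def)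
      then show "case p of (v, s) \<Rightarrow> fst ((\<lambda>(v, s). (v div b * t, enc (a (v div b)))) p) = v div b * t \<and>
         snd ((\<lambda>(v, s). (v div b * t, enc (a (v div b)))) p) \<in> set (literal_words (v mod b) s)"
        using a[OF vg[of v s]] p vs by (auto simp: set_literal_words)
    qed
    moreover have "violated f g"
      unfolding violated_def
    proof safe
      fix c w assume "(c, w) \<in> set g"
      then obtain v s where vs: "(v, s) \<in> set cl" "c = v div b * t" "w = enc (a (v div b))" by (auto simp: g_def)
      then show "matches w (\<lambda>j. f (c + j))" using match[of w "v div b"] a[OF vg[OF vs(1)]] enc by auto
    qed
    ultimately have "V (clause_gadgets cl) \<noteq> 0" unfolding V_def by auto
    then show False using cl0 cl by auto
  qed
  then show ?thesis by (auto simp: satisfiable_def)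
qed

end

section \<open>The reduction as a program\<close>

abbreviation (input) "yZERO \<equiv> 2 :: nat"
abbreviation (input) "yONE \<equiv> 3 :: nat"
abbreviation (input) "yN \<equiv> 4 :: nat"
abbreviation (input) "yM \<equiv> 5 :: nat"
abbreviation (input) "yT \<equiv> 6 :: nat"
abbreviation (input) "yR \<equiv> 7 :: nat"
abbreviation (input) "yGB \<equiv> 8 :: nat"
abbreviation (input) "yIDX \<equiv> 9 :: nat"
abbreviation (input) "yG \<equiv> 10 :: nat"
abbreviation (input) "yH \<equiv> 11 :: nat"
abbreviation (input) "yNUM \<equiv> 12 :: nat"
abbreviation (input) "yE \<equiv> 13 :: nat"
abbreviation (input) "yBUD \<equiv> 14 :: nat"
abbreviation (input) "yPTR \<equiv> 15 :: nat"
abbreviation (input) "yREM \<equiv> 16 :: nat"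
abbreviation (input) "yLIT \<equiv> 17 :: nat"
abbreviation (input) "yCODE \<equiv> 18 :: nat"
abbreviation (input) "yA \<equiv> 19 :: nat"
abbreviation (input) "yB \<equiv> 20 :: nat"
abbreviation (input) "yC \<equiv> 21 :: nat"
abbreviation (input) "yI \<equiv> 24 :: nat"
text \<open>The offsets of the groups to which the literals of the current clause belong. While
  group gadgets are emitted, \<open>yBASE 0\<close> holds the offset of the current group.\<close>

abbreviation (input) "yBASE i \<equiv> 40 + i :: nat"
abbreviation (input) "bGB \<equiv> 2 :: nat"
abbreviation (input) "bCODE \<equiv> 3 :: nat"
abbreviation (input) "bEU \<equiv> 4 :: nat"
abbreviation (input) "bEV \<equiv> 5 :: nat"
abbreviation (input) "bROW \<equiv> 6 :: nat"

text \<open>Loop-free code that writes to the edge lists only. The large generated program texts are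
  handled through these properties instead of being unfolded.\<close>

definition straight :: "nat set \<Rightarrow> lprog \<Rightarrow> bool" where
  "straight X P \<longleftrightarrow> lwf P \<and> count_regs P = {} \<and> wregs P \<subseteq> X \<and> warrs P \<subseteq> {bEU, bEV}"

lemma straight_Seq: "straight X P \<Longrightarrow> straight X P' \<Longrightarrow> straight X (P ;; P')"
  and straight_If: "straight X P \<Longrightarrow> straight X P' \<Longrightarrow> straight X (LIf r P P')"
  and straight_mono: "straight X P \<Longrightarrow> X \<subseteq> Y \<Longrightarrow> straight Y P"
  by (auto simp: straight_def)

text \<open>The pair \<open>(r, o)\<close> denotes the vertex whose number is the content of register \<open>r\<close> plus \<open>o\<close>.\<close>

definition emit_edge :: "(nat \<times> nat) \<times> (nat \<times> nat) \<Rightarrow> lprog" where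
  "emit_edge e = LConst yC (snd (fst e)) ;; LAdd yA (fst (fst e)) yC ;; LStore bEU yE yA ;;
     LConst yC (snd (snd e)) ;; LAdd yA (fst (snd e)) yC ;; LStore bEV yE yA ;; LAdd yE yE yONE"

definition sequence :: "lprog list \<Rightarrow> lprog" where
  "sequence Ps = foldr (;;) Ps LSkip"

lemma lsem_sequence_Nil [simp]: "lsem (sequence []) s = s"
  and lsem_sequence_Cons [simp]: "lsem (sequence (P # Ps)) s = lsem (sequence Ps) (lsem P s)"
  by (simp_all add: sequence_def)

lemma straight_sequence: "(\<And>P. P \<in> set Ps \<Longrightarrow> straight X P) \<Longrightarrow> straight X (sequence Ps)"
  by (induction Ps) (auto simp: sequence_def straight_def)

definition eval_vertex :: "ram_state \<Rightarrow> nat \<times> nat \<Rightarrow> nat" where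
  "eval_vertex s v = regs s (fst v) + snd v"

definition holds_edges :: "ram_state \<Rightarrow> (nat \<times> nat) list \<Rightarrow> bool" where
  "holds_edges s es \<longleftrightarrow> regs s yE = length es \<and>
     (\<forall>i<length es. arrs s bEU i = fst (es ! i) \<and> arrs s bEV i = snd (es ! i))"

lemma emit_edges_spec:
  assumes "holds_edges s es" "regs s yONE = 1"
    "\<And>e. e \<in> set fs \<Longrightarrow> fst (fst e) \<notin> {yA, yC, yE} \<and> fst (snd e) \<notin> {yA, yC, yE}"
  shows "holds_edges (lsem (sequence (map emit_edge fs)) s) (es @ map (map_prod (eval_vertex s) (eval_vertex s)) fs)"
  using assms
proof (induction fs arbitrary: s es)
  case (Cons f fs)
  let ?s = "lsem (emit_edge f) s"
  have r: "fst (fst f) \<notin> {yA, yC, yE}" "fst (snd f) \<notin> {yA, yC, yE}" using Cons.prems(3)[of f] by auto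
  have h: "holds_edges ?s (es @ [map_prod (eval_vertex s) (eval_vertex s) f])"
    using Cons.prems(1,2) r by (cases f) (auto simp: holds_edges_def emit_edge_def eval_vertex_def nth_append less_Suc_eq)
  have regs: "regs ?s r = regs s r" if "r \<notin> {yA, yC, yE}" for r using that by (simp add: emit_edge_def)
  have "map_prod (eval_vertex ?s) (eval_vertex ?s) e = map_prod (eval_vertex s) (eval_vertex s) e" if "e \<in> set fs" for e
    using Cons.prems(3)[of e] that by (cases e) (auto simp: eval_vertex_def regs)
  then have eq: "map (map_prod (eval_vertex ?s) (eval_vertex ?s)) fs = map (map_prod (eval_vertex s) (eval_vertex s)) fs" by simp
  have "holds_edges (lsem (sequence (map emit_edge fs)) ?s)
     ((es @ [map_prod (eval_vertex s) (eval_vertex s) f]) @ map (map_prod (eval_vertex ?s) (eval_vertex ?s)) fs)"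
    using h Cons.prems regs[of yONE] by (intro Cons.IH) auto
  then show ?case unfolding eq by simp
qed simp

section \<open>Gadgets under renaming of their vertices\<close>

lemma map_gadget_edges:
  "map (map_prod h h) (gadget_edges lv S blks) = gadget_edges (\<lambda>a. h (lv a)) S (map (map (map h)) blks)"
proof -
  have nth: "map (map (map h)) blks ! e = map (map h) (blks ! e)" if "e \<in> set [0..<length blks]" for e
    using that by simp
  show ?thesis
    unfolding gadget_edges_def map_append map_concat map_map comp_def length_map
    by (intro arg_cong2[where f = append] arg_cong[where f = concat] map_cong refl) (auto simp: nth)
qed

lemma map_test_block: "map (map h) (test_block q pos w a b) = test_block q (\<lambda>j. h (pos j)) w a b"
  by (simp add: test_block_def same_block_def diff_block_def)

lemma map_gadget_tests:
  "map (map (map h)) (gadget_tests q ws) = gadget_tests q (map (\<lambda>(pos, w). (\<lambda>j. h (pos j), w)) ws)"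
  by (simp add: gadget_tests_def word_blocks_def map_concat comp_def case_prod_unfold map_test_block)

lemma map_gadget_blocks:
  "map (map (map h)) (gadget_blocks q ws) = gadget_blocks q (map (\<lambda>(pos, w). (\<lambda>j. h (pos j), w)) ws)"
  by (simp add: gadget_blocks_def map_gadget_tests const_block_def)

text \<open>Gadgets are built when the program is generated, over pairs of a register and an offset.
  Since the construction commutes with renaming of vertices, evaluating the pairs at run time yields
  the actual gadget.\<close>

definition symbolic :: "(nat \<times> nat list) list \<Rightarrow> ((nat \<Rightarrow> nat \<times> nat) \<times> nat list) list" where
  "symbolic ws = map (\<lambda>(r, w). (Pair r, w)) ws"

definition symbolic_edges :: "nat \<Rightarrow> (nat \<times> nat list) list \<Rightarrow> ((nat \<times> nat) \<times> (nat \<times> nat)) list" where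
  "symbolic_edges q ws = gadget_edges (Pair yNUM) (Suc q) (gadget_blocks q (symbolic ws))"

definition eval_gadget :: "ram_state \<Rightarrow> (nat \<times> nat list) list \<Rightarrow> (nat \<times> nat list) list" where
  "eval_gadget s ws = map (\<lambda>(r, w). (regs s r, w)) ws"

lemma symbolic_edges_eval:
  "map (map_prod (eval_vertex s) (eval_vertex s)) (symbolic_edges q ws) = placed_edges q (regs s yNUM) (eval_gadget s ws)"
proof -
  have "map (\<lambda>(pos, w). (\<lambda>j. eval_vertex s (pos j), w)) (symbolic ws) = shifted (eval_gadget s ws)"
    by (auto simp: symbolic_def shifted_def eval_gadget_def eval_vertex_def)
  then show ?thesis
    by (simp add: symbolic_edges_def placed_edges_def map_gadget_edges map_gadget_blocks eval_vertex_def)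
qed

lemma symbolic_cost: "length (gadget_tests q (symbolic ws)) = gadget_cost q (eval_gadget s ws)"
proof -
  have "length (gadget_tests q (map (\<lambda>(pos, w). (\<lambda>j. h (pos j), w)) (symbolic ws))) = length (gadget_tests q (symbolic ws))"
    for h :: "nat \<times> nat \<Rightarrow> nat" unfolding map_gadget_tests[symmetric] by simp
  from this[of "eval_vertex s"] show ?thesis
    by (simp add: gadget_cost_def shifted_def symbolic_def eval_gadget_def eval_vertex_def comp_def case_prod_beta)
qed

lemma gadget_blocks_att:
  assumes "e < length (gadget_blocks q ws)" "j < length (gadget_blocks q ws ! e)" "h \<in> set (gadget_blocks q ws ! e ! j)"
  shows "\<exists>(pos, w)\<in>set ws. \<exists>a. h = pos a"
proof -
  let ?blk = "gadget_blocks q ws ! e"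
  have "?blk \<in> set (gadget_blocks q ws)" using assms(1) by simp
  then consider "?blk = const_block q" | "?blk = [[]]" | pos w where "(pos, w) \<in> set ws" "?blk \<in> set (word_blocks q pos w)"
    by (auto simp: gadget_blocks_def gadget_tests_def split: if_splits)
  then show ?thesis
  proof cases
    case 1
    then have "set (?blk ! j) = {}" using assms(2) by (simp add: const_block_def del: replicate_Suc)
    then show ?thesis using assms(3) by simp
  next
    case 2
    then show ?thesis using assms(2,3) by simp
  next
    case 3
    then show ?thesis using word_blocks_att[OF 3(2) assms(2,3)] by blast
  qed
qed

text \<open>Controls on which registers the symbolic vertices depend, so that emitting one edge does
  not change the meaning of the next.\<close>

lemma symbolic_edges_regs:
  assumes "e \<in> set (symbolic_edges q ws)"
  shows "fst (fst e) = yNUM \<and> (fst (snd e) = yNUM \<or> fst (snd e) \<in> fst ` set ws)"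
proof -
  let ?B = "gadget_blocks q (symbolic ws)"
  consider (a) a a' where "e = ((yNUM, a), (yNUM, a'))"
    | (b) a i j h where "e = ((yNUM, a), h)" "i < length ?B" "j < length (?B ! i)" "h \<in> set (?B ! i ! j)"
    using assms unfolding symbolic_edges_def set_gadget_edges by blast
  then show ?thesis
  proof cases
    case b
    then obtain pos w c where "(pos, w) \<in> set (symbolic ws)" "h = pos c" using gadget_blocks_att[OF b(2-4)] by blast
    then show ?thesis using b(1) by (force simp: symbolic_def)
  qed simp
qed

lemma map_product_lists: "map (map h) (product_lists xss) = product_lists (map (map h) xss)"
proof (induction xss)
  case (Cons xs xss)
  show ?case by (simp add: map_concat comp_def Cons.IH[symmetric])
qed simp

text \<open>Program text cannot be indexed by data, so the case is selected by counting
  \<open>yCODE\<close> down to \<open>0\<close>.\<close>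

primrec switch :: "nat \<Rightarrow> nat \<Rightarrow> (nat \<Rightarrow> lprog) \<Rightarrow> lprog" where
  "switch 0 j P = LSkip"
| "switch (Suc m) j P = LIf yCODE (LSub yCODE yCODE yONE ;; switch m (Suc j) P) (P j)"

lemma lsem_switch:
  "regs s yCODE = c \<Longrightarrow> c < m \<Longrightarrow> regs s yONE = 1 \<Longrightarrow>
     lsem (switch m j P) s = lsem (P (j + c)) (set_reg yCODE 0 s)"
proof (induction m arbitrary: j c s)
  case (Suc m)
  show ?case
  proof (cases c)
    case 0
    then have "set_reg yCODE 0 s = s" using Suc.prems(1) by (simp add: set_reg_def fun_upd_idem)
    then show ?thesis using 0 Suc.prems by simp
  next
    case (Suc d)
    let ?s = "set_reg yCODE d s"
    have "lsem (switch m (Suc j) P) ?s = lsem (P (Suc j + d)) (set_reg yCODE 0 ?s)"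
      using Suc Suc.prems by (intro Suc.IH) auto
    moreover have "set_reg yCODE 0 ?s = set_reg yCODE 0 s" by (simp add: set_reg_def)
    ultimately show ?thesis using Suc Suc.prems by simp
  qed
qed simp

lemma straight_switch:
  "(\<And>c. straight X (P c)) \<Longrightarrow> yCODE \<in> X \<Longrightarrow> straight X (switch m j P)"
  by (induction m arbitrary: j) (auto simp: straight_def)

locale reduction = coded_formulas +
  fixes k :: nat
begin

definition "SZ = gadget_size k"

definition emit_gadget :: "(nat \<times> nat list) list \<Rightarrow> lprog" where
  "emit_gadget ws = sequence (map emit_edge (symbolic_edges q ws)) ;;
     LConst yC SZ ;; LAdd yNUM yNUM yC ;;
     LConst yC (length (gadget_tests q (symbolic ws))) ;; LAdd yBUD yBUD yC"

abbreviation (input) "emit_regs \<equiv> {yA, yC, yE, yNUM, yBUD}"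

lemma straight_emit_edge: "straight emit_regs (emit_edge e)"
  by (auto simp: straight_def emit_edge_def)

lemma straight_emit_gadget: "straight emit_regs (emit_gadget ws)"
proof -
  have "straight emit_regs (sequence (map emit_edge (symbolic_edges q ws)))"
    by (rule straight_sequence) (auto intro: straight_emit_edge)
  then show ?thesis unfolding emit_gadget_def
    by (intro straight_Seq) (auto simp: straight_def)
qed

text \<open>\<open>h\<close> is the number of hub vertices and \<open>d\<close> the share of the
  budget for the groups so far. As \<open>yNUM\<close> is always the next free vertex number,
  gadgets can be emitted one after another.\<close>

definition holds_gadgets :: "ram_state \<Rightarrow> nat \<Rightarrow> nat \<Rightarrow> (nat \<times> nat list) list list \<Rightarrow> bool" where
  "holds_gadgets s h d gs \<longleftrightarrow> holds_edges s (all_edges q h SZ gs) \<and> regs s yNUM = h + length gs * SZ \<and>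
     regs s yBUD = d + sum_list (map (gadget_cost q) gs)"

lemma emit_gadget_spec:
  assumes "holds_gadgets s h d gs" "regs s yONE = 1" "fst ` set ws \<inter> emit_regs = {}"
  shows "holds_gadgets (lsem (emit_gadget ws) s) h d (gs @ [eval_gadget s ws])"
proof -
  define s1 where "s1 = lsem (sequence (map emit_edge (symbolic_edges q ws))) s"
  have w1: "straight {yA, yC, yE} (sequence (map emit_edge (symbolic_edges q ws)))"
    by (rule straight_sequence) (auto simp: straight_def emit_edge_def)
  have fr: "regs s1 r = regs s r" if "r \<notin> {yA, yC, yE}" for r
    unfolding s1_def using w1 that by (intro lsem_frame_regs) (auto simp: straight_def)
  have h1: "holds_edges s1 (all_edges q h SZ gs @ placed_edges q (regs s yNUM) (eval_gadget s ws))"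
    unfolding s1_def symbolic_edges_eval[symmetric]
  proof (rule emit_edges_spec)
    fix e assume "e \<in> set (symbolic_edges q ws)"
    note regs = symbolic_edges_regs[OF this]
    have "fst (snd e) \<notin> {yA, yC, yE}"
    proof (cases "fst (snd e) = yNUM")
      case False
      then have "fst (snd e) \<in> fst ` set ws" using regs by blast
      then show ?thesis using assms(3) by blast
    qed simp
    then show "fst (fst e) \<notin> {yA, yC, yE} \<and> fst (snd e) \<notin> {yA, yC, yE}" using regs by simp
  qed (use assms in \<open>auto simp: holds_gadgets_def\<close>)
  have num: "regs s yNUM = h + length gs * SZ" using assms(1) by (simp add: holds_gadgets_def)
  have "lsem (emit_gadget ws) s = lsem (LConst yC SZ ;; LAdd yNUM yNUM yC ;;
     LConst yC (gadget_cost q (eval_gadget s ws)) ;; LAdd yBUD yBUD yC) s1"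
    by (simp add: emit_gadget_def s1_def symbolic_cost[of q ws s])
  moreover have "holds_edges s1 (all_edges q h SZ (gs @ [eval_gadget s ws]))"
    using h1 unfolding all_edges_snoc num .
  ultimately show ?thesis
    using assms(1) fr[of yNUM] fr[of yBUD] by (simp add: holds_gadgets_def holds_edges_def)
qed

definition emit_gadgets :: "(nat \<times> nat list) list list \<Rightarrow> lprog" where
  "emit_gadgets wss = sequence (map emit_gadget wss)"

lemma straight_emit_gadgets: "straight emit_regs (emit_gadgets wss)"
  unfolding emit_gadgets_def by (rule straight_sequence) (auto intro: straight_emit_gadget)

lemma emit_gadgets_spec:
  assumes "holds_gadgets s h d gs" "regs s yONE = 1" "\<And>ws. ws \<in> set wss \<Longrightarrow> fst ` set ws \<inter> emit_regs = {}"
  shows "holds_gadgets (lsem (emit_gadgets wss) s) h d (gs @ map (eval_gadget s) wss)"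
  using assms
proof (induction wss arbitrary: s gs)
  case (Cons ws wss)
  let ?s = "lsem (emit_gadget ws) s"
  have fr: "regs ?s r = regs s r" if "r \<notin> emit_regs" for r
    using straight_emit_gadget[of ws] that by (intro lsem_frame_regs) (auto simp: straight_def)
  have "eval_gadget ?s vs = eval_gadget s vs" if "vs \<in> set wss" for vs
    unfolding eval_gadget_def using Cons.prems(3)[of vs] that fr by (intro map_cong refl) force
  then have eq: "map (eval_gadget ?s) wss = map (eval_gadget s) wss" by simp
  have "holds_gadgets (lsem (emit_gadgets wss) ?s) h d ((gs @ [eval_gadget s ws]) @ map (eval_gadget ?s) wss)"
    using Cons.prems fr[of yONE] by (intro Cons.IH emit_gadget_spec) auto
  then show ?case unfolding eq by (simp add: emit_gadgets_def)
qed (simp add: emit_gadgets_def)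

text \<open>The shape of the gadgets of a clause depends only on the codes of its literals, each one
  of \<open>2 * b\<close> values; the offsets of the groups are left to registers.\<close>

definition clause_pattern :: "nat list \<Rightarrow> (nat \<times> nat list) list list" where
  "clause_pattern cs = product_lists
     (map (\<lambda>i. map (Pair (yBASE i)) (literal_words (cs ! i div 2) (odd (cs ! i)))) [0..<length cs])"

text \<open>A decision tree: codes read at run time become, branch by branch, constants of the
  program text. Its size is constant for fixed \<open>b\<close> and \<open>k\<close>.\<close>

primrec read_clause :: "nat \<Rightarrow> nat list \<Rightarrow> lprog" where
  "read_clause 0 cs = emit_gadgets (clause_pattern cs)"
| "read_clause (Suc d) cs = LIf yREM
     (LLoad yLIT 0 yPTR ;; LAdd yPTR yPTR yONE ;; LSub yREM yREM yONE ;;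
      LLoad (yBASE (length cs)) bGB yLIT ;; LLoad yCODE bCODE yLIT ;;
      switch (2 * b) 0 (\<lambda>c. read_clause d (cs @ [c])))
     (emit_gadgets (clause_pattern cs))"

abbreviation (input) "clause_regs \<equiv> emit_regs \<union> {yLIT, yPTR, yREM, yCODE} \<union> {40..<41 + k}"

lemma straight_read_clause: "length cs + d \<le> k \<Longrightarrow> straight clause_regs (read_clause d cs)"
proof (induction d arbitrary: cs)
  case 0
  show ?case unfolding read_clause.simps by (rule straight_mono[OF straight_emit_gadgets]) auto
next
  case (Suc d)
  have e: "straight clause_regs (emit_gadgets (clause_pattern cs))"
    by (rule straight_mono[OF straight_emit_gadgets]) auto
  have s: "straight clause_regs (switch (2 * b) 0 (\<lambda>c. read_clause d (cs @ [c])))"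
  proof (rule straight_switch)
    show "straight clause_regs (read_clause d (cs @ [c]))" for c using Suc.prems by (intro Suc.IH) simp
  qed simp
  show ?case unfolding read_clause.simps using Suc.prems
    by (intro straight_If straight_Seq e s) (auto simp: straight_def)
qed

definition literal_code :: "nat \<times> bool \<Rightarrow> nat" where
  "literal_code l = 2 * (fst l mod b) + of_bool (snd l)"

definition encode_literal :: "nat \<times> bool \<Rightarrow> nat" where
  "encode_literal l = 2 * fst l + of_bool (snd l)"

text \<open>The machine has no division, so quotient and remainder of a variable by \<open>b\<close>
  are looked up, for literals of both signs.\<close>

definition has_tables :: "nat \<Rightarrow> ram_state \<Rightarrow> bool" where
  "has_tables n s \<longleftrightarrow> (\<forall>v<n. \<forall>p. arrs s bGB (encode_literal (v, p)) = v div b * t \<and>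
     arrs s bCODE (encode_literal (v, p)) = literal_code (v, p))"

definition input_at :: "ram_state \<Rightarrow> nat \<Rightarrow> nat list \<Rightarrow> bool" where
  "input_at s p xs \<longleftrightarrow> (\<forall>i<length xs. arrs s 0 (p + i) = xs ! i)"

lemma input_at_Cons: "input_at s p (x # xs) \<longleftrightarrow> arrs s 0 p = x \<and> input_at s (Suc p) xs"
proof -
  have "(\<forall>i<Suc (length xs). arrs s 0 (p + i) = (x # xs) ! i) \<longleftrightarrow>
      arrs s 0 (p + 0) = (x # xs) ! 0 \<and> (\<forall>i<length xs. arrs s 0 (p + Suc i) = (x # xs) ! Suc i)"
    by (auto simp: less_Suc_eq_0_disj)
  then show ?thesis by (simp add: input_at_def)
qed

lemma eval_clause_pattern:
  assumes "\<And>i. i < length cl \<Longrightarrow> regs s (yBASE i) = fst (cl ! i) div b * t"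
  shows "map (eval_gadget s) (clause_pattern (map literal_code cl)) = clause_gadgets cl"
proof -
  have lit: "literal_code l div 2 = fst l mod b" "odd (literal_code l) = snd l" for l
    by (auto simp: literal_code_def)
  have "map (\<lambda>i. map (\<lambda>(r, w). (regs s r, w)) (map (Pair (yBASE i))
       (literal_words (map literal_code cl ! i div 2) (odd (map literal_code cl ! i))))) [0..<length cl]
     = map (\<lambda>i. map (Pair (fst (cl ! i) div b * t)) (literal_words (fst (cl ! i) mod b) (snd (cl ! i)))) [0..<length cl]"
    by (rule map_cong[OF refl]) (use assms lit in \<open>auto simp: comp_def\<close>)
  also have "\<dots> = map (\<lambda>l. map (Pair (fst l div b * t)) (literal_words (fst l mod b) (snd l))) cl"
    by (rule nth_equalityI) auto
  finally show ?thesis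
    unfolding clause_pattern_def clause_gadgets_def eval_gadget_def map_product_lists
    by (simp add: case_prod_beta' comp_def)
qed

lemma clause_pattern_regs: "ws \<in> set (clause_pattern cs) \<Longrightarrow> fst ` set ws \<inter> emit_regs = {}"
  by (auto simp: clause_pattern_def product_lists_set list_all2_conv_all_nth in_set_conv_nth) fastforce+

lemma emit_clause_spec:
  assumes "holds_gadgets s h d gs" "regs s yONE = 1"
    "\<And>i. i < length cl \<Longrightarrow> regs s (yBASE i) = fst (cl ! i) div b * t"
  defines "s' \<equiv> lsem (emit_gadgets (clause_pattern (map literal_code cl))) s"
  shows "holds_gadgets s' h d (gs @ clause_gadgets cl) \<and> regs s' yPTR = regs s yPTR"
proof
  have "holds_gadgets s' h d (gs @ map (eval_gadget s) (clause_pattern (map literal_code cl)))"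
    unfolding s'_def using assms(1,2) clause_pattern_regs by (rule emit_gadgets_spec)
  moreover have "map (eval_gadget s) (clause_pattern (map literal_code cl)) = clause_gadgets cl"
    using assms(3) by (rule eval_clause_pattern)
  ultimately show "holds_gadgets s' h d (gs @ clause_gadgets cl)" by (simp only:)
  show "regs s' yPTR = regs s yPTR"
    unfolding s'_def using straight_emit_gadgets[of "clause_pattern (map literal_code cl)"]
    by (intro lsem_frame_regs) (auto simp: straight_def)
qed

lemma read_clause_spec:
  assumes "holds_gadgets s h d gs" "regs s yONE = 1" "has_tables n s" "regs s yREM = length todo"
    "length todo \<le> m" "length done + m \<le> k" "input_at s (regs s yPTR) (map encode_literal todo @ rest)"
    "\<And>l. l \<in> set todo \<Longrightarrow> fst l < n"
    "\<And>i. i < length done \<Longrightarrow> regs s (yBASE i) = fst (done ! i) div b * t"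
  defines "s' \<equiv> lsem (read_clause m (map literal_code done)) s"
  shows "holds_gadgets s' h d (gs @ clause_gadgets (done @ todo)) \<and> regs s' yPTR = regs s yPTR + length todo"
  using assms(1-9) unfolding s'_def
proof (induction m arbitrary: s "done" todo)
  case 0
  then have "todo = []" by simp
  then show ?case using emit_clause_spec[OF 0(1,2), of "done"] 0(9) by simp
next
  case (Suc m)
  show ?case
  proof (cases todo)
    case Nil
    then show ?thesis using emit_clause_spec[OF Suc.prems(1,2), of "done"] Suc.prems(4,9) by simp
  next
    case (Cons l todo')
    obtain v p where l: "l = (v, p)" by fastforce
    have v: "v < n" using Suc.prems(8)[of l] Cons l by simp
    let ?j = "yBASE (length done)"
    define s1 where "s1 = lsem (LLoad yLIT 0 yPTR ;; LAdd yPTR yPTR yONE ;; LSub yREM yREM yONE ;;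
      LLoad ?j bGB yLIT ;; LLoad yCODE bCODE yLIT) s"
    define s2 where "s2 = set_reg yCODE 0 s1"
    have inp: "arrs s 0 (regs s yPTR) = encode_literal l" "input_at s (Suc (regs s yPTR)) (map encode_literal todo' @ rest)"
      using Suc.prems(7) Cons by (auto simp: input_at_Cons)
    have tab: "arrs s bGB (encode_literal l) = v div b * t" "arrs s bCODE (encode_literal l) = literal_code l"
      using Suc.prems(3) v l by (auto simp: has_tables_def)
    have arr: "arrs s1 = arrs s" by (simp add: s1_def)
    have s1: "regs s1 yCODE = literal_code l" "regs s1 yONE = 1" "regs s1 yPTR = Suc (regs s yPTR)"
      "regs s1 yREM = length todo'" "regs s1 ?j = v div b * t"
      using inp tab Suc.prems(2,4) Cons by (auto simp: s1_def)
    have fr: "regs s1 r = regs s r" if "r \<notin> {yLIT, yPTR, yREM, yCODE, ?j}" for r using that by (simp add: s1_def)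
    have "v mod b < b" using b1 by simp
    then have code: "literal_code l < 2 * b" by (auto simp: literal_code_def l)
    have "lsem (read_clause (Suc m) (map literal_code done)) s =
      lsem (switch (2 * b) 0 (\<lambda>c. read_clause m (map literal_code done @ [c]))) s1"
      using Suc.prems(4) Cons by (simp add: s1_def)
    also have "\<dots> = lsem (read_clause m (map literal_code (done @ [l]))) s2"
      using lsem_switch[OF s1(1) code s1(2)] by (simp add: s2_def)
    finally have eq: "lsem (read_clause (Suc m) (map literal_code done)) s = lsem (read_clause m (map literal_code (done @ [l]))) s2" .
    have "holds_gadgets (lsem (read_clause m (map literal_code (done @ [l]))) s2) h d (gs @ clause_gadgets ((done @ [l]) @ todo')) \<and>
      regs (lsem (read_clause m (map literal_code (done @ [l]))) s2) yPTR = regs s2 yPTR + length todo'"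
    proof (rule Suc.IH)
      show "holds_gadgets s2 h d gs" using Suc.prems(1) arr fr[of yE] fr[of yNUM] fr[of yBUD]
        by (simp add: s2_def holds_gadgets_def holds_edges_def)
      show "has_tables n s2" using Suc.prems(3) arr by (simp add: s2_def has_tables_def)
      show "input_at s2 (regs s2 yPTR) (map encode_literal todo' @ rest)" using inp(2) arr s1 by (simp add: s2_def input_at_def)
      fix i assume i: "i < length (done @ [l])"
      show "regs s2 (yBASE i) = fst ((done @ [l]) ! i) div b * t"
      proof (cases "i = length done")
        case True
        then show ?thesis using s1(5) l by (simp add: s2_def)
      next
        case False
        then have "i < length done" using i by simp
        then show ?thesis using Suc.prems(9)[of i] fr[of "yBASE i"] by (simp add: s2_def nth_append)
      qed
    qed (use s1 Suc.prems Cons in \<open>auto simp: s2_def\<close>)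
    then show ?thesis unfolding eq using s1(3) Cons by (simp add: s2_def)
  qed
qed

end

section \<open>The input array of the constructed instance\<close>

lemma div_mod_unique_less:
  fixes u v N :: nat
  assumes "u * N + v = u' * N + v'" "v < N" "v' < N"
  shows "u = u' \<and> v = v'"
proof -
  have "(u * N + v) div N = (u' * N + v') div N" "(u * N + v) mod N = (u' * N + v') mod N" using assms(1) by simp_all
  then show ?thesis using assms(2,3) by simp
qed

lemma indicator_update:
  fixes A :: "nat \<Rightarrow> nat"
  assumes "A = (\<lambda>i. if i = 0 then N else of_bool (i \<in> Z))" "a \<noteq> 0" "b \<noteq> 0"
  shows "A(a := 1, b := 1) = (\<lambda>i. if i = 0 then N else of_bool (i \<in> insert a (insert b Z)))"
  using assms(2,3) unfolding assms(1) by (auto simp: fun_eq_iff)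

text \<open>Brings the encoding into the form in which a program can write it: a header and a set of
  positions holding \<open>1\<close>.\<close>

lemma encode_instance_array:
  fixes G :: "nat pair_pre_digraph" and h :: nat
  assumes "input_graph G" "h \<le> card (pverts G)"
  defines "N \<equiv> card (pverts G)"
  shows "arrs (initial_state (encode_instance G {..<h})) 0 = (\<lambda>i. if i = 0 then N else
     of_bool (i \<in> {1 + N * N..<1 + N * N + h} \<union> (\<lambda>(u, v). 1 + u * N + v) ` parcs G))"
    (is "?A = ?R")
proof
  fix i
  define S where "S = (\<lambda>(u, v). 1 + u * N + v) ` parcs G"
  have R: "?R i = (if i = 0 then N else of_bool (i \<in> {1 + N * N..<1 + N * N + h} \<or> i \<in> S))"
    by (simp only: S_def Un_iff)
  have hN: "h \<le> N" using assms(2) by (simp add: N_def)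
  have less: "u < N \<and> v < N" if "(u, v) \<in> parcs G" for u v
  proof -
    interpret pair_graph G using assms(1) by (simp add: input_graph_def)
    have "pverts G = {..<N}" using assms(1) by (simp add: input_graph_def N_def)
    then show ?thesis using in_arcsD1[OF that] in_arcsD2[OF that] by simp
  qed
  note enc = encode_instance_nth[where G = G and Q = "{..<h}", folded N_def]
  have idx: "1 + u * N + v < 1 + N * N" if "u < N" "v < N" for u v
  proof -
    have "u * N + v < Suc u * N" "Suc u * N \<le> N * N"
      using that by (auto intro: mult_right_mono simp del: mult_Suc) auto
    then show ?thesis by linarith
  qed
  consider "i = 0" | "1 \<le> i" "i < 1 + N * N" | "1 + N * N \<le> i" "i < 1 + N * N + N" | "1 + N * N + N \<le> i" by linarith
  then show "?A i = ?R i"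
  proof cases
    case 1
    then show ?thesis unfolding R using enc(1) by simp
  next
    case 2
    define u v where "u = (i - 1) div N" and "v = (i - 1) mod N"
    have N0: "N > 0" using 2 by (cases N) auto
    have "i - 1 < N * N" using 2 by linarith
    then have u: "u < N" by (simp add: u_def less_mult_imp_div_less)
    have v: "v < N" using N0 by (simp add: v_def)
    have "i - 1 = u * N + v" unfolding u_def v_def by (simp only: div_mult_mod_eq)
    then have i: "i = 1 + u * N + v" using 2 by linarith
    have "i \<in> S \<longleftrightarrow> (u, v) \<in> parcs G"
    proof
      assume "i \<in> S"
      then obtain u' v' where uv: "(u', v') \<in> parcs G" "u * N + v = u' * N + v'" using i by (auto simp: S_def)
      then show "(u, v) \<in> parcs G" using div_mod_unique_less[OF uv(2) v] less[OF uv(1)] by auto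
    qed (force simp: i S_def)
    then show ?thesis unfolding R using 2 enc(2)[OF u v] i by simp
  next
    case 3
    define j where "j = i - (1 + N * N)"
    have i: "i = 1 + N * N + j" "j < N" using 3 by (auto simp: j_def)
    have "i \<notin> S"
    proof
      assume "i \<in> S"
      then obtain u v where uv: "(u, v) \<in> parcs G" "i = 1 + u * N + v" by (auto simp: S_def)
      then show False using idx[of u v] less[OF uv(1)] 3(1) by linarith
    qed
    then show ?thesis unfolding R using enc(3)[OF i(2)] i by simp
  next
    case 4
    have len: "length (encode_instance G {..<h}) = 1 + N * N + N"
      by (simp add: encode_instance_def Let_def length_concat comp_def sum_list_triv N_def)
    have "i \<notin> S"
    proof
      assume "i \<in> S"
      then obtain u v where uv: "(u, v) \<in> parcs G" "i = 1 + u * N + v" by (auto simp: S_def)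
      then show False using idx[of u v] less[OF uv(1)] 4 by linarith
    qed
    moreover have "?A i = 0" using 4 len by (simp add: initial_state_def)
    ultimately show ?thesis unfolding R using 4 hN by auto
  qed
qed

context reduction
begin

text \<open>Above all registers and arrays that the reduction uses for itself. Array
  \<open>K\<close> is the input array of the shifted solver and \<open>Suc K\<close> its output
  array.\<close>

definition "K = 41 + k"

definition read_sizes :: lprog where
  "read_sizes = LConst yZERO 0 ;; LConst yONE 1 ;; LLoad yN 0 yZERO ;; LLoad yM 0 yONE ;; LConst yT t ;; LConst yG 1"

text \<open>Both literals of a variable are written in succession; \<open>yR\<close> counts modulo
  \<open>b\<close>, and when it wraps around the next group begins.\<close>

definition table_row :: lprog where
  "table_row = LStore bGB yIDX yGB ;; LAdd yA yR yR ;; LStore bCODE yIDX yA ;; LAdd yIDX yIDX yONE ;;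
     LStore bGB yIDX yGB ;; LAdd yA yA yONE ;; LStore bCODE yIDX yA ;; LAdd yIDX yIDX yONE ;;
     LAdd yR yR yONE ;; LConst yC b ;; LSub yC yC yR ;;
     LIf yC LSkip (LConst yR 0 ;; LAdd yGB yGB yT ;; LAdd yG yG yONE)"

definition group_pattern :: "(nat \<times> nat list) list list" where
  "group_pattern = concat (replicate (Suc t) (map (\<lambda>w. [(yBASE 0, w)]) bad_words))"

definition emit_group :: lprog where
  "emit_group = emit_gadgets group_pattern ;; LAdd (yBASE 0) (yBASE 0) yT ;; LConst yC z ;; LAdd yBUD yBUD yC"

definition emit_clause :: lprog where
  "emit_clause = LLoad yREM 0 yPTR ;; LAdd yPTR yPTR yONE ;; read_clause k []"

definition tables :: lprog where
  "tables = LFor yI yN table_row"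

definition emit_all :: lprog where
  "emit_all = LAdd yH yGB yT ;; LAdd yNUM yH yZERO ;; LFor yI yG emit_group ;; LConst yPTR 2 ;; LFor yI yM emit_clause"

definition write_edge :: lprog where
  "write_edge = LLoad yA bEU yI ;; LLoad yB bEV yI ;; LLoad yC bROW yA ;; LAdd yC yC yB ;; LStore K yC yONE ;;
     LLoad yC bROW yB ;; LAdd yC yC yA ;; LStore K yC yONE"

text \<open>The machine cannot multiply, so the starts \<open>1 + u * N\<close> of the matrix rows
  are tabulated in \<open>bROW\<close> by repeated addition.\<close>

definition build :: lprog where
  "build = LStore K yZERO yNUM ;; LConst yPTR 1 ;;
     LFor yI yNUM (LStore bROW yI yPTR ;; LAdd yPTR yPTR yNUM) ;;
     LFor yI yH (LStore K yPTR yONE ;; LAdd yPTR yPTR yONE) ;;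
     LFor yI yE write_edge"

text \<open>The output array may contain entries other than \<open>0\<close> and \<open>1\<close>,
  hence the two tests that single out the value \<open>1\<close>.\<close>

definition decide :: lprog where
  "decide = LConst yR 0 ;;
     LFor yI yNUM (LLoad yA (Suc K) yI ;; LSub yB yA yONE ;; LIf yB LSkip (LIf yA (LAdd yR yR yONE) LSkip)) ;;
     LSub yA yR yBUD ;; LIf yA (LStore 1 yZERO yZERO) (LStore 1 yZERO yONE)"

lemma tables_spec:
  assumes "regs s yR = 0" "regs s yGB = 0" "regs s yIDX = 0" "regs s yG = 1" "regs s yT = t" "regs s yONE = 1" "regs s yN = n"
  defines "s' \<equiv> lsem tables s"
  shows "has_tables n s'" "regs s' yGB = n div b * t" "regs s' yG = groups n"
proof -
  define J where "J v s \<longleftrightarrow> has_tables v s \<and> regs s yR = v mod b \<and> regs s yGB = v div b * t \<and>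
     regs s yG = Suc (v div b) \<and> regs s yIDX = 2 * v" for v and s :: ram_state
  have "J n s'" unfolding s'_def tables_def
  proof (rule LFor_invariant_frame, goal_cases)
    case 1 show ?case by (simp add: table_row_def)
  next
    case 2 show ?case by (rule assms)
  next
    case 3 show ?case using assms(1-4) by (simp add: J_def has_tables_def)
  next
    case (4 v s1)
    have fr: "regs s1 yT = t" "regs s1 yONE = 1"
      using 4(4)[of yT] 4(4)[of yONE] assms(5,6) by (auto simp: table_row_def)
    let ?s2 = "for_step yI n (lsem table_row) s1"
    have J1: "has_tables v s1" "regs s1 yR = v mod b" "regs s1 yGB = v div b * t" "regs s1 yG = Suc (v div b)" "regs s1 yIDX = 2 * v"
      using 4(2) by (auto simp: J_def)
    have mb: "v mod b < b" using b1 by simp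
    have arr: "arrs ?s2 bGB = (arrs s1 bGB)(2 * v := v div b * t, Suc (2 * v) := v div b * t)"
      "arrs ?s2 bCODE = (arrs s1 bCODE)(2 * v := 2 * (v mod b), Suc (2 * v) := Suc (2 * (v mod b)))"
      using J1 fr by (auto simp: table_row_def mult_2)
    have reg: "regs ?s2 yIDX = 2 * Suc v" "regs ?s2 yR = (if Suc (v mod b) = b then 0 else Suc (v mod b))"
      "regs ?s2 yGB = (if Suc (v mod b) = b then v div b * t + t else v div b * t)"
      "regs ?s2 yG = (if Suc (v mod b) = b then Suc (Suc (v div b)) else Suc (v div b))"
      using J1 fr mb by (auto simp: table_row_def)
    have "has_tables (Suc v) ?s2"
      unfolding has_tables_def arr
    proof (intro allI impI)
      fix v' p assume v': "v' < Suc v"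
      show "((arrs s1 bGB)(2 * v := v div b * t, Suc (2 * v) := v div b * t)) (encode_literal (v', p)) = v' div b * t \<and>
         ((arrs s1 bCODE)(2 * v := 2 * (v mod b), Suc (2 * v) := Suc (2 * (v mod b)))) (encode_literal (v', p)) = literal_code (v', p)"
      proof (cases "v' = v")
        case True
        then show ?thesis by (cases p) (auto simp: encode_literal_def literal_code_def)
      next
        case False
        then have "v' < v" using v' by simp
        then have "encode_literal (v', p) \<noteq> 2 * v" "encode_literal (v', p) \<noteq> Suc (2 * v)" by (cases p; simp add: encode_literal_def; presburger)+
        then show ?thesis using J1(1) \<open>v' < v\<close> by (simp add: has_tables_def)
      qed
    qed
    moreover have "Suc v mod b = (if Suc (v mod b) = b then 0 else Suc (v mod b))" by (rule mod_Suc)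
    moreover have "Suc v div b = (if Suc (v mod b) = b then Suc (v div b) else v div b)"
      using b1 by (simp add: div_Suc mod_Suc)
    ultimately show ?case unfolding J_def reg by simp
  qed
  then show "has_tables n s'" "regs s' yGB = n div b * t" "regs s' yG = groups n"
    by (auto simp: J_def groups_def)
qed

lemma input_at_append: "input_at s p (xs @ ys) \<longleftrightarrow> input_at s p xs \<and> input_at s (p + length xs) ys"
  by (induction xs arbitrary: p) (auto simp: input_at_Cons, auto simp: input_at_def)

definition encode_clause :: "(nat \<times> bool) list \<Rightarrow> nat list" where
  "encode_clause cl = length cl # map encode_literal cl"

lemma encode_cnf_eq: "encode_cnf n \<phi> = n # length \<phi> # concat (map encode_clause \<phi>)"
proof -
  have "encode_literal = (\<lambda>(v, p). 2 * v + of_bool p)" by (auto simp: encode_literal_def)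
  then show ?thesis by (simp add: encode_cnf_def encode_clause_def[abs_def])
qed

lemma straight_emit_group: "straight (emit_regs \<union> {40}) emit_group"
proof -
  have "straight (emit_regs \<union> {40}) (emit_gadgets group_pattern)" by (rule straight_mono[OF straight_emit_gadgets]) auto
  then show ?thesis unfolding emit_group_def by (intro straight_Seq) (auto simp: straight_def)
qed

lemma straight_emit_clause: "straight clause_regs emit_clause"
proof -
  have "straight clause_regs (read_clause k [])" by (rule straight_read_clause) simp
  then show ?thesis unfolding emit_clause_def by (intro straight_Seq) (auto simp: straight_def)
qed

lemma wregs_emit: "wregs emit_group \<subseteq> emit_regs \<union> {40}" "warrs emit_group \<subseteq> {bEU, bEV}"
  "wregs emit_clause \<subseteq> clause_regs" "warrs emit_clause \<subseteq> {bEU, bEV}"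
  "count_regs emit_group = {}" "count_regs emit_clause = {}" "lwf emit_group" "lwf emit_clause"
  using straight_emit_group straight_emit_clause by (auto simp: straight_def)

lemma emit_all_spec:
  assumes "k_cnf k n \<phi>" "has_tables n s" "regs s yGB = n div b * t" "regs s yG = groups n" "regs s yT = t"
    "regs s yONE = 1" "regs s yZERO = 0" "regs s yM = length \<phi>" "regs s (yBASE 0) = 0" "regs s yE = 0" "regs s yBUD = 0"
    "input_at s 2 (concat (map encode_clause \<phi>))"
  defines "s' \<equiv> lsem emit_all s"
  shows "holds_gadgets s' (groups n * t) (groups n * z) (gadgets n \<phi>)" "regs s' yH = groups n * t"
proof -
  let ?h = "groups n * t"
  define s0 where "s0 = lsem (LAdd yH yGB yT ;; LAdd yNUM yH yZERO) s"
  have s0: "regs s0 yH = ?h" "regs s0 yNUM = ?h" "arrs s0 = arrs s"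
    "\<And>r. r \<notin> {yH, yNUM} \<Longrightarrow> regs s0 r = regs s r"
    using assms(3,5,7) by (auto simp: s0_def groups_def)
  define J where "J g s \<longleftrightarrow> holds_gadgets s ?h (g * z) (concat (map group_gadgets [0..<g])) \<and> regs s (yBASE 0) = g * t"
    for g and s :: ram_state
  define s1 where "s1 = lsem (LFor yI yG emit_group) s0"
  have "J (groups n) s1" unfolding s1_def
  proof (rule LFor_invariant_frame, goal_cases)
    case 1 show ?case using wregs_emit(1,7) by auto
  next
    case 2 show ?case using s0(4) assms(4) by simp
  next
    case 3 show ?case using s0 assms(9-11) by (simp add: J_def holds_gadgets_def holds_edges_def all_edges_def)
  next
    case (4 g s2)
    have "yT \<notin> wregs emit_group" "yONE \<notin> wregs emit_group" using wregs_emit(1) by auto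
    then have fr: "regs s2 yT = t" "regs s2 yONE = 1" using 4(4)[of yT] 4(4)[of yONE] s0(4) assms(5,6) by auto
    have J2: "holds_gadgets s2 ?h (g * z) (concat (map group_gadgets [0..<g]))" "regs s2 (yBASE 0) = g * t"
      using 4(2) by (auto simp: J_def)
    have ev: "map (eval_gadget s2) group_pattern = group_gadgets g"
      using J2(2) by (simp add: group_pattern_def group_gadgets_def map_concat comp_def eval_gadget_def)
    define s3 where "s3 = lsem (emit_gadgets group_pattern) s2"
    have h3: "holds_gadgets s3 ?h (g * z) (concat (map group_gadgets [0..<g]) @ map (eval_gadget s2) group_pattern)"
      unfolding s3_def by (rule emit_gadgets_spec[OF J2(1) fr(2)]) (auto simp: group_pattern_def split: if_splits)
    have fr3: "regs s3 r = regs s2 r" if "r \<notin> emit_regs" for r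
      unfolding s3_def using that straight_emit_gadgets[of group_pattern] by (intro lsem_frame_regs) (auto simp: straight_def)
    have "lsem emit_group s2 = lsem (LAdd (yBASE 0) (yBASE 0) yT ;; LConst yC z ;; LAdd yBUD yBUD yC) s3"
      by (simp add: emit_group_def s3_def)
    then show ?case using h3[unfolded ev] fr3[of yT] fr3[of "yBASE 0"] fr J2(2)
      by (simp add: J_def holds_gadgets_def holds_edges_def)
  qed
  then have g1: "holds_gadgets s1 ?h (groups n * z) (concat (map group_gadgets [0..<groups n]))" by (simp add: J_def)
  have wg: "wregs (LFor yI yG emit_group) \<subseteq> emit_regs \<union> {40, yI, Suc yI}" "warrs (LFor yI yG emit_group) \<subseteq> {bEU, bEV}"
    using wregs_emit by auto
  have fr1: "regs s1 r = regs s0 r" if "r \<notin> emit_regs \<union> {40, yI, Suc yI}" for r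
    unfolding s1_def using that wg by (intro lsem_frame_regs) blast
  have ar1: "arrs s1 a = arrs s a" if "a \<notin> {bEU, bEV}" for a
    unfolding s1_def s0(3)[symmetric] using that wg by (intro lsem_frame_arrs) blast
  define s2 where "s2 = lsem (LConst yPTR 2) s1"
  let ?g0 = "concat (map group_gadgets [0..<groups n])"
  \<comment> \<open>The first \<open>c\<close> clauses have been turned into gadgets, and the
    pointer stands at the first unread clause.\<close>
  define C where "C c s \<longleftrightarrow> holds_gadgets s ?h (groups n * z) (?g0 @ concat (map clause_gadgets (take c \<phi>))) \<and>
     input_at s (regs s yPTR) (concat (map encode_clause (drop c \<phi>)))" for c and s :: ram_state
  have s': "s' = lsem (LFor yI yM emit_clause) s2" by (simp add: s'_def emit_all_def s2_def s1_def s0_def)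
  have "C (length \<phi>) s'" unfolding s'
  proof (rule LFor_invariant_frame, goal_cases)
    case 1 show ?case using wregs_emit(3,8) by auto
  next
    case 2 show ?case using fr1[of yM] s0(4) assms(8) by (simp add: s2_def)
  next
    case 3
    have "input_at (for_init yI (length \<phi>) s2) 2 (concat (map encode_clause \<phi>))"
      using assms(12) ar1[of 0] by (simp add: input_at_def s2_def)
    then show ?case using g1 by (simp add: C_def s2_def holds_gadgets_def holds_edges_def)
  next
    case (4 c s3)
    let ?cl = "\<phi> ! c"
    have dr: "drop c \<phi> = ?cl # drop (Suc c) \<phi>" and tk: "take (Suc c) \<phi> = take c \<phi> @ [?cl]"
      using 4(1) by (simp_all add: Cons_nth_drop_Suc take_Suc_conv_app_nth)
    let ?rest = "concat (map encode_clause (drop (Suc c) \<phi>))"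
    have inp: "arrs s3 0 (regs s3 yPTR) = length ?cl" "input_at s3 (Suc (regs s3 yPTR)) (map encode_literal ?cl @ ?rest)"
      using 4(2) unfolding C_def dr by (auto simp: encode_clause_def input_at_Cons)
    have "yONE \<notin> wregs emit_clause" using wregs_emit(3) by auto
    then have one: "regs s3 yONE = 1" using 4(4)[of yONE] fr1[of yONE] s0(4) assms(6) by (simp add: s2_def)
    have "bGB \<notin> warrs emit_clause" "bCODE \<notin> warrs emit_clause" "0 \<notin> warrs emit_clause" using wregs_emit(4) by auto
    then have tab: "has_tables n s3"
      using 4(5)[of bGB] 4(5)[of bCODE] ar1 assms(2) by (simp add: has_tables_def s2_def)
    define s4 where "s4 = lsem (LLoad yREM 0 yPTR ;; LAdd yPTR yPTR yONE) s3"
    have cl: "?cl \<in> set \<phi>" using 4(1) by simp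
    have lenk: "length ?cl \<le> k" and vars: "\<And>l. l \<in> set ?cl \<Longrightarrow> fst l < n"
      using assms(1) cl by (fastforce simp: k_cnf_def)+
    have "holds_gadgets (lsem (read_clause k (map literal_code [])) s4) ?h (groups n * z)
        ((?g0 @ concat (map clause_gadgets (take c \<phi>))) @ clause_gadgets ([] @ ?cl)) \<and>
      regs (lsem (read_clause k (map literal_code [])) s4) yPTR = regs s4 yPTR + length ?cl"
    proof (rule read_clause_spec)
      show "holds_gadgets s4 ?h (groups n * z) (?g0 @ concat (map clause_gadgets (take c \<phi>)))"
        using 4(2) by (simp add: C_def s4_def holds_gadgets_def holds_edges_def)
      show "has_tables n s4" using tab by (simp add: s4_def has_tables_def)
      show "input_at s4 (regs s4 yPTR) (map encode_literal ?cl @ ?rest)"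
        using inp(2) one by (simp add: s4_def input_at_def)
    qed (use inp one lenk vars in \<open>auto simp: s4_def\<close>)
    then have r: "holds_gadgets (lsem emit_clause s3) ?h (groups n * z) (?g0 @ concat (map clause_gadgets (take (Suc c) \<phi>)))"
      "regs (lsem emit_clause s3) yPTR = Suc (regs s3 yPTR) + length ?cl"
      using one by (simp_all add: tk emit_clause_def s4_def)
    have "arrs (lsem emit_clause s3) 0 = arrs s3 0" using wregs_emit(4) by (intro lsem_frame_arrs) auto
    then have "input_at (lsem emit_clause s3) (Suc (regs s3 yPTR) + length ?cl) ?rest"
      using inp(2) unfolding input_at_append by (simp add: input_at_def)
    then show ?case using r by (simp add: C_def holds_gadgets_def holds_edges_def input_at_def)
  qed
  then show "holds_gadgets s' ?h (groups n * z) (gadgets n \<phi>)" by (simp add: C_def gadgets_def)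
  have "regs s' yH = regs s2 yH" unfolding s' using wregs_emit(3) by (intro lsem_frame_regs) auto
  then show "regs s' yH = ?h" using fr1[of yH] s0(1) by (simp add: s2_def)
qed

lemma build_spec:
  assumes "holds_edges s es" "regs s yNUM = N" "regs s yH = h" "regs s yZERO = 0" "regs s yONE = 1"
    "arrs s K = (\<lambda>_. 0)" "\<And>u v. (u, v) \<in> set es \<Longrightarrow> u < N \<and> v < N"
  shows "arrs (lsem build s) K = (\<lambda>i. if i = 0 then N else
     of_bool (i \<in> {1 + N * N..<1 + N * N + h} \<union> (\<lambda>(u, v). 1 + u * N + v) ` (set es \<union> (set es)\<inverse>)))"
proof -
  have K: "K \<noteq> bROW" "K \<noteq> bEU" "K \<noteq> bEV" by (auto simp: K_def)
  define s0 where "s0 = lsem (LStore K yZERO yNUM ;; LConst yPTR 1) s"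
  define s1 where "s1 = lsem (LFor yI yNUM (LStore bROW yI yPTR ;; LAdd yPTR yPTR yNUM)) s0"
  define s2 where "s2 = lsem (LFor yI yH (LStore K yPTR yONE ;; LAdd yPTR yPTR yONE)) s1"
  have eq: "lsem build s = lsem (LFor yI yE write_edge) s2" by (simp add: build_def s0_def s1_def s2_def)
  have s0: "\<And>r. r \<noteq> yPTR \<Longrightarrow> regs s0 r = regs s r" "regs s0 yPTR = 1" "\<And>a. a \<noteq> K \<Longrightarrow> arrs s0 a = arrs s a"
    "arrs s0 K = (\<lambda>i. if i = 0 then N else 0)"
    using assms(2,4,6) by (auto simp: s0_def)
  define J1 where "J1 u s \<longleftrightarrow> regs s yPTR = 1 + u * N \<and> (\<forall>v<u. arrs s bROW v = 1 + v * N)" for u and s :: ram_state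
  have "J1 N s1" unfolding s1_def
  proof (rule LFor_invariant_frame, goal_cases)
    case (4 u s')
    have "regs s' yNUM = N" using 4(4)[of yNUM] s0(1) assms(2) by simp
    then show ?case using 4(2,3) by (auto simp: J1_def less_Suc_eq)
  qed (use s0 assms(2) in \<open>auto simp: J1_def\<close>)
  then have p1: "regs s1 yPTR = 1 + N * N" and row1: "\<forall>v<N. arrs s1 bROW v = 1 + v * N" by (auto simp: J1_def)
  have fr1: "regs s1 r = regs s r" if "r \<notin> {yPTR, yI, Suc yI}" for r
  proof -
    have "regs s1 r = regs s0 r" unfolding s1_def using that by (intro lsem_frame_regs) auto
    then show ?thesis using s0(1) that by simp
  qed
  have ar1: "arrs s1 a = arrs s0 a" if "a \<noteq> bROW" for a
    unfolding s1_def using that by (intro lsem_frame_arrs) auto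
  define J2 where "J2 j s \<longleftrightarrow> regs s yPTR = 1 + N * N + j \<and>
     arrs s K = (\<lambda>i. if i = 0 then N else of_bool (i \<in> {1 + N * N..<1 + N * N + j}))" for j and s :: ram_state
  have "J2 h s2" unfolding s2_def
  proof (rule LFor_invariant_frame, goal_cases)
    case 3 show ?case using p1 ar1[of K] s0(4) K by (auto simp: J2_def)
  next
    case (4 j s')
    have "regs s' yONE = 1" using 4(4)[of yONE] fr1[of yONE] assms(5) by simp
    then show ?case using 4(2,3) by (auto simp: J2_def fun_eq_iff)
  qed (use fr1[of yH] assms(3) in auto)
  then have k2: "arrs s2 K = (\<lambda>i. if i = 0 then N else of_bool (i \<in> {1 + N * N..<1 + N * N + h}))" by (simp only: J2_def)
  have fr2: "regs s2 r = regs s r" if "r \<notin> {yPTR, yI, Suc yI}" for r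
  proof -
    have "regs s2 r = regs s1 r" unfolding s2_def using that by (intro lsem_frame_regs) auto
    then show ?thesis using fr1 that by simp
  qed
  have ar2: "arrs s2 a = arrs s1 a" if "a \<noteq> K" for a
    unfolding s2_def using that by (intro lsem_frame_arrs) auto
  let ?f = "\<lambda>(u, v). 1 + u * N + v"
  define J where "J j s \<longleftrightarrow> arrs s K = (\<lambda>i. if i = 0 then N else
     of_bool (i \<in> {1 + N * N..<1 + N * N + h} \<union> ?f ` (set (take j es) \<union> (set (take j es))\<inverse>)))" for j and s :: ram_state
  have "J (length es) (lsem (LFor yI yE write_edge) s2)"
  proof (rule LFor_invariant_frame, goal_cases)
    case 1 show ?case by (simp add: write_edge_def)
  next
    case 2 show ?case using fr2[of yE] assms(1) by (simp add: holds_edges_def)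
  next
    case 3
    have "?f ` (set (take 0 es) \<union> (set (take 0 es))\<inverse>) = {}" by simp
    then show ?case using k2 unfolding J_def arrs_for_init by (simp only: Un_empty_right)
  next
    case (4 j s3)
    obtain u v where uv: "es ! j = (u, v)" by fastforce
    have "(u, v) \<in> set es" using uv 4(1) by (metis nth_mem)
    then have less: "u < N" "v < N" using assms(7) by auto
    have w: "warrs write_edge = {K}" "yONE \<notin> wregs write_edge" by (auto simp: write_edge_def)
    have "arrs s3 bEU = arrs s bEU" "arrs s3 bEV = arrs s bEV" "arrs s3 bROW = arrs s1 bROW"
      using 4(5)[of bEU] 4(5)[of bEV] 4(5)[of bROW] w K ar2 ar1 s0(3) by auto
    then have a3: "arrs s3 bEU j = u" "arrs s3 bEV j = v" "arrs s3 bROW u = 1 + u * N" "arrs s3 bROW v = 1 + v * N"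
      using assms(1) 4(1) uv row1 less by (auto simp: holds_edges_def)
    have one: "regs s3 yONE = 1" using 4(4)[of yONE] w fr2[of yONE] assms(5) by simp
    have arr: "arrs (for_step yI (length es) (lsem write_edge) s3) K = (arrs s3 K)(1 + u * N + v := 1, 1 + v * N + u := 1)"
      using a3 one 4(3) K by (simp add: write_edge_def)
    have tk: "set (take (Suc j) es) = insert (u, v) (set (take j es))"
      using 4(1) uv by (simp add: take_Suc_conv_app_nth)
    have im: "?f ` (set (take (Suc j) es) \<union> (set (take (Suc j) es))\<inverse>) =
      insert (1 + u * N + v) (insert (1 + v * N + u) (?f ` (set (take j es) \<union> (set (take j es))\<inverse>)))"
      unfolding tk by (auto simp: image_Un)
    show ?case unfolding J_def arr im Un_insert_right
      by (rule indicator_update[OF 4(2)[unfolded J_def]]) simp_all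
  qed
  moreover have "take (length es) es = es" by simp
  ultimately show ?thesis unfolding eq J_def by (simp only:)
qed

lemma decide_spec:
  assumes "regs s yNUM = N" "regs s yONE = 1" "regs s yZERO = 0"
  shows "arrs (lsem decide s) 1 0 = of_bool (card {v. v < N \<and> arrs s (Suc K) v = 1} \<le> regs s yBUD)"
proof -
  define s0 where "s0 = lsem (LConst yR 0) s"
  let ?body = "LLoad yA (Suc K) yI ;; LSub yB yA yONE ;; LIf yB LSkip (LIf yA (LAdd yR yR yONE) LSkip)"
  define s1 where "s1 = lsem (LFor yI yNUM ?body) s0"
  let ?o = "arrs s (Suc K)"
  define J where "J j s \<longleftrightarrow> regs s yR = card {v. v < j \<and> ?o v = 1}" for j and s :: ram_state
  have "J N s1" unfolding s1_def
  proof (rule LFor_invariant_frame, goal_cases)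
    case (4 j s')
    have fr: "regs s' yONE = 1" "arrs s' (Suc K) = ?o" using 4(4)[of yONE] 4(5)[of "Suc K"] assms(2) by (auto simp: s0_def)
    have "{v. v < Suc j \<and> ?o v = 1} = (if ?o j = 1 then insert j {v. v < j \<and> ?o v = 1} else {v. v < j \<and> ?o v = 1})"
      by (auto simp: less_Suc_eq)
    then have c: "card {v. v < Suc j \<and> ?o v = 1} = card {v. v < j \<and> ?o v = 1} + of_bool (?o j = 1)" by simp
    have e: "regs (for_step yI N (lsem ?body) s') yR = regs s' yR + of_bool (?o j = 1)"
      using fr 4(3) by (cases "?o j"; cases "?o j - 1") auto
    show ?case unfolding J_def e c using 4(2) by (simp only: J_def)
  qed (use assms in \<open>auto simp: s0_def J_def\<close>)
  then have r: "regs s1 yR = card {v. v < N \<and> ?o v = 1}" by (simp only: J_def)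
  have "regs s1 r = regs s r" if "r \<in> {yBUD, yZERO, yONE}" for r
  proof -
    have "regs s1 r = regs s0 r" unfolding s1_def using that by (intro lsem_frame_regs) auto
    then show ?thesis using that by (auto simp: s0_def)
  qed
  moreover have "lsem decide s = lsem (LSub yA yR yBUD ;; LIf yA (LStore 1 yZERO yZERO) (LStore 1 yZERO yONE)) s1"
    by (simp add: decide_def s1_def s0_def)
  ultimately show ?thesis using r assms by auto
qed

end

section \<open>Existence of good codes\<close>

text \<open>When the zeros agree, matching means that a map of colors turns \<open>r\<close> into
  \<open>w\<close>, and there are \<open>Suc q ^ Suc q\<close> maps of \<open>{..q}\<close> into
  itself.\<close>

lemma card_matching_words_le:
  assumes "length r = t" "set r \<subseteq> {..q}"
  shows "card {w. length w = t \<and> set w \<subseteq> {..q} \<and> zeros w = zeros r \<and> matches r ((!) w)} \<le> Suc q ^ Suc q"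
proof -
  let ?M = "{w. length w = t \<and> set w \<subseteq> {..q} \<and> zeros w = zeros r \<and> matches r ((!) w)}"
  let ?F = "PiE {..q} (\<lambda>_. {..q})"
  have fin: "finite ?F" by (intro finite_PiE) auto
  have "?M \<subseteq> (\<lambda>h. map h r) ` ?F"
  proof
    fix w assume "w \<in> ?M"
    then have w: "length w = t" "set w \<subseteq> {..q}" "zeros w = zeros r" "matches r ((!) w)" by auto
    \<comment> \<open>Any position of color \<open>c\<close> may represent it, since equal entries
      of \<open>r\<close> correspond to equal entries of \<open>w\<close>. Colors that do not occur
      get the default \<open>0\<close>.\<close>
    define h where "h = restrict (\<lambda>c. if \<exists>i<t. r ! i = c then w ! (SOME i. i < t \<and> r ! i = c) else 0) {..q}"
    have some: "(SOME j. j < t \<and> r ! j = r ! i) < t \<and> r ! (SOME j. j < t \<and> r ! j = r ! i) = r ! i" if "i < t" for i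
      by (rule someI[of _ i]) (use that in auto)
    have eq: "w ! j = w ! i" if "i < t" "j < t" "r ! j = r ! i" for i j
    proof (cases "r ! i = 0")
      case True
      then show ?thesis
        using matches_zero_iff[OF w(4) _ w(3), of i] matches_zero_iff[OF w(4) _ w(3), of j] w(1) assms(1) that by simp
    next
      case False
      then show ?thesis using w(4)[unfolded matches_def, rule_format, of j i] that assms(1) by simp
    qed
    have h: "h (r ! i) = w ! i" if i: "i < t" for i
    proof -
      have "r ! i \<in> {..q}" using assms i nth_mem[of i r] by blast
      then have "h (r ! i) = w ! (SOME j. j < t \<and> r ! j = r ! i)" using i by (auto simp: h_def)
      then show ?thesis using eq[OF i] some[OF i] by simp
    qed
    have "map h r = w" by (rule nth_equalityI) (use h assms(1) w(1) in auto)
    moreover have "h \<in> ?F"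
    proof (rule PiE_I)
      fix c assume c: "c \<in> {..q}"
      show "h c \<in> {..q}"
      proof (cases "\<exists>i<t. r ! i = c")
        case True
        then obtain i where i: "i < t" "r ! i = c" by blast
        have "w ! i \<in> set w" using i(1) w(1) by (intro nth_mem) simp
        then show ?thesis using h[OF i(1)] i(2) w(2) by auto
      next
        case False
        then have "h c = 0" using c unfolding h_def restrict_apply by (simp only: if_True if_False)
        then show ?thesis by simp
      qed
    qed (simp add: h_def)
    ultimately show "w \<in> (\<lambda>h. map h r) ` ?F" by (metis imageI)
  qed
  then have "card ?M \<le> card ((\<lambda>h. map h r) ` ?F)" using fin by (intro card_mono) auto
  also have "\<dots> \<le> card ?F" using fin by (rule card_image_le)
  also have "\<dots> = Suc q ^ Suc q" by (simp add: card_PiE)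
  finally show ?thesis .
qed

text \<open>Take a largest set of pairwise non-matching words among those with a frequent number of
  zeros. The words matched by its members cover all the others, so it has at least
  \<open>X / S\<close> elements, where \<open>S\<close> grows only linearly in
  \<open>t\<close>.\<close>

lemma ex_coded_formulas:
  fixes B :: real
  assumes "1 \<le> q" "1 \<le> B" "B < real q + 1"
  shows "\<exists>t z b enc. coded_formulas q t z b enc \<and> B ^ t < 2 ^ b"
proof -
  define C where "C = Suc q ^ Suc q"
  define x where "x = B / (real q + 1)"
  have C1: "1 \<le> C" unfolding C_def by (rule one_le_power) simp
  have x: "0 \<le> x" "x < 1" using assms by (auto simp: x_def)
  \<comment> \<open>The decay of \<open>x ^ t\<close> beats the factor \<open>t + 1\<close>; the
    \<open>2\<close> beside \<open>C\<close> pays for rounding down to a power of two.\<close>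
  have "(\<lambda>n. real n * x ^ n) \<longlonglongrightarrow> 0" using x by (intro powser_times_n_limit_0) simp
  moreover have "(\<lambda>n. x ^ n) \<longlonglongrightarrow> 0" using x by (intro LIMSEQ_realpow_zero) auto
  ultimately have "(\<lambda>n. real n * x ^ n + x ^ n) \<longlonglongrightarrow> 0 + 0" by (rule tendsto_add)
  then have "eventually (\<lambda>n. real n * x ^ n + x ^ n < 1 / (2 * real C)) sequentially"
    using C1 by (intro order_tendstoD) auto
  moreover have "eventually (\<lambda>n. 1 \<le> n) sequentially" by (rule eventually_ge_at_top)
  ultimately have "eventually (\<lambda>n. real n * x ^ n + x ^ n < 1 / (2 * real C) \<and> 1 \<le> n) sequentially"
    by (rule eventually_conj)
  then obtain t where t: "real t * x ^ t + x ^ t < 1 / (2 * real C)" "1 \<le> t"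
    by (auto simp: eventually_sequentially)
  define S where "S = Suc t * C"
  define X where "X = Suc q ^ t"
  have S1: "1 \<le> S" using C1 by (simp add: S_def)
  have "2 * B ^ t * real S < real X"
  proof -
    have "0 < 2 * real C" using C1 by simp
    then have "(real t + 1) * x ^ t * (2 * real C) < 1"
      using t(1) C1 by (simp add: pos_less_divide_eq distrib_right)
    then have "(real t + 1) * (B ^ t / (real q + 1) ^ t) * (2 * real C) < 1" by (simp add: x_def power_divide)
    then have "((real t + 1) * B ^ t * (2 * real C)) / (real q + 1) ^ t < 1" by (simp add: mult_ac)
    then have "(real t + 1) * B ^ t * (2 * real C) < (real q + 1) ^ t"
      by (subst (asm) divide_less_eq_1_pos) simp_all
    moreover have "real S = (real t + 1) * real C" by (simp add: S_def algebra_simps)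
    moreover have "real X = (real q + 1) ^ t" by (simp add: X_def add.commute)
    ultimately show ?thesis by (simp add: algebra_simps)
  qed
  then have BX: "2 * B ^ t * real S < real X" .
  \<comment> \<open>The largest \<open>b\<close> with \<open>2 ^ b * S \<le> X\<close>, obtained as
    the least one whose successor is too large.\<close>
  define b where "b = (LEAST b. X < 2 ^ Suc b * S)"
  have "X < 2 ^ X" by (rule less_exp)
  also have "(2::nat) ^ X \<le> 2 ^ Suc X * S" using S1 by (simp add: Suc_le_eq)
  finally have "X < 2 ^ Suc X * S" .
  then have b_less: "X < 2 ^ Suc b * S" unfolding b_def by (rule LeastI)
  have "real S \<le> B ^ t * real S" using assms(2) by (simp add: mult_le_cancel_right1 one_le_power)
  then have "real S \<le> real X" using BX by linarith
  then have SX: "S \<le> X" by simp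
  have b_le: "2 ^ b * S \<le> X"
  proof (cases b)
    case 0
    then show ?thesis using SX by simp
  next
    case (Suc c)
    then have "\<not> X < 2 ^ Suc c * S" using not_less_Least[of c "\<lambda>b. X < 2 ^ Suc b * S"] by (simp add: b_def)
    then show ?thesis using Suc by simp
  qed
  have "real X < real (2 ^ Suc b * S)" using b_less by (simp only: of_nat_less_iff)
  then have "real X < 2 * 2 ^ b * real S" by simp
  then have "B ^ t * real S < 2 ^ b * real S" using BX by linarith
  then have Bb: "B ^ t < 2 ^ b" using S1 by simp
  have "1 \<le> B ^ t" using assms(2) by (rule one_le_power)
  then have b1: "1 \<le> b" using Bb by (cases b) auto
  let ?W = "{w. set w \<subseteq> {..q} \<and> length w = t}"
  have finW: "finite ?W" by (rule finite_lists_length_eq) simp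
  have cardW: "card ?W = X" by (simp add: card_lists_length_eq X_def)
  define Wz where "Wz z = {w \<in> ?W. zeros w = z}" for z
  have finWz: "finite (Wz z)" for z unfolding Wz_def by (rule finite_subset[OF _ finW]) auto
  \<comment> \<open>One of the \<open>t + 1\<close> possible numbers of zeros is attained by at
    least an average share of the words.\<close>
  have "\<exists>z\<le>t. X \<le> card (Wz z) * Suc t"
  proof (rule ccontr)
    assume "\<not> ?thesis"
    then have less: "card (Wz z) * Suc t < X" if "z \<le> t" for z using that by (meson not_le)
    have "?W = (\<Union>z\<in>{..t}. Wz z)" using zeros_le by (auto simp: Wz_def)
    then have "X \<le> (\<Sum>z\<le>t. card (Wz z))" unfolding cardW[symmetric] using card_UN_le[of "{..t}" Wz] by simp
    then have "X * Suc t \<le> (\<Sum>z\<le>t. card (Wz z) * Suc t)" unfolding sum_distrib_right[symmetric] by (rule mult_right_mono) simp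
    also have "\<dots> < (\<Sum>z\<le>t. X)" using less by (intro sum_strict_mono) auto
    finally show False by simp
  qed
  then obtain z where z: "X \<le> card (Wz z) * Suc t" by blast
  define indep where "indep R \<longleftrightarrow> (\<forall>r\<in>R. \<forall>r'\<in>R. matches r ((!) r') \<longrightarrow> r = r')" for R
  let ?R = "{R. R \<subseteq> Wz z \<and> indep R}"
  have finR: "finite ?R" using finWz[of z] by simp
  have "{} \<in> ?R" by (simp add: indep_def)
  then have "Max (card ` ?R) \<in> card ` ?R" using finR by (intro Max_in) auto
  then obtain R where R: "R \<subseteq> Wz z" "indep R" "card R = Max (card ` ?R)" by auto
  have max: "card R' \<le> card R" if "R' \<subseteq> Wz z" "indep R'" for R'
    unfolding R(3) using finR that by (intro Max_ge) auto
  have finRR: "finite R" using R(1) finWz finite_subset by blast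
  \<comment> \<open>A word matched by no member of \<open>R\<close> could be added to
    \<open>R\<close>, because matching is symmetric among words with equally many zeros.\<close>
  have cover: "\<exists>r\<in>R. matches r ((!) w)" if w: "w \<in> Wz z" for w
  proof (rule ccontr)
    assume no: "\<not> ?thesis"
    then have wR: "w \<notin> R" using matches_self by blast
    have "\<not> matches w ((!) r)" if "r \<in> R" for r
    proof
      assume "matches w ((!) r)"
      moreover have "length r = length w" "zeros r = zeros w" using w that R(1) by (auto simp: Wz_def)
      ultimately have "matches r ((!) w)" using matches_sym by blast
      then show False using no that by blast
    qed
    then have "indep (insert w R)" using R(2) no unfolding indep_def by blast
    then have "card (insert w R) \<le> card R" using w R(1) by (intro max) auto
    then show False using wR finRR by simp
  qed
  let ?M = "\<lambda>r. {w. length w = t \<and> set w \<subseteq> {..q} \<and> zeros w = zeros r \<and> matches r ((!) w)}"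
  have "Wz z \<subseteq> (\<Union>r\<in>R. ?M r)"
  proof
    fix w assume w: "w \<in> Wz z"
    obtain r where r: "r \<in> R" "matches r ((!) w)" using cover[OF w] by blast
    have "zeros r = z" "zeros w = z" "length w = t" "set w \<subseteq> {..q}" using r(1) R(1) w by (auto simp: Wz_def)
    then show "w \<in> (\<Union>r\<in>R. ?M r)" using r by blast
  qed
  moreover have "finite (?M r)" for r by (rule finite_subset[OF _ finW]) auto
  ultimately have "card (Wz z) \<le> card (\<Union>r\<in>R. ?M r)" using finRR by (intro card_mono) auto
  also have "\<dots> \<le> (\<Sum>r\<in>R. card (?M r))" using finRR by (rule card_UN_le)
  also have "\<dots> \<le> (\<Sum>r\<in>R. C)"
    unfolding C_def by (intro sum_mono card_matching_words_le) (use R(1) in \<open>auto simp: Wz_def\<close>)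
  also have "\<dots> = card R * C" by simp
  finally have "card (Wz z) * Suc t \<le> card R * C * Suc t" by (rule mult_right_mono) simp
  moreover have "card R * C * Suc t = card R * S" by (simp only: S_def mult_ac)
  ultimately have "2 ^ b * S \<le> card R * S" using b_le z by linarith
  then have "2 ^ b \<le> card R" using S1 by simp
  then obtain enc where enc: "inj_on enc {..<2 ^ b::nat}" "enc ` {..<2 ^ b} \<subseteq> R"
    using card_le_inj[of "{..<2 ^ b::nat}" R] finRR by auto
  have "coded_formulas q t z b enc"
  proof
    fix a :: nat assume "a < 2 ^ b"
    then have "enc a \<in> Wz z" using enc(2) R(1) by blast
    then show "length (enc a) = t \<and> set (enc a) \<subseteq> {..q} \<and> zeros (enc a) = z" by (simp add: Wz_def)
  next
    fix a a' :: nat assume a: "a < 2 ^ b" "a' < 2 ^ b" "matches (enc a) ((!) (enc a'))"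
    then have "enc a = enc a'" using enc(2) R(2) unfolding indep_def by blast
    then show "a = a'" using enc(1) a by (auto dest: inj_onD)
  qed (fact assms(1) t(2) b1)+
  then show ?thesis using Bb by blast
qed


section \<open>The lower bound\<close>

lemma length_concat_map_le:
  assumes "\<And>x. x \<in> set xs \<Longrightarrow> length (f x) \<le> B"
  shows "length (concat (map f xs)) \<le> length xs * B"
  using assms by (induction xs) (auto intro: add_mono)

lemma length_product_lists_le:
  "(\<And>xs. xs \<in> set xss \<Longrightarrow> length xs \<le> B) \<Longrightarrow> length (product_lists xss) \<le> B ^ length xss"
proof (induction xss)
  case (Cons xs xss)
  have "length (product_lists (xs # xss)) \<le> length xs * B ^ length xss"
    unfolding product_lists.simps using Cons by (intro length_concat_map_le) auto
  also have "\<dots> \<le> B * B ^ length xss" using Cons.prems by (intro mult_right_mono) auto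
  finally show ?case by simp
qed simp

lemma gadget_blocks_att_length:
  assumes "blk \<in> set (gadget_blocks q ws)" "j < length blk"
  shows "length (blk ! j) \<le> 2"
proof -
  consider "blk = const_block q" | "blk = [[]]" | pos w where "blk \<in> set (word_blocks q pos w)"
    using assms(1) by (auto simp: gadget_blocks_def gadget_tests_def split: if_splits)
  then show ?thesis
  proof cases
    case 1
    then show ?thesis using assms(2) by (simp add: const_block_def del: replicate_Suc)
  next
    case 2
    then show ?thesis using assms(2) by simp
  next
    case 3
    then obtain a b where "blk = test_block q pos w a b" by (auto simp: word_blocks_iff)
    then show ?thesis using assms(2)
      by (cases j) (auto simp: test_block_def same_block_def diff_block_def split: if_splits)
  qed
qed

lemma length_gadget_edges_le:
  assumes "\<And>e. e < length blks \<Longrightarrow> length (blks ! e) \<le> S"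
    and "\<And>e j. e < length blks \<Longrightarrow> j < length (blks ! e) \<Longrightarrow> length (blks ! e ! j) \<le> 2"
  shows "length (gadget_edges lv R blks) \<le> length blks * (S * S) + (length blks * (S * 2) + length blks * length blks)"
proof -
  have "length [(lv (e * R + j), lv (e * R + i)). e \<leftarrow> [0..<length blks], j \<leftarrow> [0..<length (blks ! e)], i \<leftarrow> [0..<j]]
     \<le> length [0..<length blks] * (S * S)"
  proof (rule length_concat_map_le)
    fix e assume e: "e \<in> set [0..<length blks]"
    have "length (concat (map (\<lambda>j. map (\<lambda>i. (lv (e * R + j), lv (e * R + i))) [0..<j]) [0..<length (blks ! e)])) \<le> length [0..<length (blks ! e)] * S"
      by (rule length_concat_map_le) (use assms(1)[of e] e in auto)
    also have "\<dots> \<le> S * S" using assms(1)[of e] e by (intro mult_right_mono) auto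
    finally show "length (concat (map (\<lambda>j. map (\<lambda>i. (lv (e * R + j), lv (e * R + i))) [0..<j]) [0..<length (blks ! e)])) \<le> S * S" .
  qed
  moreover have "length [(lv (e * R + j), h). e \<leftarrow> [0..<length blks], j \<leftarrow> [0..<length (blks ! e)], h \<leftarrow> blks ! e ! j]
     \<le> length [0..<length blks] * (S * 2)"
  proof (rule length_concat_map_le)
    fix e assume e: "e \<in> set [0..<length blks]"
    have "length (concat (map (\<lambda>j. map (\<lambda>h. (lv (e * R + j), h)) (blks ! e ! j)) [0..<length (blks ! e)])) \<le> length [0..<length (blks ! e)] * 2"
      by (rule length_concat_map_le) (use assms(2)[of e] e in auto)
    also have "\<dots> \<le> S * 2" using assms(1)[of e] e by (intro mult_right_mono) auto
    finally show "length (concat (map (\<lambda>j. map (\<lambda>h. (lv (e * R + j), h)) (blks ! e ! j)) [0..<length (blks ! e)])) \<le> S * 2" .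
  qed
  moreover have "length [(lv (e * R), lv (d * R)). e \<leftarrow> [0..<length blks], d \<leftarrow> [0..<e]] \<le> length [0..<length blks] * length blks"
    by (rule length_concat_map_le) auto
  ultimately show ?thesis unfolding gadget_edges_def length_append by simp
qed

text \<open>Clauses are distinct, so there are at most as many as lists of at most \<open>k\<close>
  literals. For fixed \<open>k\<close> this keeps formula and graph polynomial in
  \<open>n\<close>.\<close>

lemma k_cnf_length:
  assumes "k_cnf k n \<phi>"
  shows "length \<phi> \<le> Suc k * (2 * n + 1) ^ k"
proof -
  let ?L = "{..<n} \<times> (UNIV :: bool set)"
  let ?C = "{cl. set cl \<subseteq> ?L \<and> length cl \<le> k}"
  have fin: "finite ?C" by (rule finite_lists_length_le) simp
  have "distinct \<phi>" using assms by (simp add: k_cnf_def distinct_map)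
  then have "length \<phi> = card (set \<phi>)" by (simp add: distinct_card)
  also have "\<dots> \<le> card ?C" using assms fin by (intro card_mono) (auto simp: k_cnf_def)
  also have "card ?C = (\<Sum>i\<le>k. card ?L ^ i)" by (rule card_lists_length_le) simp
  also have "card ?L = 2 * n" by (simp add: card_cartesian_product)
  also have "(\<Sum>i\<le>k. (2 * n) ^ i) \<le> (\<Sum>i\<le>k. (2 * n + 1) ^ k)"
  proof (rule sum_mono)
    fix i assume "i \<in> {..k}"
    have "(2 * n) ^ i \<le> (2 * n + 1) ^ i" by (rule power_mono) auto
    also have "\<dots> \<le> (2 * n + 1) ^ k" using \<open>i \<in> {..k}\<close> by (intro power_increasing) auto
    finally show "(2 * n) ^ i \<le> (2 * n + 1) ^ k" .
  qed
  also have "\<dots> = Suc k * (2 * n + 1) ^ k" by simp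
  finally show ?thesis .
qed

context reduction
begin

lemma static_read_sizes: "lwf read_sizes" "count_regs read_sizes = {}" "wregs read_sizes = {yZERO, yONE, yN, yM, yT, yG}" "warrs read_sizes = {}"
  by (auto simp: read_sizes_def)

lemma static_tables: "lwf tables" "count_regs tables = {yN}"
  "wregs tables = {yI, Suc yI, yA, yIDX, yR, yC, yGB, yG}" "warrs tables = {bGB, bCODE}"
  by (auto simp: tables_def table_row_def)

lemma static_emit_all: "lwf emit_all" "count_regs emit_all = {yG, yM}"
  "wregs emit_all \<subseteq> clause_regs \<union> {yI, Suc yI, yH}" "warrs emit_all \<subseteq> {bEU, bEV}"
  using wregs_emit by (auto simp: emit_all_def)

lemma static_build: "lwf build" "count_regs build = {yNUM, yH, yE}"
  "wregs build = {yI, Suc yI, yPTR, yA, yB, yC}" "warrs build = {K, bROW}"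
  by (auto simp: build_def write_edge_def)

lemma static_decide: "lwf decide" "count_regs decide = {yNUM}" "wregs decide = {yI, Suc yI, yA, yB, yR}"
  by (auto simp: decide_def)

definition num_clauses :: "nat \<Rightarrow> nat" where
  "num_clauses n = Suc k * (2 * n + 1) ^ k"

text \<open>At most \<open>2 ^ b\<close> codes falsify a literal, hence the factor
  \<open>(2 ^ b) ^ k\<close> per clause, a constant once the code and \<open>k\<close> are
  fixed.\<close>

definition num_gadgets :: "nat \<Rightarrow> nat" where
  "num_gadgets n = (n + 1) * (Suc t * length bad_words) + num_clauses n * (2 ^ b) ^ k"

definition num_verts :: "nat \<Rightarrow> nat" where
  "num_verts n = (n + 1) * t + num_gadgets n * SZ"

definition num_edges :: "nat \<Rightarrow> nat" where
  "num_edges n = num_gadgets n * (SZ * (Suc q * Suc q) + (SZ * (Suc q * 2) + SZ * SZ))"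

lemma length_gadgets_le:
  assumes "k_cnf k n \<phi>"
  shows "length (gadgets n \<phi>) \<le> num_gadgets n"
proof -
  have "groups n \<le> n + 1" by (simp add: groups_def)
  have "length (concat (map group_gadgets [0..<groups n])) \<le> length [0..<groups n] * (Suc t * length bad_words)"
  proof (rule length_concat_map_le)
    fix g
    show "length (group_gadgets g) \<le> Suc t * length bad_words"
      unfolding group_gadgets_def by (simp add: length_concat sum_list_replicate)
  qed
  also have "\<dots> \<le> (n + 1) * (Suc t * length bad_words)"
    using \<open>groups n \<le> n + 1\<close> by (intro mult_right_mono) auto
  finally have g: "length (concat (map group_gadgets [0..<groups n])) \<le> (n + 1) * (Suc t * length bad_words)" .
  have "length (concat (map clause_gadgets \<phi>)) \<le> length \<phi> * (2 ^ b) ^ k"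
  proof (rule length_concat_map_le)
    fix cl assume "cl \<in> set \<phi>"
    then have len: "length cl \<le> k" using assms by (auto simp: k_cnf_def)
    have "length (literal_words r s) \<le> 2 ^ b" for r s
      unfolding literal_words_def length_map by (rule order_trans[OF length_filter_le]) simp
    then have "length (clause_gadgets cl) \<le> (2 ^ b) ^ length (map (\<lambda>(v, s). map (Pair (v div b * t)) (literal_words (v mod b) s)) cl)"
      unfolding clause_gadgets_def by (intro length_product_lists_le) auto
    also have "\<dots> \<le> (2 ^ b) ^ k" using len by (intro power_increasing) auto
    finally show "length (clause_gadgets cl) \<le> (2 ^ b) ^ k" .
  qed
  also have "\<dots> \<le> num_clauses n * (2 ^ b) ^ k"
    using k_cnf_length[OF assms] by (intro mult_right_mono) (auto simp: num_clauses_def)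
  finally show ?thesis using g by (simp add: gadgets_def num_gadgets_def)
qed

lemma length_all_edges_le:
  assumes "k_cnf k n \<phi>"
  shows "length (all_edges q h SZ (gadgets n \<phi>)) \<le> num_edges n"
proof -
  interpret gi: gadget_instance q t "groups n * t" SZ "gadgets n \<phi>"
    unfolding SZ_def by (rule gadget_instance) fact
  let ?E = "SZ * (Suc q * Suc q) + (SZ * (Suc q * 2) + SZ * SZ)"
  have "length (all_edges q h SZ (gadgets n \<phi>)) \<le> length [0..<length (gadgets n \<phi>)] * ?E"
    unfolding all_edges_def
  proof (rule length_concat_map_le)
    fix i assume "i \<in> set [0..<length (gadgets n \<phi>)]"
    then have g: "gadgets n \<phi> ! i \<in> set (gadgets n \<phi>)" by simp
    let ?B = "gadget_blocks q (shifted (gadgets n \<phi> ! i))"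
    have "length ?B * 1 \<le> length ?B * Suc q" by (intro mult_left_mono) auto
    also have "\<dots> \<le> SZ" using gi.fits[OF g] by (simp only: gi.length_blocks)
    finally have len: "length ?B \<le> SZ" by simp
    have "length (placed_edges q (h + i * SZ) (gadgets n \<phi> ! i)) \<le>
       length ?B * (Suc q * Suc q) + (length ?B * (Suc q * 2) + length ?B * length ?B)"
      unfolding placed_edges_def
      by (rule length_gadget_edges_le) (use gi.block_length[OF g] gadget_blocks_att_length nth_mem in blast)+
    also have "\<dots> \<le> ?E" using len by (intro add_mono mult_mono) auto
    finally show "length (placed_edges q (h + i * SZ) (gadgets n \<phi> ! i)) \<le> ?E" .
  qed
  also have "\<dots> \<le> num_edges n"
    unfolding num_edges_def using length_gadgets_le[OF assms] by (intro mult_right_mono) auto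
  finally show ?thesis .
qed

section \<open>The SAT program and its cost\<close>

definition sat_program :: "prog \<Rightarrow> prog" where
  "sat_program P = Seq (compile read_sizes) (Seq (compile tables) (Seq (compile emit_all)
     (Seq (compile build) (Seq (shift_prog K P) (compile decide)))))"

definition max_count :: "nat \<Rightarrow> nat" where
  "max_count n = n + 1 + num_clauses n + num_verts n + num_edges n"

definition consts_bound :: nat where
  "consts_bound = max_const read_sizes + max_const tables + max_const emit_all + max_const build + max_const decide"

definition value_bound :: "nat \<Rightarrow> nat" where
  "value_bound n = 2 * n + 2 + num_clauses n + k + consts_bound"

definition step_bound :: "nat \<Rightarrow> nat" where
  "step_bound n = cost_bound (\<lambda>_. max_count n) read_sizes + cost_bound (\<lambda>_. max_count n) tables +
     cost_bound (\<lambda>_. max_count n) emit_all + cost_bound (\<lambda>_. max_count n) build"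

definition decide_bound :: "nat \<Rightarrow> nat" where
  "decide_bound n = cost_bound (\<lambda>_. max_count n) decide"

definition log_bound :: "nat \<Rightarrow> nat" where
  "log_bound n = step_bound n + (value_bound n + 1)"

text \<open>The solver runs on the instance prepared in array \<open>K\<close>, and its number of
  deletions is compared with the budget. The last phase handles numbers that the solver produced,
  whose lengths are bounded through \<open>tP\<close>; this is why \<open>tP\<close> occurs in the
  bound for \<open>t2\<close>.\<close>

lemma sat_program_spec:
  assumes cnf: "k_cnf k n \<phi>"
  defines "G \<equiv> instance_graph q (groups n * t) SZ (gadgets n \<phi>)" and "Q \<equiv> {..<groups n * t}"
  assumes "solves_deletion_within P q G Q T"
  shows "\<exists>t1 tP t2 out. computes (sat_program P) (encode_cnf n \<phi>) (t1 + tP + t2) out \<and>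
     out 0 = of_bool (satisfiable \<phi>) \<and> real tP \<le> T \<and> t1 \<le> 4 * (step_bound n * (1 + 2 * log_bound n)) \<and>
     t2 \<le> decide_bound n * (1 + 2 * (decide_bound n + (tP + log_bound n)))"
proof -
  let ?h = "groups n * t" and ?gs = "gadgets n \<phi>"
  define N where "N = ?h + length ?gs * SZ"
  interpret gi: gadget_instance q t ?h SZ ?gs unfolding SZ_def by (rule gadget_instance) fact
  have cardG: "card (pverts G) = N" by (simp add: G_def instance_graph_def N_def)
  define s0 where "s0 = initial_state (encode_cnf n \<phi>)"
  define s1 where "s1 = lsem read_sizes s0"
  define s2 where "s2 = lsem tables s1"
  define s3 where "s3 = lsem emit_all s2"
  define s4 where "s4 = lsem build s3"
  have i0: "regs s0 r = 0" "a \<noteq> 0 \<Longrightarrow> arrs s0 a = (\<lambda>_. 0)" for r a by (auto simp: s0_def initial_state_def)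
  have in0: "arrs s0 0 0 = n" "arrs s0 0 (Suc 0) = length \<phi>" "input_at s0 2 (concat (map encode_clause \<phi>))"
    by (auto simp: s0_def initial_state_def encode_cnf_eq input_at_def)
  have s1: "regs s1 yZERO = 0" "regs s1 yONE = 1" "regs s1 yN = n" "regs s1 yM = length \<phi>" "regs s1 yT = t" "regs s1 yG = 1"
    "arrs s1 = arrs s0" "\<And>r. r \<notin> {yZERO, yONE, yN, yM, yT, yG} \<Longrightarrow> regs s1 r = 0"
    using in0 i0 by (auto simp: s1_def read_sizes_def)
  have t2: "has_tables n s2" "regs s2 yGB = n div b * t" "regs s2 yG = groups n"
    using tables_spec[of s1 n] s1 by (auto simp: s2_def)
  have fr2: "regs s2 r = regs s1 r" if "r \<notin> {yI, Suc yI, yA, yIDX, yR, yC, yGB, yG}" for r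
    unfolding s2_def using that static_tables(3) by (intro lsem_frame_regs) simp
  have ar2: "arrs s2 a = arrs s0 a" if "a \<notin> {bGB, bCODE}" for a
    unfolding s2_def s1(7)[symmetric] using that static_tables(4) by (intro lsem_frame_arrs) simp
  have "input_at s2 2 (concat (map encode_clause \<phi>))" using in0(3) ar2[of 0] by (simp add: input_at_def)
  moreover have "regs s2 yT = t" "regs s2 yONE = 1" "regs s2 yZERO = 0" "regs s2 yM = length \<phi>"
    "regs s2 (yBASE 0) = 0" "regs s2 yE = 0" "regs s2 yBUD = 0"
    by (simp_all add: fr2 s1)
  ultimately have s3: "holds_gadgets s3 ?h (groups n * z) ?gs" "regs s3 yH = ?h"
    unfolding s3_def using emit_all_spec[OF cnf t2] by blast+
  have fr3: "regs s3 r = regs s2 r" if "r \<notin> clause_regs \<union> {yI, Suc yI, yH}" for r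
    unfolding s3_def using that static_emit_all(3) by (intro lsem_frame_regs) blast
  have ar3: "arrs s3 a = arrs s2 a" if "a \<notin> {bEU, bEV}" for a
    unfolding s3_def using that static_emit_all(4) by (intro lsem_frame_arrs) blast
  have num3: "regs s3 yNUM = N" "regs s3 yBUD = budget n \<phi>" "holds_edges s3 (all_edges q ?h SZ ?gs)"
    using s3(1) by (auto simp: holds_gadgets_def N_def budget_def)
  have one3: "regs s3 yZERO = 0" "regs s3 yONE = 1" by (simp_all add: fr3 fr2 s1)
  have K41: "41 \<le> K" by (simp add: K_def)
  have ig: "input_graph G" unfolding G_def by (rule gi.input_graph)
  have edge_less: "u < N \<and> v < N" if "(u, v) \<in> set (all_edges q ?h SZ ?gs)" for u v
  proof -
    interpret pair_graph G using ig by (simp add: input_graph_def)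
    have "(u, v) \<in> parcs G" using that by (simp add: G_def instance_graph_def)
    from in_arcsD1[OF this] in_arcsD2[OF this] show ?thesis by (simp add: G_def instance_graph_def N_def)
  qed
  have arK: "arrs s3 K = (\<lambda>_. 0)" using ar3[of K] ar2[of K] i0(2)[of K] K41 by auto
  have "arrs s4 K = (\<lambda>i. if i = 0 then N else of_bool (i \<in> {1 + N * N..<1 + N * N + ?h} \<union>
      (\<lambda>(u, v). 1 + u * N + v) ` (set (all_edges q ?h SZ ?gs) \<union> (set (all_edges q ?h SZ ?gs))\<inverse>)))"
    unfolding s4_def by (rule build_spec[OF num3(3,1) s3(2) one3 arK edge_less])
  moreover have "?h \<le> card (pverts G)" by (simp add: cardG N_def)
  moreover have "parcs G = set (all_edges q ?h SZ ?gs) \<union> (set (all_edges q ?h SZ ?gs))\<inverse>"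
    by (simp add: G_def instance_graph_def)
  ultimately have k4: "arrs s4 K = arrs (initial_state (encode_instance G Q)) 0"
    using encode_instance_array[OF ig, of ?h] by (simp only: cardG Q_def)
  have fr4: "regs s4 r = regs s3 r" if "r \<notin> {yI, Suc yI, yPTR, yA, yB, yC}" for r
    unfolding s4_def using that static_build(3) by (intro lsem_frame_regs) simp
  have ar4: "arrs s4 a = arrs s3 a" if "a \<notin> {K, bROW}" for a
    unfolding s4_def using that static_build(4) by (intro lsem_frame_arrs) simp
  have high_regs: "regs s4 r = 0" if "K \<le> r" for r
  proof -
    have r: "41 + k \<le> r" using that by (simp add: K_def)
    have "regs s4 r = regs s3 r" using r by (intro fr4) auto
    also have "\<dots> = regs s2 r" using r by (intro fr3) auto
    also have "\<dots> = regs s1 r" using r by (intro fr2) auto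
    also have "\<dots> = 0" using r by (intro s1(8)) auto
    finally show ?thesis .
  qed
  have high_arrs: "arrs s4 a = (\<lambda>_. 0)" if "K < a" for a
  proof -
    have a: "41 < a" using that K41 by simp
    have "arrs s4 a = arrs s3 a" using that a by (intro ar4) auto
    also have "\<dots> = arrs s2 a" using a by (intro ar3) auto
    also have "\<dots> = arrs s0 a" using a by (intro ar2) auto
    also have "\<dots> = (\<lambda>_. 0)" using a by (intro i0(2)) auto
    finally show ?thesis .
  qed
  \<comment> \<open>The registers from \<open>K\<close> on and the arrays above \<open>K\<close> are
    still empty, and array \<open>K\<close> holds the encoded instance, so this state already is an
    embedded initial state of the solver.\<close>
  have emb: "embed_state K s4 (initial_state (encode_instance G Q)) = s4"
  proof (rule ram_state.equality)
    show "regs (embed_state K s4 (initial_state (encode_instance G Q))) = regs s4"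
      using high_regs by (auto simp: embed_state_def initial_state_def fun_eq_iff)
    have "arrs (initial_state (encode_instance G Q)) (a - K) = arrs s4 a" if "K \<le> a" for a
      using k4 high_arrs[of a] that by (cases "a = K") (auto simp: initial_state_def)
    then show "arrs (embed_state K s4 (initial_state (encode_instance G Q))) = arrs s4"
      by (auto simp: embed_state_def fun_eq_iff)
  qed simp
  obtain tP sP where P: "exec P (initial_state (encode_instance G Q)) tP sP" "real tP \<le> T"
    "min_coloring_deletion_set q G {v \<in> pverts G. arrs sP 1 v = 1}"
    using assms(4) by (auto simp: solves_deletion_within_def computes_def)
  define s5 where "s5 = embed_state K s4 sP"
  have e5: "exec (shift_prog K P) s4 tP s5"
    using exec_shift_prog[OF P(1), of K s4] unfolding emb s5_def .
  have r5: "regs s5 r = regs s4 r" if "r < 41" for r using that K41 by (simp add: s5_def embed_state_def)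
  have out5: "arrs s5 (Suc K) = arrs sP 1" using arrs_embed_state[of K s4 sP 1] by (simp add: s5_def)
  define s6 where "s6 = lsem decide s5"
  have reg5: "regs s5 yNUM = N" "regs s5 yONE = 1" "regs s5 yZERO = 0" "regs s5 yBUD = budget n \<phi>"
    by (simp_all add: r5 fr4 num3 one3)
  have "{v \<in> pverts G. arrs sP 1 v = 1} = {v. v < N \<and> arrs sP 1 v = 1}" by (auto simp: G_def instance_graph_def N_def)
  then have "arrs s6 1 0 = of_bool (card {v \<in> pverts G. arrs sP 1 v = 1} \<le> budget n \<phi>)"
    unfolding s6_def decide_spec[OF reg5(1-3)] out5 reg5(4) by simp
  also have "card {v \<in> pverts G. arrs sP 1 v = 1} \<le> budget n \<phi> \<longleftrightarrow> satisfiable \<phi>"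
    unfolding min_coloring_deletion_set_le_iff[OF P(3)]
    using satisfiable_imp_coloring[OF cnf] coloring_imp_satisfiable[OF cnf]
    unfolding G_def SZ_def by (metis order_refl)
  finally have out: "arrs s6 1 0 = of_bool (satisfiable \<phi>)" .

  let ?M = "value_bound n" and ?U = "max_count n"
  have m_le: "length \<phi> \<le> num_clauses n" using k_cnf_length[OF cnf] by (simp add: num_clauses_def)
  have "groups n \<le> n + 1" by (simp add: groups_def)
  then have h_le: "?h \<le> (n + 1) * t" by (rule mult_right_mono) simp
  have gs_le: "length ?gs * SZ \<le> num_gadgets n * SZ" using length_gadgets_le[OF cnf] by (rule mult_right_mono) simp
  have N_le: "N \<le> num_verts n" unfolding N_def num_verts_def using h_le gs_le by (rule add_mono)
  have b0: "bounded_state ?M s0" unfolding s0_def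
  proof (rule bounded_initial_state)
    fix x assume x: "x \<in> set (encode_cnf n \<phi>)"
    have lit: "encode_literal l \<le> 2 * n" if "cl \<in> set \<phi>" "l \<in> set cl" for cl l
    proof -
      have "fst l < n" using cnf that by (fastforce simp: k_cnf_def)
      then show ?thesis by (auto simp: encode_literal_def)
    qed
    have len: "length cl \<le> k" if "cl \<in> set \<phi>" for cl using cnf that by (auto simp: k_cnf_def)
    have "x = n \<or> x = length \<phi> \<or> (\<exists>cl\<in>set \<phi>. x = length cl \<or> (\<exists>l\<in>set cl. x = encode_literal l))"
      using x by (auto simp: encode_cnf_eq encode_clause_def)
    then have "x \<le> n \<or> x \<le> num_clauses n \<or> x \<le> k \<or> x \<le> 2 * n" using m_le lit len by auto
    then show "x \<le> ?M" unfolding value_bound_def by linarith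
  qed
  define K0 where "K0 = cost_bound (\<lambda>_. ?U) read_sizes"
  define K1 where "K1 = cost_bound (\<lambda>_. ?U) tables"
  define K2 where "K2 = cost_bound (\<lambda>_. ?U) emit_all"
  define K3 where "K3 = cost_bound (\<lambda>_. ?U) build"
  have sb: "step_bound n = K0 + K1 + K2 + K3" by (simp add: step_bound_def K0_def K1_def K2_def K3_def)
  have M1: "1 \<le> ?M" "consts_bound \<le> ?M" by (auto simp: value_bound_def)
  have blM: "bit_len ?M \<le> ?M + 1" by (rule bit_len_le_self)
  have pos: "1 \<le> 2 ^ j * ?M" "consts_bound \<le> 2 ^ j * ?M" for j
    using M1 by (auto intro: order_trans[OF _ mult_right_mono[of 1 "2 ^ j" ?M]])
  \<comment> \<open>Each phase adds its cost bound to the exponent in the bound on the values, so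
    that the exponent never exceeds \<open>step_bound n\<close>.\<close>
  have phase: "\<exists>u. exec (compile R) s u (lsem R s) \<and> u \<le> step_bound n * (1 + 2 * log_bound n) \<and>
      bounded_state (2 ^ (j + cost_bound (\<lambda>_. ?U) R) * ?M) (lsem R s)"
    if ph: "lwf R" "count_regs R \<inter> wregs R = {}" "\<And>m. m \<in> count_regs R \<Longrightarrow> regs s m \<le> ?U"
      "max_const R \<le> consts_bound" "bounded_state (2 ^ j * ?M) s" "j + cost_bound (\<lambda>_. ?U) R \<le> step_bound n" for R s j
  proof -
    let ?c = "cost_bound (\<lambda>_. ?U) R"
    have "max_const R \<le> 2 ^ j * ?M" using ph(4) pos(2)[of j] by simp
    then obtain u where u: "exec (compile R) s u (lsem R s)" "u \<le> ?c * (1 + 2 * (?c + bit_len (2 ^ j * ?M)))"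
      "bounded_state (2 ^ ?c * (2 ^ j * ?M)) (lsem R s)"
      using exec_compile_poly[OF ph(1,2,3) _ pos(1) ph(5)] by blast
    have "?c + bit_len (2 ^ j * ?M) \<le> log_bound n"
      using ph(6) blM bit_len_pow2_mult[OF M1(1), of j] by (simp add: log_bound_def)
    then have "?c * (1 + 2 * (?c + bit_len (2 ^ j * ?M))) \<le> step_bound n * (1 + 2 * log_bound n)"
      using ph(6) by (intro mult_mono) auto
    with u(2) have "u \<le> step_bound n * (1 + 2 * log_bound n)" by (rule order_trans)
    moreover have "2 ^ ?c * (2 ^ j * ?M) = 2 ^ (j + ?c) * ?M" by (simp add: power_add mult_ac)
    then have "bounded_state (2 ^ (j + ?c) * ?M) (lsem R s)" using u(3) by (simp only:)
    ultimately show ?thesis using u(1) by blast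
  qed
  obtain u0 where u0: "exec (compile read_sizes) s0 u0 s1" "u0 \<le> step_bound n * (1 + 2 * log_bound n)" "bounded_state (2 ^ K0 * ?M) s1"
    using phase[of read_sizes s0 0] static_read_sizes b0 by (auto simp: s1_def K0_def sb consts_bound_def)
  obtain u1 where u1: "exec (compile tables) s1 u1 s2" "u1 \<le> step_bound n * (1 + 2 * log_bound n)" "bounded_state (2 ^ (K0 + K1) * ?M) s2"
    using phase[of tables s1 K0] static_tables u0(3) s1(3) by (auto simp: s2_def K1_def sb consts_bound_def max_count_def)
  have dis2: "count_regs emit_all \<inter> wregs emit_all = {}" using static_emit_all(2,3) by auto
  have cnt2: "regs s2 m \<le> ?U" if "m \<in> count_regs emit_all" for m
  proof -
    have "m = yG \<or> m = yM" using that static_emit_all(2) by simp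
    then show ?thesis using t2(3) fr2[of yM] s1(4) m_le \<open>groups n \<le> n + 1\<close> by (auto simp: max_count_def)
  qed
  obtain u2 where u2: "exec (compile emit_all) s2 u2 s3" "u2 \<le> step_bound n * (1 + 2 * log_bound n)" "bounded_state (2 ^ (K0 + K1 + K2) * ?M) s3"
    using phase[OF static_emit_all(1) dis2 cnt2 _ u1(3)] by (auto simp: s3_def K2_def sb consts_bound_def)
  have dis3: "count_regs build \<inter> wregs build = {}" using static_build(2,3) by auto
  have cnt3: "regs s3 m \<le> ?U" if "m \<in> count_regs build" for m
  proof -
    have "regs s3 yE \<le> num_edges n" using num3(3) length_all_edges_le[OF cnf] by (simp add: holds_edges_def)
    moreover have "?h \<le> N" by (simp add: N_def)
    moreover have "m = yNUM \<or> m = yH \<or> m = yE" using that static_build(2) by simp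
    ultimately show ?thesis using num3(1) s3(2) N_le by (auto simp: max_count_def)
  qed
  obtain u3 where u3: "exec (compile build) s3 u3 s4" "u3 \<le> step_bound n * (1 + 2 * log_bound n)" "bounded_state (2 ^ (K0 + K1 + K2 + K3) * ?M) s4"
    using phase[OF static_build(1) dis3 cnt3 _ u2(3)] by (auto simp: s4_def K3_def sb consts_bound_def)
  let ?M4 = "2 ^ step_bound n * ?M"
  \<comment> \<open>Nothing is known about the solver except its running time, which therefore has
    to bound the values it leaves.\<close>
  have b5: "bounded_state (2 ^ tP * ?M4) s5"
    using exec_bounded_state[OF e5 u3(3)] pos(1) by (simp add: sb)
  have dis4: "count_regs decide \<inter> wregs decide = {}" using static_decide by auto
  have cnt4: "regs s5 m \<le> ?U" if "m \<in> count_regs decide" for m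
    using that static_decide(2) reg5(1) N_le by (auto simp: max_count_def)
  have eq5: "2 ^ tP * ?M4 = 2 ^ (tP + step_bound n) * ?M" by (simp add: power_add)
  have "max_const decide \<le> 2 ^ (tP + step_bound n) * ?M" using pos(2)[of "tP + step_bound n"] by (simp add: consts_bound_def)
  then obtain u5 where u5: "exec (compile decide) s5 u5 s6"
    "u5 \<le> decide_bound n * (1 + 2 * (decide_bound n + bit_len (2 ^ (tP + step_bound n) * ?M)))"
    using exec_compile_poly[OF static_decide(1) dis4 cnt4 _ pos(1) b5[unfolded eq5]] unfolding s6_def decide_bound_def by blast
  have "bit_len (2 ^ (tP + step_bound n) * ?M) \<le> tP + log_bound n"
    using bit_len_pow2_mult[OF M1(1)] blM by (simp add: log_bound_def)
  then have "u5 \<le> decide_bound n * (1 + 2 * (decide_bound n + (tP + log_bound n)))"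
    by (intro order_trans[OF u5(2)] mult_left_mono) auto
  moreover have "u0 + u1 + u2 + u3 \<le> 4 * (step_bound n * (1 + 2 * log_bound n))"
    using u0(2) u1(2) u2(2) u3(2) by linarith
  moreover have "exec (sat_program P) s0 (u0 + (u1 + (u2 + (u3 + (tP + u5))))) s6"
    unfolding sat_program_def
    by (rule exec.Seq[OF u0(1) exec.Seq[OF u1(1) exec.Seq[OF u2(1) exec.Seq[OF u3(1) exec.Seq[OF e5 u5(1)]]]]])
  then have "exec (sat_program P) s0 (u0 + u1 + u2 + u3 + tP + u5) s6" by (simp only: add.assoc)
  then have "computes (sat_program P) (encode_cnf n \<phi>) (u0 + u1 + u2 + u3 + tP + u5) (arrs s6 1)"
    unfolding computes_def s0_def by blast
  ultimately show ?thesis using out P(2) by blast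
qed

lemma poly_bounds:
  "poly_bounded (\<lambda>n. n) num_verts" "poly_bounded (\<lambda>n. n) step_bound" "poly_bounded (\<lambda>n. n) decide_bound"
  "poly_bounded (\<lambda>n. n) log_bound"
proof -
  note rules = poly_bounded_add poly_bounded_mult poly_bounded_power poly_bounded_const poly_bounded_size
  have cl: "poly_bounded (\<lambda>n. n) num_clauses" unfolding num_clauses_def by (intro rules)
  have ga: "poly_bounded (\<lambda>n. n) num_gadgets" unfolding num_gadgets_def by (intro rules cl)
  show ve: "poly_bounded (\<lambda>n. n) num_verts" unfolding num_verts_def by (intro rules ga)
  have ed: "poly_bounded (\<lambda>n. n) num_edges" unfolding num_edges_def by (intro rules ga)
  have mc: "poly_bounded (\<lambda>n. n) max_count" unfolding max_count_def by (intro rules cl ve ed)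
  have cb: "poly_bounded (\<lambda>n. n) (\<lambda>n. cost_bound (\<lambda>_. max_count n) R)" for R
    by (rule poly_bounded_compose[OF poly_bounded_cost_bound mc])
  show st: "poly_bounded (\<lambda>n. n) step_bound" unfolding step_bound_def by (intro poly_bounded_add cb)
  show "poly_bounded (\<lambda>n. n) decide_bound" unfolding decide_bound_def by (rule cb)
  have "poly_bounded (\<lambda>n. n) value_bound" unfolding value_bound_def by (intro rules cl)
  then show "poly_bounded (\<lambda>n. n) log_bound" unfolding log_bound_def by (intro rules st)
qed

lemma num_verts_ge: "k_cnf k n \<phi> \<Longrightarrow> groups n * t + length (gadgets n \<phi>) * SZ \<le> num_verts n"
  unfolding num_verts_def using length_gadgets_le[of n \<phi>]
  by (intro add_mono mult_right_mono) (auto simp: groups_def)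

text \<open>With \<open>p = groups n * t\<close>, the factor \<open>B ^ p\<close> equals
  \<open>B ^ t * (B ^ t) ^ (n div b)\<close>. This is at most the constant \<open>B ^ t\<close>
  times the \<open>n\<close>-th power of the \<open>b\<close>-th root of
  \<open>B ^ t\<close>.\<close>

theorem sat_from_deletion_solver:
  fixes base B :: real
  assumes solver: "\<And>G Q p. input_graph G \<and> hub SZ (Suc k * t) G Q \<and> card Q \<le> p \<longrightarrow>
      solves_deletion_within P q G Q (base ^ p * poly_factor c (card (pverts G)))"
    and "0 \<le> base" "base \<le> B" "1 \<le> B"
  shows "\<exists>P' c'. \<forall>n \<phi>. k_cnf k n \<phi> \<longrightarrow> solves_sat_within P' n \<phi> (root b (B ^ t) ^ n * poly_factor c' n)"
proof -
  define \<rho> where "\<rho> = root b (B ^ t)"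
  have Bt: "1 \<le> B ^ t" using assms(4) by (rule one_le_power)
  have rho1: "1 \<le> \<rho>" unfolding \<rho>_def using Bt b1 by simp
  have rhob: "\<rho> ^ b = B ^ t" unfolding \<rho>_def using Bt b1 by (intro real_root_pow_pos2) auto
  \<comment> \<open>What remains of the solver's time after splitting off \<open>\<rho> ^ n\<close>;
    the ceiling keeps it a natural number.\<close>
  define D where "D n = nat \<lceil>B ^ t\<rceil> * (c * (num_verts n + 1) ^ c)" for n
  define Z where "Z n = 4 * (step_bound n * (1 + 2 * log_bound n)) + D n +
     decide_bound n * (1 + 2 * (decide_bound n + (D n + log_bound n)))" for n
  note rules = poly_bounded_add poly_bounded_mult poly_bounded_power poly_bounded_const poly_bounds
  have "poly_bounded (\<lambda>n. n) D" unfolding D_def by (intro rules)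
  then have "poly_bounded (\<lambda>n. n) Z" unfolding Z_def by (intro rules)
  then obtain c' where c': "\<And>n. Z n \<le> c' * (n + 1) ^ c'" by (auto simp: poly_bounded_def)
  have "solves_sat_within (sat_program P) n \<phi> (\<rho> ^ n * poly_factor c' n)" if cnf: "k_cnf k n \<phi>" for n \<phi>
  proof -
    interpret gi: gadget_instance q t "groups n * t" SZ "gadgets n \<phi>" unfolding SZ_def by (rule gadget_instance) fact
    let ?p = "groups n * t"
    define G where "G = instance_graph q ?p SZ (gadgets n \<phi>)"
    define N where "N = card (pverts G)"
    have N: "N = ?p + length (gadgets n \<phi>) * SZ" by (simp add: N_def G_def instance_graph_def)
    have "hub SZ (Suc k * t) G {..<?p}" unfolding G_def
      using length_gadget[OF cnf] by (intro gi.hub mult_right_mono) auto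
    then have "solves_deletion_within P q G {..<?p} (base ^ ?p * poly_factor c N)"
      using solver[of G "{..<?p}" ?p] gi.input_graph unfolding G_def N_def by simp
    then obtain t1 tP t2 out where r: "computes (sat_program P) (encode_cnf n \<phi>) (t1 + tP + t2) out"
      "out 0 = of_bool (satisfiable \<phi>)" "real tP \<le> base ^ ?p * poly_factor c N"
      "t1 \<le> 4 * (step_bound n * (1 + 2 * log_bound n))"
      "t2 \<le> decide_bound n * (1 + 2 * (decide_bound n + (tP + log_bound n)))"
      using sat_program_spec[OF cnf] unfolding G_def by blast
    have "base ^ ?p \<le> B ^ ?p" using assms(2,3) by (intro power_mono)
    also have "\<dots> = B ^ t * (\<rho> ^ b) ^ (n div b)"
      unfolding rhob groups_def by (simp add: power_add power_mult mult.commute)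
    also have "(\<rho> ^ b) ^ (n div b) = \<rho> ^ (b * (n div b))" by (simp add: power_mult)
    also have "\<rho> ^ (b * (n div b)) \<le> \<rho> ^ n" using rho1 by (intro power_increasing) auto
    finally have base_le: "base ^ ?p \<le> B ^ t * \<rho> ^ n" using Bt by simp
    have "N \<le> num_verts n" using num_verts_ge[OF cnf] N by simp
    then have "poly_factor c N \<le> real (c * (num_verts n + 1) ^ c)"
      unfolding poly_factor_def by (simp add: mult_left_mono power_mono)
    then have "base ^ ?p * poly_factor c N \<le> (B ^ t * \<rho> ^ n) * real (c * (num_verts n + 1) ^ c)"
      using base_le rho1 Bt by (intro mult_mono) (auto simp: poly_factor_def)
    also have "\<dots> \<le> (real (nat \<lceil>B ^ t\<rceil>) * \<rho> ^ n) * real (c * (num_verts n + 1) ^ c)"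
      using rho1 by (intro mult_right_mono real_nat_ceiling_ge) auto
    finally have tP: "real tP \<le> \<rho> ^ n * real (D n)" using r(3) by (simp add: D_def mult_ac)
    have R1: "1 \<le> \<rho> ^ n" using rho1 by (rule one_le_power)
    have up: "real x \<le> \<rho> ^ n * real x" for x :: nat using R1 by (simp add: mult_le_cancel_right1)
    let ?w = "decide_bound n"
    \<comment> \<open>The bound for the last phase is linear in \<open>tP\<close>, so the factor
      \<open>\<rho> ^ n\<close> enters only once.\<close>
    have "real t2 \<le> real (?w * (1 + 2 * (?w + log_bound n))) + real (2 * ?w) * real tP"
    proof -
      have "?w * (1 + 2 * (?w + (tP + log_bound n))) = ?w * (1 + 2 * (?w + log_bound n)) + 2 * ?w * tP"
        by (simp add: algebra_simps)
      then show ?thesis using r(5) by (metis of_nat_add of_nat_mono of_nat_mult)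
    qed
    also have "\<dots> \<le> \<rho> ^ n * real (?w * (1 + 2 * (?w + log_bound n))) + real (2 * ?w) * (\<rho> ^ n * real (D n))"
      by (intro add_mono up mult_left_mono tP) simp
    finally have "real t2 \<le> \<rho> ^ n * real (?w * (1 + 2 * (?w + (D n + log_bound n))))"
      by (simp add: algebra_simps)
    moreover have "real t1 \<le> \<rho> ^ n * real (4 * (step_bound n * (1 + 2 * log_bound n)))"
      using r(4) by (intro order_trans[OF _ up]) (simp only: of_nat_le_iff)
    ultimately have "real (t1 + tP + t2) \<le> \<rho> ^ n * real (Z n)"
      using tP unfolding Z_def of_nat_add distrib_left by linarith
    also have "\<dots> \<le> \<rho> ^ n * real (c' * (n + 1) ^ c')"
    proof (rule mult_left_mono)
      show "real (Z n) \<le> real (c' * (n + 1) ^ c')" using c'[of n] by (simp only: of_nat_le_iff)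
      show "0 \<le> \<rho> ^ n" using R1 by linarith
    qed
    also have "real (c' * (n + 1) ^ c') = poly_factor c' n" by (simp add: poly_factor_def add.commute)
    finally show ?thesis using r(1,2) unfolding solves_sat_within_def by blast
  qed
  then show ?thesis unfolding \<rho>_def by blast
qed

end

theorem hub_lower_bound:
  fixes \<epsilon> :: real
  assumes "1 \<le> q" "0 < \<epsilon>"
  shows "\<exists>\<sigma>\<ge>1. \<exists>\<delta>\<ge>1. (\<exists>P c. \<forall>G Q p. input_graph G \<and> hub \<sigma> \<delta> G Q \<and> card Q \<le> p \<longrightarrow>
      solves_deletion_within P q G Q ((real q + 1 - \<epsilon>) ^ p * poly_factor c (card (pverts G)))) \<longrightarrow> \<not> SETH"
proof (cases "SETH \<and> \<epsilon> \<le> real q + 1")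
  \<comment> \<open>If the SETH fails, there is nothing to show. If
    \<open>\<epsilon> > q + 1\<close>, the time allowed for \<open>p = 1\<close> is not positive,
    which the empty graph already refutes.\<close>
  case False
  have "\<not> solves_deletion_within P q G Q ((real q + 1 - \<epsilon>) ^ 1 * poly_factor c (card (pverts G)))"
    if "real q + 1 < \<epsilon>" for P c G Q
  proof
    assume "solves_deletion_within P q G Q ((real q + 1 - \<epsilon>) ^ 1 * poly_factor c (card (pverts G)))"
    then obtain u s where "exec P (initial_state (encode_instance G Q)) u s"
      "real u \<le> (real q + 1 - \<epsilon>) * poly_factor c (card (pverts G))"
      by (auto simp: solves_deletion_within_def computes_def)
    moreover have "(real q + 1 - \<epsilon>) * poly_factor c (card (pverts G)) \<le> 0"
      using that by (intro mult_nonpos_nonneg) (auto simp: poly_factor_def)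
    ultimately show False using exec_cost_pos by fastforce
  qed
  moreover have "\<exists>G Q. input_graph G \<and> hub 1 1 G Q \<and> card Q \<le> 1"
  proof -
    interpret gadget_instance q 1 0 1 "[]" using assms(1) by unfold_locales auto
    have "hub 1 1 G {..<0}" by (rule hub) simp
    then show ?thesis using input_graph by (intro exI[of _ G] exI[of _ "{}"]) simp
  qed
  ultimately have no: "\<nexists>P c. \<forall>G Q p. input_graph G \<and> hub 1 1 G Q \<and> card Q \<le> p \<longrightarrow>
      solves_deletion_within P q G Q ((real q + 1 - \<epsilon>) ^ p * poly_factor c (card (pverts G)))"
    if "real q + 1 < \<epsilon>" using that by blast
  have "\<not> SETH \<or> real q + 1 < \<epsilon>" using False by linarith
  then show ?thesis using no by (intro exI[of _ "1::nat"] conjI order_refl) blast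
next
  case True
  define base where "base = real q + 1 - \<epsilon>"
  \<comment> \<open>A base below \<open>1\<close> is raised to \<open>1\<close>: this only weakens
    the time bound and makes its powers monotone.\<close>
  define B where "B = max 1 base"
  have B: "1 \<le> B" "B < real q + 1" "base \<le> B" "0 \<le> base" using assms True by (auto simp: B_def base_def)
  obtain t z b enc where code: "coded_formulas q t z b enc" "B ^ t < 2 ^ b"
    using ex_coded_formulas[OF assms(1) B(1,2)] by blast
  interpret coded_formulas q t z b enc by (fact code(1))
  \<comment> \<open>The size of the code enters here: \<open>B ^ t < 2 ^ b\<close> is what puts the
    base of the SAT algorithm below \<open>2\<close>.\<close>
  have "root b (B ^ t) < root b (2 ^ b)" using code(2) b1 by (intro real_root_less_mono) auto
  also have "root b (2 ^ b) = 2" using b1 by (intro real_root_power_cancel) auto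
  finally have "0 < 2 - root b (B ^ t)" by simp
  then obtain k where k: "\<nexists>P c. \<forall>n \<phi>. k_cnf k n \<phi> \<longrightarrow> solves_sat_within P n \<phi> ((2 - (2 - root b (B ^ t))) ^ n * poly_factor c n)"
    using True unfolding SETH_def by blast
  interpret reduction q t z b enc k by unfold_locales
  have "1 \<le> SZ" using q1 by (simp add: SZ_def gadget_size_def)
  moreover have "1 \<le> Suc k * t" using t1 by simp
  moreover have "\<nexists>P c. \<forall>G Q p. input_graph G \<and> hub SZ (Suc k * t) G Q \<and> card Q \<le> p \<longrightarrow>
      solves_deletion_within P q G Q (base ^ p * poly_factor c (card (pverts G)))"
    using sat_from_deletion_solver[OF _ B(4,3,1)] k by (metis diff_diff_eq2 add_diff_cancel_left')
  ultimately show ?thesis unfolding base_def by blast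
qed

theorem theorem1p4:
  fixes q :: nat
  assumes "q \<ge> 1"
  shows "(\<forall>\<sigma>\<ge>1. \<forall>\<delta>\<ge>1. \<exists>P c. \<forall>G Q p.
            input_graph G \<and> hub \<sigma> \<delta> G Q \<and> card Q = p \<longrightarrow>
            solves_deletion_within P q G Q
              ((real q + 1) ^ p * poly_factor c (card (pverts G))))
       \<and> (\<forall>\<epsilon>::real > 0. \<exists>\<sigma>\<ge>1. \<exists>\<delta>\<ge>1.
            (\<exists>P c. \<forall>G Q p.
               input_graph G \<and> hub \<sigma> \<delta> G Q \<and> card Q \<le> p \<longrightarrow>
               solves_deletion_within P q G Q
                 ((real q + 1 - \<epsilon>) ^ p * poly_factor c (card (pverts G))))
            \<longrightarrow> \<not> SETH)"
  using hub_algorithm hub_lower_bound[OF assms] by blast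

end
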